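(* Let $\Phi$ be a finite or affine simply-laced root system with positive roots $\Phi^+$ in the vector space $V$. Take any ordering $\gamma_1,\gamma_2,\gamma_3,\ldots$ of $\Phi^+$ which refines the root poset on $\Phi^+$. Then this ordering is suitable (as an ordering of the set $X=\Phi^+\subseteq V$).
   Context: Root systems are (symmetrizable, crystallographic, real, reduced) root systems in a real vector space $V$ with symmetric bilinear form, base $\Pi$, positive roots $\Phi^+=\Phi\cap\mathrm{Span}_+\Pi$ ($\mathrm{Span}_+$ = nonnegative combinations); affine root systems have all irreducible components finite or affine (at least one affine), imaginary roots excluded; simply-laced means all Cartan matrix entries off the diagonal are $0$ or $-1$ (types $A,D,E$ and their affine versions, including $\widetilde A_n$). Root poset: $\alpha\le\beta$ iff $\beta-\alpha\in\mathrm{Span}_+\Pi$. For $Z\subseteq V$, $B\subseteq Z$: closed in $Z$ if $\alpha,\beta\in B$, $\gamma\in\mathrm{Span}_+(\alpha,\beta)\cap Z$ imply $\gamma\in B$; coclosed if $Z\setminus B$ closed; biclosed if both; weakly separable if $\mathrm{Span}_+(B)\cap\mathrm{Span}_+(Z\setminus B)=\{0\}$; $Z$ clean if every biclosed subset is weakly separable. For $X\subseteq V$: a linear subset is $X\cap L$ for a subspace $L$; a $2$-dimensional linear subset $Y$ has fundamental vectors $\alpha,\beta\in Y$ if $Y\subseteq\mathrm{Span}_+\{\alpha,\beta\}$ and neither lies in the nonnegative span of the other elements of $Y$; $F\subseteq X$ is full if $F\cap\mathrm{Span}\{\alpha,\beta\}=X\cap\mathrm{Span}\{\alpha,\beta\}$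 for all $\alpha,\beta\in F$. An ordering $\gamma_1,\gamma_2,\ldots$ of $X$ with initial segments $X_i=\{\gamma_1,\ldots,\gamma_i\}$ is suitable if (1) in every $2$-dimensional linear subset the fundamental vectors precede all its other vectors, and (2) for every $i$ and $\alpha,\beta,\gamma\in X_i$ there is a full $F\subseteq X$ containing them with $F\cap X_i$ clean. *)

theory Defs
  imports "HOL-Analysis.Analysis"
begin

definition nnspan :: "'a::real_vector set \<Rightarrow> 'a set" where
  "nnspan S = {v. \<exists>F c. finite F \<and> F \<subseteq> S \<and> (\<forall>x\<in>F. 0 \<le> c x) \<and>
                       v = (\<Sum>x\<in>F. c x *\<^sub>R x)}"

text \<open>Reflection in the simple root a (B a a = 2).\<close>
definition refl :: "('a::real_vector \<Rightarrow> 'a \<Rightarrow> real) \<Rightarrow> 'a \<Rightarrow> 'a \<Rightarrow> 'a" where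
  "refl B a v = v - B a v *\<^sub>R a"

text \<open>The (real) roots: the orbit of the base under the Weyl group generated by
  the simple reflections.\<close>
inductive_set roots :: "('a::real_vector \<Rightarrow> 'a \<Rightarrow> real) \<Rightarrow> 'a set \<Rightarrow> 'a set"
  for B :: "'a \<Rightarrow> 'a \<Rightarrow> real" and P :: "'a set" where
  simple: "a \<in> P \<Longrightarrow> a \<in> roots B P"
| reflect: "b \<in> roots B P \<Longrightarrow> a \<in> P \<Longrightarrow> refl B a b \<in> roots B P"

definition pos_roots :: "('a::real_vector \<Rightarrow> 'a \<Rightarrow> real) \<Rightarrow> 'a set \<Rightarrow> 'a set" where
  "pos_roots B P = roots B P \<inter> nnspan P"

definition simply_laced_base :: "('a::real_vector \<Rightarrow> 'a \<Rightarrow> real) \<Rightarrow> 'a set \<Rightarrow> bool" where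
  "simply_laced_base B P \<longleftrightarrow>
     bilinear B \<and> (\<forall>u v. B u v = B v u) \<and> finite P \<and> independent P \<and>
     (\<forall>a\<in>P. B a a = 2) \<and>
     (\<forall>a\<in>P. \<forall>b\<in>P. a \<noteq> b \<longrightarrow> B a b = 0 \<or> B a b = -1)"

definition component :: "('a::real_vector \<Rightarrow> 'a \<Rightarrow> real) \<Rightarrow> 'a set \<Rightarrow> 'a \<Rightarrow> 'a set" where
  "component B P a = {b \<in> P. (a, b) \<in> ({(x, y). x \<in> P \<and> y \<in> P \<and> B x y \<noteq> 0})\<^sup>*}"

definition finite_type_comp :: "('a::real_vector \<Rightarrow> 'a \<Rightarrow> real) \<Rightarrow> 'a set \<Rightarrow> bool" where
  "finite_type_comp B C \<longleftrightarrow> (\<forall>v\<in>span C. v \<noteq> 0 \<longrightarrow> 0 < B v v)"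

definition affine_type_comp :: "('a::real_vector \<Rightarrow> 'a \<Rightarrow> real) \<Rightarrow> 'a set \<Rightarrow> bool" where
  "affine_type_comp B C \<longleftrightarrow> (\<forall>v\<in>span C. 0 \<le> B v v) \<and> \<not> finite_type_comp B C"

definition fin_or_aff_simply_laced :: "('a::real_vector \<Rightarrow> 'a \<Rightarrow> real) \<Rightarrow> 'a set \<Rightarrow> bool" where
  "fin_or_aff_simply_laced B P \<longleftrightarrow> simply_laced_base B P \<and>
     (\<forall>a\<in>P. finite_type_comp B (component B P a) \<or> affine_type_comp B (component B P a))"

definition closed_in :: "'a::real_vector set \<Rightarrow> 'a set \<Rightarrow> bool" where
  "closed_in Z S \<longleftrightarrow> (\<forall>a\<in>S. \<forall>b\<in>S. \<forall>c\<in>Z. c \<in> nnspan {a, b} \<longrightarrow> c \<in> S)"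

definition biclosed_in :: "'a::real_vector set \<Rightarrow> 'a set \<Rightarrow> bool" where
  "biclosed_in Z S \<longleftrightarrow> S \<subseteq> Z \<and> closed_in Z S \<and> closed_in Z (Z - S)"

definition weakly_separable :: "'a::real_vector set \<Rightarrow> 'a set \<Rightarrow> bool" where
  "weakly_separable Z S \<longleftrightarrow> nnspan S \<inter> nnspan (Z - S) = {0}"

definition clean :: "'a::real_vector set \<Rightarrow> bool" where
  "clean Z \<longleftrightarrow> (\<forall>S. biclosed_in Z S \<longrightarrow> weakly_separable Z S)"

definition linear_subset :: "'a::real_vector set \<Rightarrow> 'a set \<Rightarrow> bool" where
  "linear_subset X Y \<longleftrightarrow> (\<exists>L. subspace L \<and> Y = X \<inter> L)"

definition fundamental_vectors :: "'a::real_vector set \<Rightarrow> 'a \<Rightarrow> 'a \<Rightarrow> bool" where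
  "fundamental_vectors Y a b \<longleftrightarrow> a \<in> Y \<and> b \<in> Y \<and> Y \<subseteq> nnspan {a, b} \<and>
     a \<notin> nnspan (Y - {a}) \<and> b \<notin> nnspan (Y - {b})"

definition full :: "'a::real_vector set \<Rightarrow> 'a set \<Rightarrow> bool" where
  "full X F \<longleftrightarrow> F \<subseteq> X \<and> (\<forall>a\<in>F. \<forall>b\<in>F. F \<inter> span {a, b} = X \<inter> span {a, b})"

text \<open>An ordering \<gamma>_1, \<gamma>_2, ... of X is encoded as a bijection g from a downward
  closed set N of naturals (i.e. {..<n} or all of \<nat>) onto X; position 0 is \<gamma>_1.
  The initial segment X_i = {\<gamma>_1,...,\<gamma>_i} is g ` ({..<i} \<inter> N).\<close>
definition ordering_of :: "(nat \<Rightarrow> 'a) \<Rightarrow> nat set \<Rightarrow> 'a set \<Rightarrow> bool" where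
  "ordering_of g N X \<longleftrightarrow> bij_betw g N X \<and> (\<forall>i\<in>N. \<forall>j<i. j \<in> N)"

definition suitable :: "(nat \<Rightarrow> 'a::real_vector) \<Rightarrow> nat set \<Rightarrow> 'a set \<Rightarrow> bool" where
  "suitable g N X \<longleftrightarrow> ordering_of g N X \<and>
     (\<forall>Y a b. linear_subset X Y \<and> dim (span Y) = 2 \<and> fundamental_vectors Y a b \<longrightarrow>
        (\<forall>i\<in>N. \<forall>j\<in>N. (g i = a \<or> g i = b) \<and> g j \<in> Y - {a, b} \<longrightarrow> i < j)) \<and>
     (\<forall>i. \<forall>a\<in>g ` ({..<i} \<inter> N). \<forall>b\<in>g ` ({..<i} \<inter> N). \<forall>c\<in>g ` ({..<i} \<inter> N).
        \<exists>F. full X F \<and> a \<in> F \<and> b \<in> F \<and> c \<in> F \<and> clean (F \<inter> g ` ({..<i} \<inter> N)))"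

definition refines_root_poset :: "'a::real_vector set \<Rightarrow> (nat \<Rightarrow> 'a) \<Rightarrow> nat set \<Rightarrow> bool" where
  "refines_root_poset P g N \<longleftrightarrow>
     (\<forall>i\<in>N. \<forall>j\<in>N. g i \<noteq> g j \<and> g j - g i \<in> nnspan P \<longrightarrow> i < j)"

end

theory Submission
  imports Defs
begin

text \<open>
  In these types the roots are exactly the lattice vectors of norm 2 lying in the span of one
  component. In a plane with fundamental roots a, b no root has coefficients of mixed sign; this
  forces every other positive root c of the plane to satisfy c - a, c - b \<open>\<in>\<close> nnspan P.

  For cleanness, the initial segments are order ideals. Let F be the set of positive roots in the
  span of three given ones. If the form is definite there, a violation of weak separability of S and its
  complement T gives an integral relation between elements of S and of T; the common
  value has positive norm, so some s in S and t in T have inner product 1,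
  and replacing the larger of the two by their difference and dropping the smaller one shortens the relation. If the span is isotropic, then
  (up to replacing F by a smaller full set) F is contained in an affine plane together with at most one
  orthogonal root, or is of affine type A2. In the latter case F consists
  of the roots a + kd and (k + 1)d - a, with a ranging over three simple roots of sum d: in the projective plane these lie
  on three lines through the point d. Each line is cut by S; closedness shows that S and T
  cannot both surround d, and a separating functional is found by solving a system of
  inequalities for two of its values.
\<close>

section \<open>Nonnegative spans and linear functionals\<close>

text \<open>The obstacle is that the form is only semidefinite. Shortening a relation needs a common
  value of positive norm and no pairing 2 between distinct roots; both can fail once the span
  contains an isotropic vector. For three roots this happens in two ways. Two of them may have
  pairing 2 or -2, and then differ, up to sign, by an isotropic vector. Otherwise the pairings r, s,
  t lie in {-1, 0, 1}, and the Gram determinant 8 - 2 (r r + s s + t t) + 2 r s t vanishes only for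
  r s t = -1, which produces affine A2.

  A smaller full set is needed when the third root c is orthogonal to an affine plane containing d:
  the span of all three can contain every root c + kd. The plane together with c alone avoids these
  and is still full, because two orthogonal positive roots span no further positive root.

  In type A2, S and T are exchanged if necessary so that, apart from one degenerate case, the
  functional can be given the value 1 at d. On each line its sign is then governed by one threshold,
  and the thresholds x, y, x + y are the only unknowns left.\<close>

lemma nnspan_finite:
  assumes "finite S"
  shows "v \<in> nnspan S \<longleftrightarrow> (\<exists>c. (\<forall>x\<in>S. 0 \<le> c x) \<and> v = (\<Sum>x\<in>S. c x *\<^sub>R x))"
proof
  assume "v \<in> nnspan S"
  then obtain F c where F: "finite F" "F \<subseteq> S" "\<forall>x\<in>F. 0 \<le> c x" "v = (\<Sum>x\<in>F. c x *\<^sub>R x)"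
    unfolding nnspan_def by blast
  let ?c = "\<lambda>x. if x \<in> F then c x else 0"
  have "(\<Sum>x\<in>S. ?c x *\<^sub>R x) = (\<Sum>x\<in>F. c x *\<^sub>R x)"
    using assms F by (intro sum.mono_neutral_cong_right) auto
  then show "\<exists>c. (\<forall>x\<in>S. 0 \<le> c x) \<and> v = (\<Sum>x\<in>S. c x *\<^sub>R x)"
    using F by (intro exI[of _ ?c]) auto
next
  assume "\<exists>c. (\<forall>x\<in>S. 0 \<le> c x) \<and> v = (\<Sum>x\<in>S. c x *\<^sub>R x)"
  then show "v \<in> nnspan S" unfolding nnspan_def using assms by blast
qed

lemma nnspan_mono: "S \<subseteq> T \<Longrightarrow> nnspan S \<subseteq> nnspan T"
  unfolding nnspan_def by blast

lemma nnspan_0: "0 \<in> nnspan S"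
  unfolding nnspan_def by (simp, rule exI[of _ "{}"]) simp

lemma nnspan_pair: "v \<in> nnspan {a, b} \<longleftrightarrow> (\<exists>x y. 0 \<le> x \<and> 0 \<le> y \<and> v = x *\<^sub>R a + y *\<^sub>R b)"
proof (cases "a = b")
  case True
  have "(\<exists>c\<ge>0. v = c *\<^sub>R b) \<longleftrightarrow> (\<exists>x y. 0 \<le> x \<and> 0 \<le> y \<and> v = x *\<^sub>R b + y *\<^sub>R b)"
  proof
    assume "\<exists>c\<ge>0. v = c *\<^sub>R b"
    then obtain c where "0 \<le> c" "v = c *\<^sub>R b + 0 *\<^sub>R b" by auto
    then show "\<exists>x y. 0 \<le> x \<and> 0 \<le> y \<and> v = x *\<^sub>R b + y *\<^sub>R b" by blast
  next
    assume "\<exists>x y. 0 \<le> x \<and> 0 \<le> y \<and> v = x *\<^sub>R b + y *\<^sub>R b"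
    then obtain x y where "0 \<le> x" "0 \<le> y" "v = x *\<^sub>R b + y *\<^sub>R b" by blast
    then have "0 \<le> x + y" "v = (x + y) *\<^sub>R b" by (simp_all add: scaleR_add_left)
    then show "\<exists>c\<ge>0. v = c *\<^sub>R b" by blast
  qed
  moreover have "(\<exists>c. 0 \<le> c b \<and> v = c b *\<^sub>R b) \<longleftrightarrow> (\<exists>c\<ge>0. v = c *\<^sub>R b)"
    by (auto intro: exI[of _ "\<lambda>_. c" for c])
  ultimately show ?thesis using True by (simp add: nnspan_finite)
next
  case False
  have "(\<exists>c. 0 \<le> c a \<and> 0 \<le> c b \<and> v = c a *\<^sub>R a + c b *\<^sub>R b) \<longleftrightarrow>
      (\<exists>x y. 0 \<le> x \<and> 0 \<le> y \<and> v = x *\<^sub>R a + y *\<^sub>R b)"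
    using False by (auto intro: exI[of _ "\<lambda>u. if u = a then x else y" for x y])
  with False show ?thesis by (simp add: nnspan_finite)
qed

lemma linear_nnspan_nonneg:
  assumes "linear f" "\<And>x. x \<in> S \<Longrightarrow> 0 \<le> f x" "v \<in> nnspan S"
  shows "(0::real) \<le> f v"
proof -
  obtain F c where "finite F" "F \<subseteq> S" "\<forall>x\<in>F. 0 \<le> c x" "v = (\<Sum>x\<in>F. c x *\<^sub>R x)"
    using assms(3) unfolding nnspan_def by blast
  then show ?thesis using assms(1,2)
    by (auto simp: linear_sum[OF assms(1)] linear_cmul[OF assms(1)] intro!: sum_nonneg mult_nonneg_nonneg)
qed

lemma linear_nnspan_eq_0:
  assumes "linear f" "\<And>x. x \<in> S \<Longrightarrow> 0 < f x" "v \<in> nnspan S" "f v = (0::real)"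
  shows "v = 0"
proof -
  obtain F c where F: "finite F" "F \<subseteq> S" "\<forall>x\<in>F. 0 \<le> c x" "v = (\<Sum>x\<in>F. c x *\<^sub>R x)"
    using assms(3) unfolding nnspan_def by blast
  then have "(\<Sum>x\<in>F. c x * f x) = 0"
    using assms(1,4) by (simp add: linear_sum[OF assms(1)] linear_cmul[OF assms(1)])
  then have "\<forall>x\<in>F. c x * f x = 0"
    using F assms(2) by (subst (asm) sum_nonneg_eq_0_iff) (auto intro!: mult_nonneg_nonneg intro: less_imp_le)
  then have "\<forall>x\<in>F. c x = 0" using F assms(2) by (metis less_irrefl mult_eq_0_iff subsetD)
  then show ?thesis using F by simp
qed

lemma weakly_separable_linear:
  assumes f: "linear f" and "\<And>x. x \<in> S \<Longrightarrow> 0 < f x" "\<And>x. x \<in> Z - S \<Longrightarrow> f x < (0::real)"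
  shows "weakly_separable Z S"
proof -
  have "v = 0" if v: "v \<in> nnspan S" "v \<in> nnspan (Z - S)" for v
  proof -
    have "0 \<le> f v" using linear_nnspan_nonneg[OF f _ v(1)] assms(2) by fastforce
    moreover have "0 \<le> - f v"
      using linear_nnspan_nonneg[OF linear_compose_neg[OF f] _ v(2)] assms(3) by fastforce
    ultimately show ?thesis using linear_nnspan_eq_0[OF f assms(2) v(1)] by simp
  qed
  then show ?thesis unfolding weakly_separable_def using nnspan_0 by blast
qed

section \<open>Cuts of three concurrent lines\<close>

text \<open>Fourier-Motzkin elimination for bounds on x, y and x + y: the hypotheses compare lower
  with upper bounds. The extreme bounds leave room for a value s of x + y, and moving x and y
  through the same fraction t of their intervals attains it.\<close>

lemma exists_pair_with_sum_between:
  fixes A A' C C' E E' :: "real set"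
  assumes fin: "finite A" "finite A'" "finite C" "finite C'" "finite E" "finite E'"
    and ne: "A \<noteq> {}" "A' \<noteq> {}" "C \<noteq> {}" "C' \<noteq> {}" "E \<noteq> {}" "E' \<noteq> {}"
    and "\<And>a a'. a \<in> A \<Longrightarrow> a' \<in> A' \<Longrightarrow> a < a'"
    and "\<And>c c'. c \<in> C \<Longrightarrow> c' \<in> C' \<Longrightarrow> c < c'"
    and "\<And>e e'. e \<in> E \<Longrightarrow> e' \<in> E' \<Longrightarrow> e < e'"
    and "\<And>a c e'. a \<in> A \<Longrightarrow> c \<in> C \<Longrightarrow> e' \<in> E' \<Longrightarrow> a + c < e'"
    and "\<And>a' c' e. a' \<in> A' \<Longrightarrow> c' \<in> C' \<Longrightarrow> e \<in> E \<Longrightarrow> e < a' + c'"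
  obtains x y where "\<And>a. a \<in> A \<Longrightarrow> a < x" "\<And>a'. a' \<in> A' \<Longrightarrow> x < a'"
    "\<And>c. c \<in> C \<Longrightarrow> c < y" "\<And>c'. c' \<in> C' \<Longrightarrow> y < c'"
    "\<And>e. e \<in> E \<Longrightarrow> e < x + y" "\<And>e'. e' \<in> E' \<Longrightarrow> x + y < e'"
proof -
  define a a' c c' e e' where "a = Max A" "a' = Min A'" "c = Max C" "c' = Min C'" "e = Max E" "e' = Min E'"
  note defs = this
  have mem: "a \<in> A" "a' \<in> A'" "c \<in> C" "c' \<in> C'" "e \<in> E" "e' \<in> E'"
    unfolding defs using fin ne by auto
  have lt: "a < a'" "c < c'" "e < e'" "a + c < e'" "e < a' + c'" using mem assms by blast+
  define s where "s = (max (a + c) e + min (a' + c') e') / 2"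
  have s: "a + c < s" "e < s" "s < a' + c'" "s < e'" unfolding s_def max_def min_def using lt by (auto simp: field_simps)
  define t where "t = (s - a - c) / (a' + c' - a - c)"
  have t: "0 < t" "t < 1" unfolding t_def using s lt by (simp_all add: field_simps)
  have t_eq: "t * (a' + c' - a - c) = s - a - c" unfolding t_def using lt by simp
  define x y where "x = a + t * (a' - a)" "y = c + t * (c' - c)"
  note xy = this
  have "x + y = s" using t_eq by (simp add: xy algebra_simps)
  moreover have "a < x" "c < y" using t lt by (simp_all add: xy)
  moreover have "t * (a' - a) < a' - a" "t * (c' - c) < c' - c" using t lt by simp_all
  then have "x < a'" "y < c'" by (simp_all add: xy)
  ultimately show thesis using s fin ne
    by (intro that[of x y]) (auto simp: defs)
qed

text \<open>
  For i in I, the index k stands for the root i + kd on the A-ray and (k + 1)d - i on the opposite E-ray,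
  where d is the sum of the three elements of I. SA, SE and TA, TE record which of these roots lie in S and T.
\<close>

locale hexagon_cut =
  fixes I :: "'i set" and SA SE TA TE :: "'i \<Rightarrow> nat \<Rightarrow> bool" and L :: nat
  assumes card_I: "card I = 3"
    and disjoint_A: "SA i k \<Longrightarrow> TA i k \<Longrightarrow> False"
    and disjoint_E: "SE i k \<Longrightarrow> TE i k \<Longrightarrow> False"
    and bound_A: "SA i k \<or> TA i k \<Longrightarrow> k < L"
    and bound_E: "SE i k \<or> TE i k \<Longrightarrow> k < L"
    and A_le_A: "i \<in> I \<Longrightarrow> SA i k \<or> TA i k \<Longrightarrow> p \<le> k \<Longrightarrow> SA i p \<or> TA i p"
    and E_le_E: "i \<in> I \<Longrightarrow> SE i k \<or> TE i k \<Longrightarrow> p \<le> k \<Longrightarrow> SE i p \<or> TE i p"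
    and E_less_A: "i \<in> I \<Longrightarrow> j \<in> I \<Longrightarrow> SA i k \<or> TA i k \<Longrightarrow> p < k \<Longrightarrow> SE j p \<or> TE j p"
    and A_less_E: "i \<in> I \<Longrightarrow> SE i k \<or> TE i k \<Longrightarrow> p < k \<Longrightarrow> SA i p \<or> TA i p"
    and A_le_E: "i \<in> I \<Longrightarrow> j \<in> I \<Longrightarrow> i \<noteq> j \<Longrightarrow> SE i k \<or> TE i k \<Longrightarrow> p \<le> k \<Longrightarrow> SA j p \<or> TA j p"
    and S_AAE: "\<lbrakk>i \<in> I; j \<in> I; l \<in> I; distinct [i, j, l]; SA i p; SA j q; TE l (p + q)\<rbrakk> \<Longrightarrow> False"
    and T_AAE: "\<lbrakk>i \<in> I; j \<in> I; l \<in> I; distinct [i, j, l]; TA i p; TA j q; SE l (p + q)\<rbrakk> \<Longrightarrow> False"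
    and S_EEA: "\<lbrakk>i \<in> I; j \<in> I; l \<in> I; distinct [i, j, l]; SE i p; SE j q; TA l (Suc (p + q))\<rbrakk> \<Longrightarrow> False"
    and T_EEA: "\<lbrakk>i \<in> I; j \<in> I; l \<in> I; distinct [i, j, l]; TE i p; TE j q; SA l (Suc (p + q))\<rbrakk> \<Longrightarrow> False"
    and S_AE_A: "\<lbrakk>i \<in> I; SA i p; SE i q; TA i m; p < m\<rbrakk> \<Longrightarrow> False"
    and T_AE_A: "\<lbrakk>i \<in> I; TA i p; TE i q; SA i m; p < m\<rbrakk> \<Longrightarrow> False"
    and S_EA_E: "\<lbrakk>i \<in> I; SE i p; SA i q; TE i m; p < m\<rbrakk> \<Longrightarrow> False"
    and T_EA_E: "\<lbrakk>i \<in> I; TE i p; TA i q; SE i m; p < m\<rbrakk> \<Longrightarrow> False"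
begin

text \<open>The hypotheses of the locale are symmetric or come in pairs exchanged by S and T, so
  every statement proved for S is available for T by interpreting this fact.\<close>

lemma swap: "hexagon_cut I TA TE SA SE L"
proof (unfold_locales, goal_cases)
  case 1 show ?case by (rule card_I)
next
  case 2 then show ?case by (metis disjoint_A)
next
  case 3 then show ?case by (metis disjoint_E)
next
  case 4 then show ?case by (metis bound_A)
next
  case 5 then show ?case by (metis bound_E)
next
  case 6 then show ?case by (metis A_le_A)
next
  case 7 then show ?case by (metis E_le_E)
next
  case 8 then show ?case by (metis E_less_A)
next
  case 9 then show ?case by (metis A_less_E)
next
  case 10 then show ?case by (metis A_le_E)
next
  case 11 then show ?case by (rule T_AAE)
next
  case 12 then show ?case by (rule S_AAE)
next
  case 13 then show ?case by (rule T_EEA)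
next
  case 14 then show ?case by (rule S_EEA)
next
  case 15 then show ?case by (rule T_AE_A)
next
  case 16 then show ?case by (rule S_AE_A)
next
  case 17 then show ?case by (rule T_EA_E)
next
  case 18 then show ?case by (rule S_EA_E)
qed

definition triple :: "'i \<Rightarrow> 'i \<Rightarrow> 'i \<Rightarrow> bool" where
  "triple i j l \<longleftrightarrow> i \<in> I \<and> j \<in> I \<and> l \<in> I \<and> distinct [i, j, l]"

lemma triple_swap: "triple i j l \<Longrightarrow> triple j i l" "triple i j l \<Longrightarrow> triple i l j"
  by (auto simp: triple_def)

lemma triple_mem: assumes "triple i j l" shows "i \<in> I" "j \<in> I" "l \<in> I" "i \<noteq> j" "j \<noteq> i" "i \<noteq> l" "l \<noteq> i" "j \<noteq> l" "l \<noteq> j"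
  using assms by (auto simp: triple_def)

text \<open>The index of the sum is a variable \<open>n\<close> with an equation, so that these
  rules apply to an index of any form and leave the arithmetic to the simplifier.\<close>

lemma S_AAE': "triple i j l \<Longrightarrow> SA i p \<Longrightarrow> SA j q \<Longrightarrow> n = p + q \<Longrightarrow> TE l n \<Longrightarrow> False"
  using S_AAE unfolding triple_def by blast
lemma T_AAE': "triple i j l \<Longrightarrow> TA i p \<Longrightarrow> TA j q \<Longrightarrow> n = p + q \<Longrightarrow> SE l n \<Longrightarrow> False"
  using T_AAE unfolding triple_def by blast
lemma S_EEA': "triple i j l \<Longrightarrow> SE i p \<Longrightarrow> SE j q \<Longrightarrow> n = Suc (p + q) \<Longrightarrow> TA l n \<Longrightarrow> False"
  using S_EEA unfolding triple_def by blast
lemma T_EEA': "triple i j l \<Longrightarrow> TE i p \<Longrightarrow> TE j q \<Longrightarrow> n = Suc (p + q) \<Longrightarrow> SA l n \<Longrightarrow> False"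
  using T_EEA unfolding triple_def by blast

text \<open>On one line, A-roots of index above p lie between the A-root of index p and any E-root.
  If S and T both occurred on both rays, an S-root and a T-root of the A-ray could be compared
  neither way: the one closer to d would be enclosed by the other set.\<close>

lemma both_sides_S:
  assumes "i \<in> I" "SA i k" "SE i m"
  shows "(\<forall>k. \<not> TA i k) \<or> (\<forall>k. \<not> TE i k)"
  by (metis assms S_AE_A T_AE_A disjoint_A linorder_neqE_nat)

text \<open>The A-root of index 0 on the third line fits nowhere. In T, adding it to a T-root on the
  A-ray of \<open>j\<close> gives the E-root of \<open>i\<close> in S; in S, adding it to an S-root
  on the A-ray of \<open>i\<close> gives the E-root of \<open>j\<close> in T.\<close>

lemma crossing_A_A:
  assumes t: "triple i j l" and "\<And>k. \<not> TA i k" "\<And>k. \<not> SA j k" "SE i m" "TE j n"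
  shows False
proof (cases "TA l 0")
  case True
  have "TA j m" using A_le_E[of i j m m] assms triple_mem[OF t] by auto
  then show False using T_AAE'[OF triple_swap(2)[OF triple_swap(1)[OF t]] _ True, of m m] assms by auto
next
  case False
  then have "SA l 0" using A_le_E[of i l m 0] assms triple_mem[OF t] by auto
  moreover have "SA i n" using A_le_E[of j i n n] assms triple_mem[OF t] by auto
  ultimately show False using S_AAE'[OF triple_swap(2)[OF t], of n 0 n] assms by auto
qed

text \<open>If the A-root of index 0 on line \<open>j\<close> is in T, then S misses that A-ray and
  \<open>crossing_A_A\<close> applies. Otherwise it is in S, and sums with roots of index 0 fix the
  sides of further roots until an S-root on the A-ray of \<open>j\<close> is enclosed by T.\<close>

lemma crossing_A_E:
  assumes t: "triple i j l" and noTA: "\<And>k. \<not> TA i k" and noSE: "\<And>k. \<not> SE j k"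
    and SE: "SE i m" and TA: "TA j k" and TE: "TE j n"
  shows False
proof -
  note m = triple_mem[OF t]
  show False
  proof (cases "TA j 0")
    case True
    have "\<not> SA j p" for p
      by (metis T_AE_A m(2) True TE disjoint_A not_gr_zero)
    then show False using crossing_A_A[OF t noTA _ SE TE] by blast
  next
    case False
    then have SAj: "SA j 0" using A_le_A[of j k 0] TA m by auto
    have k: "k \<noteq> 0" using False TA by metis
    have SAi: "SA i 0" using A_le_E[of j i n 0] TE m noTA by auto
    have "SE l 0 \<or> TE l 0" using E_less_A[of j l k 0] TA k m by auto
    then have SEl: "SE l 0" using S_AAE'[OF t SAi SAj, of 0] by auto
    have "SE i (k - 1) \<or> TE i (k - 1)" using E_less_A[of j i k "k - 1"] TA k m by auto
    then have TEi: "TE i (k - 1)"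
      using S_EEA'[OF triple_swap(2)[OF t] _ SEl, of "k - 1" k] TA k by auto
    \<comment> \<open>The T-root of index k - 1 on the E-ray of \<open>i\<close> cannot be closer to
      d than the S-root of index m, since S also occurs on the A-ray of \<open>i\<close>.\<close>
    have mk: "k \<le> m"
    proof (rule ccontr)
      assume "\<not> k \<le> m"
      then have "m = k - 1 \<or> m < k - 1" by auto
      then show False using S_EA_E[OF m(1) SE SAi TEi] disjoint_E[OF SE] TEi by blast
    qed
    have TEj: "TE j 0" using E_le_E[of j n 0] TE noSE m by auto
    have "\<not> SA l 0" using S_AAE'[OF triple_swap(2)[OF t] SAi, of 0 0] TEj by auto
    then have TAl: "TA l 0" using A_le_E[of j l n 0] TE m by auto
    have "\<not> TA j m"
      using T_AAE'[OF triple_swap(2)[OF triple_swap(1)[OF t]] _ TAl, of m m] SE by auto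
    then have "SA j m" using A_le_E[of i j m m] SE m by auto
    then show False using T_AE_A[OF m(2) TA TE, of m] mk disjoint_A[OF _ TA] by (cases "m = k") auto
  qed
qed

text \<open>S cannot surround d on one line while T surrounds it on another. By
  \<open>both_sides_S\<close>, T misses a ray of line \<open>i\<close> and S misses a ray of line
  \<open>j\<close>. Of the four combinations, two are the lemmas above and a third is
  \<open>crossing_A_E\<close> with S and T exchanged.\<close>

lemma crossing:
  assumes t: "triple i j l" and SA: "SA i k" and SE: "SE i m" and TA: "TA j k'" and TE: "TE j m'"
  shows False
proof -
  interpret o: hexagon_cut I TA TE SA SE L by (rule swap)
  note m = triple_mem[OF t]
  have t': "o.triple j i l" using t by (auto simp: triple_def o.triple_def)
  have cEA: False if "\<And>k. \<not> SA j k" "\<And>k. \<not> TE i k"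
    using o.crossing_A_E[OF t' that TE SA SE] .
  consider "\<And>k. \<not> TA i k" | "\<And>k. \<not> TE i k" using both_sides_S[OF m(1) SA SE] by blast
  then show False
  proof cases
    case 1
    then show False
      using o.both_sides_S[OF m(2) TA TE] crossing_A_A[OF t _ _ SE TE] crossing_A_E[OF t _ _ SE TA TE] by blast
  next
    case 2
    then have noTE: "\<And>k. \<not> TE i k" .
    consider "\<And>k. \<not> SA j k" | "\<And>k. \<not> SE j k" using o.both_sides_S[OF m(2) TA TE] by blast
    then show False
    proof cases
      case 1
      then show False using cEA noTE by blast
    next
      case 2
      show False
      proof (cases "SA i 0 \<or> TA j 0")
        case True
        then show False
        proof
          assume "SA i 0"
          then have "\<not> TA i p" for p
            by (metis S_AE_A m(1) SE disjoint_A not_gr_zero)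
          then show False using crossing_A_E[OF t _ 2 SE TA TE] by blast
        next
          assume "TA j 0"
          then have "\<not> SA j p" for p
            by (metis T_AE_A m(2) TE disjoint_A not_gr_zero)
          then show False using cEA noTE by blast
        qed
      next
        case False
        then have k: "k \<noteq> 0" "k' \<noteq> 0" using SA TA by metis+
        have TEj: "TE j (k - 1)" using E_less_A[of i j k "k - 1"] SA k m 2 by auto
        have SEi: "SE i (k' - 1)" using E_less_A[of j i k' "k' - 1"] TA k m noTE by auto
        \<comment> \<open>In S, this root added to the S-root of index k' - 1 on the E-ray of
          \<open>i\<close> gives the T-root of index k' on the A-ray of \<open>j\<close>; in T, the
          symmetric sum gives the S-root of index k on the A-ray of \<open>i\<close>.\<close>
        have "SE l 0 \<or> TE l 0" using E_less_A[of i l k 0] SA k m by auto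
        then show False
          using S_EEA'[OF triple_swap(2)[OF t] SEi, of 0 k'] TA SA k
            T_EEA'[OF triple_swap(2)[OF triple_swap(1)[OF t]] TEj, of 0 k] by auto
      qed
    qed
  qed
qed

text \<open>A T-root of index m > p would lie between the S-root of index p and the E-root of index
  0; the latter is present because m > 0, and lies in S because T misses the E-ray.\<close>

lemma threshold_A:
  assumes "i \<in> I" "\<And>k. \<not> TE i k" "TA i m" "SA i p"
  shows "m < p"
proof (rule ccontr)
  assume "\<not> m < p"
  then have "p < m" using assms disjoint_A[of i m] by (metis linorder_neqE_nat)
  moreover from this have "SE i 0" using E_less_A[of i i m 0] assms by auto
  ultimately show False using S_AE_A[of i p 0 m] assms by auto
qed

lemma threshold_E:
  assumes "i \<in> I" "\<And>k. \<not> TA i k" "TE i m" "SE i p"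
  shows "m < p"
proof (rule ccontr)
  assume "\<not> m < p"
  then have "p < m" using assms disjoint_E[of i m] by (metis linorder_neqE_nat)
  moreover from this have "SA i 0" using A_less_E[of i m 0] assms by auto
  ultimately show False using S_EA_E[of i p 0 m] assms by auto
qed

text \<open>\<open>x\<close> lists the values of a linear functional on the three elements of
  \<open>I\<close>. Then \<open>sum x I\<close> is its value at d, and the four expressions are its
  values at the roots.\<close>

definition separated :: "('i \<Rightarrow> real) \<Rightarrow> bool" where
  "separated x \<longleftrightarrow> (\<forall>i\<in>I. \<forall>k.
     (SA i k \<longrightarrow> 0 < x i + real k * sum x I) \<and> (TA i k \<longrightarrow> x i + real k * sum x I < 0) \<and>
     (SE i k \<longrightarrow> 0 < (real k + 1) * sum x I - x i) \<and> (TE i k \<longrightarrow> (real k + 1) * sum x I - x i < 0))"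

lemma I_eq: assumes "triple i j l" shows "I = {i, j, l}"
proof -
  have "finite I" using card_I by (simp add: card_ge_0_finite)
  then show ?thesis using assms card_I
    by (intro card_subset_eq[symmetric]) (auto simp: triple_def)
qed

text \<open>Give the functional the value 1 at d and the values -x, -y at i, j, hence 1 + x + y at
  l. Its sign then changes at index x on the A-ray of i, at y on that of j, and at x + y on the
  E-ray of l. This is the system of \<open>exists_pair_with_sum_between\<close>, whose compatibility
  conditions come from sums across lines.\<close>

lemma separated_AAE:
  assumes t: "triple i j l" and noTEi: "\<And>k. \<not> TE i k" and noTEj: "\<And>k. \<not> TE j k" and noTAl: "\<And>k. \<not> TA l k"
  shows "\<exists>x. separated x"
proof -
  note m = triple_mem[OF t]
  have fin: "finite {k. SA i k}" "finite {k. TA i k}" "finite {k. SE i k}" "finite {k. TE i k}" for i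
    by (rule finite_subset[of _ "{..<L}"]; use bound_A bound_E in auto)+
  \<comment> \<open>By the thresholds, T is closed downwards on these two A-rays, so n1 and n2 could
    be lowered until they add up to k.\<close>
  have TT: "n1 + n2 < k" if "TA i n1" "TA j n2" "SE l k" for n1 n2 k
  proof (rule ccontr)
    assume nk: "\<not> n1 + n2 < k"
    define p where "p = min n1 k"
    have p: "p \<le> n1" "k - p \<le> n2" "k = p + (k - p)" using nk by (auto simp: p_def)
    have "TA i p" using A_le_A[of i n1 p] p that m threshold_A[OF m(1) noTEi that(1), of p] by auto
    moreover have "TA j (k - p)" using A_le_A[of j n2 "k - p"] p that m threshold_A[OF m(2) noTEj that(2), of "k - p"] by auto
    ultimately show False using T_AAE'[OF t _ _ p(3)] that by blast
  qed
  \<comment> \<open>Here n2 would be raised to k - n1 instead: that root is present because of the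
    E-root of index k, and lies in S because it is not below an S-root.\<close>
  have SS: "k < n1 + n2" if "SA i n1" "SA j n2" "TE l k" for n1 n2 k
  proof (rule ccontr)
    assume k: "\<not> k < n1 + n2"
    have "SA j (k - n1)"
      using A_le_E[of l j k "k - n1"] that m threshold_A[OF m(2) noTEj, of "k - n1" n2] k by auto
    then show False using S_AAE'[OF t that(1), of "k - n1" k] that k by auto
  qed
  \<comment> \<open>Needed when one of the two lower bounds is the default -1, where compatibility
    reads -1 + n < k.\<close>
  have T1: "n \<le> k" if "triple i' j' l" "TA j' n" "SE l k" "\<And>k. \<not> TE i' k" for n k i' j'
  proof (rule ccontr)
    assume k: "\<not> n \<le> k"
    note m' = triple_mem[OF that(1)]
    have "SE i' (n - 1 - k)" using E_less_A[of j' i' n "n - 1 - k"] that m' k by auto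
    then show False using S_EEA'[OF triple_swap(2)[OF that(1)], of "n - 1 - k" k n] that k by auto
  qed
  have lb: "real k < real L" if "SA u k \<or> TA u k \<or> SE u k \<or> TE u k" for u k
    using that bound_A[of u k] bound_E[of u k] by auto
  \<comment> \<open>The inserted values keep all six sets nonempty. The value -1 also makes the
    functional positive on the E-rays of i, j and on the A-ray of l, which are free of T. The values
    L and 3 L + 1 lie above all indices and sums that occur.\<close>
  obtain x y where xy: "\<And>a. a \<in> insert (-1) (real ` {k. TA i k}) \<Longrightarrow> a < x"
     "\<And>a. a \<in> insert (real L) (real ` {k. SA i k}) \<Longrightarrow> x < a"
     "\<And>a. a \<in> insert (-1) (real ` {k. TA j k}) \<Longrightarrow> a < y"
     "\<And>a. a \<in> insert (real L) (real ` {k. SA j k}) \<Longrightarrow> y < a"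
     "\<And>a. a \<in> insert (-1) (real ` {k. TE l k}) \<Longrightarrow> a < x + y"
     "\<And>a. a \<in> insert (3 * real L + 1) (real ` {k. SE l k}) \<Longrightarrow> x + y < a"
  proof (rule exists_pair_with_sum_between[of "insert (-1) (real ` {k. TA i k})" "insert (real L) (real ` {k. SA i k})"
      "insert (-1) (real ` {k. TA j k})" "insert (real L) (real ` {k. SA j k})"
      "insert (-1) (real ` {k. TE l k})" "insert (3 * real L + 1) (real ` {k. SE l k})"], goal_cases)
    case (13 a a') then show ?case using threshold_A[OF m(1) noTEi] lb[of i] by auto
  next
    case (14 a a') then show ?case using threshold_A[OF m(2) noTEj] lb[of j] by auto
  next
    case (15 a a')
    have "-1 < 3 * real L + 1" by simp
    moreover have "-1 < real k" for k by (smt (verit) of_nat_0_le_iff)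
    moreover have "real k < 3 * real L + 1" if "TE l k" for k using lb[of l k] that by simp
    moreover have "real k < real n" if "TE l k" "SE l n" for k n
      using threshold_E[OF m(3) noTAl that] by simp
    ultimately show ?case using 15 by (elim insertE imageE CollectE; hypsubst; blast)
  next
    case (16 a c e)
    have 1: "-1 + -1 < 3 * real L + 1" "-1 + -1 < real k" for k by (simp, smt (verit) of_nat_0_le_iff)
    have 2: "real n + real k < 3 * real L + 1" if "TA i n" "TA j k" for n k
      using lb[of i n] lb[of j k] that by simp
    have 3: "-1 + real n < 3 * real L + 1" if "TA j n" for n using lb[of j n] that by simp
    have 4: "real n + -1 < 3 * real L + 1" if "TA i n" for n using lb[of i n] that by simp
    have 5: "real n + -1 < real k" if "TA i n" "SE l k" for n k
      using T1[OF triple_swap(1)[OF t] that noTEj] by simp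
    have 6: "-1 + real n < real k" if "TA j n" "SE l k" for n k
      using T1[OF t that noTEi] by simp
    have 7: "real n1 + real n2 < real k" if "TA i n1" "TA j n2" "SE l k" for n1 n2 k
      using TT[OF that] by linarith
    show ?case using 16 by (elim insertE imageE CollectE; hypsubst; blast intro: 1 2 3 4 5 6 7)
  next
    case (17 a c e)
    have 1: "-1 < real k + real n" "-1 < real k + real L" "-1 < real L + real k" for k n
      by (smt (verit) of_nat_0_le_iff)+
    have 2: "real k < real L + real n" "real k < real n + real L" if "TE l k" for n k using lb[of l k] that by simp_all
    have 3: "real k < real n1 + real n2" if "SA i n1" "SA j n2" "TE l k" for n1 n2 k
      using SS[OF that] by linarith
    show ?case using 17 by (elim insertE imageE CollectE; hypsubst; blast intro: 1 2 3)
  qed (use fin in auto)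
  define f where "f u = (if u = i then - x else if u = j then - y else 1 + x + y)" for u
  have f: "f i = - x" "f j = - y" "f l = 1 + x + y" "sum f I = 1"
    unfolding I_eq[OF t] using m by (auto simp: f_def)
  have gt: "-1 < x" "-1 < y" "-1 < x + y" using xy by simp_all
  have F1: "(SA i k \<longrightarrow> 0 < - x + real k) \<and> (TA i k \<longrightarrow> - x + real k < 0) \<and> (SE i k \<longrightarrow> 0 < real k + 1 - (- x))" for k
    using xy(1)[of "real k"] xy(2)[of "real k"] gt by auto
  have F2: "(SA j k \<longrightarrow> 0 < - y + real k) \<and> (TA j k \<longrightarrow> - y + real k < 0) \<and> (SE j k \<longrightarrow> 0 < real k + 1 - (- y))" for k
    using xy(3)[of "real k"] xy(4)[of "real k"] gt by auto
  have F3: "(SE l k \<longrightarrow> 0 < real k + 1 - (1 + x + y)) \<and> (TE l k \<longrightarrow> real k + 1 - (1 + x + y) < 0) \<and> (SA l k \<longrightarrow> 0 < 1 + x + y + real k)" for k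
    using xy(5)[of "real k"] xy(6)[of "real k"] gt by auto
  have "separated f"
    unfolding separated_def f(4)
  proof (intro ballI allI)
    fix u k
    assume "u \<in> I"
    then consider "u = i" | "u = j" | "u = l" using I_eq[OF t] by blast
    then show "(SA u k \<longrightarrow> 0 < f u + real k * 1) \<and> (TA u k \<longrightarrow> f u + real k * 1 < 0) \<and>
     (SE u k \<longrightarrow> 0 < (real k + 1) * 1 - f u) \<and> (TE u k \<longrightarrow> (real k + 1) * 1 - f u < 0)"
      using F1[of k] F2[of k] F3[of k] by cases (auto simp: f noTEi noTEj noTAl)
  qed
  then show ?thesis by blast
qed

text \<open>The mirror image of \<open>separated_AAE\<close>, with values 1 + x and 1 + y at i and
  j. On the A-ray of l the sign changes at index x + y + 1, whence the shift by 1 in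
  \<open>?r\<close>. The default -2 is below all shifted indices and still makes the functional
  positive on the E-ray of l.\<close>

lemma separated_EEA:
  assumes t: "triple i j l" and noTAi: "\<And>k. \<not> TA i k" and noTAj: "\<And>k. \<not> TA j k" and noTEl: "\<And>k. \<not> TE l k"
  shows "\<exists>x. separated x"
proof -
  note m = triple_mem[OF t]
  have fin: "finite {k. SA i k}" "finite {k. TA i k}" "finite {k. SE i k}" "finite {k. TE i k}" for i
    by (rule finite_subset[of _ "{..<L}"]; use bound_A bound_E in auto)+
  have T1: "n < k" if "triple i' j' l" "TE j' n" "SA l k" "\<And>k. \<not> TA i' k" for n k i' j'
  proof (rule ccontr)
    assume k: "\<not> n < k"
    note m' = triple_mem[OF that(1)]
    have "SA i' (n - k)" using A_le_E[of j' i' n "n - k"] that m' k by auto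
    then show False using S_AAE'[OF triple_swap(2)[OF that(1)], of "n - k" k n] that k by auto
  qed
  have TT: "n1 + n2 + 1 < k" if "TE i n1" "TE j n2" "SA l k" for n1 n2 k
  proof (rule ccontr)
    assume nk: "\<not> n1 + n2 + 1 < k"
    have k: "k \<noteq> 0" using T1[OF t that(2,3) noTAi] by auto
    define p where "p = min n1 (k - 1)"
    have p: "p \<le> n1" "k - 1 - p \<le> n2" "k = Suc (p + (k - 1 - p))" using nk k by (auto simp: p_def)
    have "TE i p" using E_le_E[of i n1 p] p that m threshold_E[OF m(1) noTAi that(1), of p] by auto
    moreover have "TE j (k - 1 - p)" using E_le_E[of j n2 "k - 1 - p"] p that m threshold_E[OF m(2) noTAj that(2), of "k - 1 - p"] by auto
    ultimately show False using T_EEA'[OF t _ _ p(3)] that by blast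
  qed
  have SS: "k < n1 + n2 + 1" if "SE i n1" "SE j n2" "TA l k" for n1 n2 k
  proof (rule ccontr)
    assume k: "\<not> k < n1 + n2 + 1"
    have "SE j (k - 1 - n1)"
      using E_less_A[of l j k "k - 1 - n1"] that m threshold_E[OF m(2) noTAj, of "k - 1 - n1" n2] k by auto
    then show False using S_EEA'[OF t that(1), of "k - 1 - n1" k] that k by auto
  qed
  have lb: "real k < real L" if "SA u k \<or> TA u k \<or> SE u k \<or> TE u k" for u k
    using that bound_A[of u k] bound_E[of u k] by auto
  let ?r = "\<lambda>k. real k - 1"
  obtain x y where xy: "\<And>a. a \<in> insert (-1) (real ` {k. TE i k}) \<Longrightarrow> a < x"
     "\<And>a. a \<in> insert (real L) (real ` {k. SE i k}) \<Longrightarrow> x < a"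
     "\<And>a. a \<in> insert (-1) (real ` {k. TE j k}) \<Longrightarrow> a < y"
     "\<And>a. a \<in> insert (real L) (real ` {k. SE j k}) \<Longrightarrow> y < a"
     "\<And>a. a \<in> insert (-2) (?r ` {k. TA l k}) \<Longrightarrow> a < x + y"
     "\<And>a. a \<in> insert (3 * real L + 1) (?r ` {k. SA l k}) \<Longrightarrow> x + y < a"
  proof (rule exists_pair_with_sum_between[of "insert (-1) (real ` {k. TE i k})" "insert (real L) (real ` {k. SE i k})"
      "insert (-1) (real ` {k. TE j k})" "insert (real L) (real ` {k. SE j k})"
      "insert (-2) (?r ` {k. TA l k})" "insert (3 * real L + 1) (?r ` {k. SA l k})"], goal_cases)
    case (13 a a') then show ?case using threshold_E[OF m(1) noTAi] lb[of i] by auto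
  next
    case (14 a a') then show ?case using threshold_E[OF m(2) noTAj] lb[of j] by auto
  next
    case (15 a a')
    have "-2 < 3 * real L + 1" by simp
    moreover have "-2 < real k - 1" for k by (smt (verit) of_nat_0_le_iff)
    moreover have "real k - 1 < 3 * real L + 1" if "TA l k" for k using lb[of l k] that by simp
    moreover have "real k - 1 < real n - 1" if "TA l k" "SA l n" for k n
      using threshold_A[OF m(3) noTEl that] by simp
    ultimately show ?case using 15 by (elim insertE imageE CollectE; hypsubst; blast)
  next
    case (16 a c e)
    have 1: "-1 + -1 < 3 * real L + 1" by simp
    have 2: "real n + real k < 3 * real L + 1" if "TE i n" "TE j k" for n k
      using lb[of i n] lb[of j k] that by simp
    have 3: "-1 + real n < 3 * real L + 1" if "TE j n" for n using lb[of j n] that by simp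
    have 4: "real n + -1 < 3 * real L + 1" if "TE i n" for n using lb[of i n] that by simp
    have 5: "real n + -1 < real k - 1" if "TE i n" "SA l k" for n k
      using T1[OF triple_swap(1)[OF t] that noTAj] by simp
    have 6: "-1 + real n < real k - 1" if "TE j n" "SA l k" for n k
      using T1[OF t that noTAi] by simp
    have 7: "real n1 + real n2 < real k - 1" if "TE i n1" "TE j n2" "SA l k" for n1 n2 k
      using TT[OF that] by linarith
    have 8: "-1 + -1 < real k - 1" for k by (smt (verit) of_nat_0_le_iff)
    show ?case using 16 by (elim insertE imageE CollectE; hypsubst; blast intro: 1 2 3 4 5 6 7 8)
  next
    case (17 a c e)
    have 1: "-2 < real k + real n" "-2 < real k + real L" "-2 < real L + real k" for k n
      by (smt (verit) of_nat_0_le_iff)+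
    have 2: "real k - 1 < real L + real n" "real k - 1 < real n + real L" if "TA l k" for n k
      using lb[of l k] that by simp_all
    have 3: "real k - 1 < real n1 + real n2" if "SE i n1" "SE j n2" "TA l k" for n1 n2 k
      using SS[OF that] by linarith
    show ?case using 17 by (elim insertE imageE CollectE; hypsubst; blast intro: 1 2 3)
  qed (use fin in auto)
  define f where "f u = (if u = i then 1 + x else if u = j then 1 + y else - 1 - x - y)" for u
  have f: "f i = 1 + x" "f j = 1 + y" "f l = - 1 - x - y" "sum f I = 1"
    unfolding I_eq[OF t] using m by (auto simp: f_def)
  have gt: "-1 < x" "-1 < y" "-2 < x + y" using xy by simp_all
  have F1: "(SE i k \<longrightarrow> 0 < real k + 1 - (1 + x)) \<and> (TE i k \<longrightarrow> real k + 1 - (1 + x) < 0) \<and> (SA i k \<longrightarrow> 0 < 1 + x + real k)" for k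
    using xy(1)[of "real k"] xy(2)[of "real k"] gt by auto
  have F2: "(SE j k \<longrightarrow> 0 < real k + 1 - (1 + y)) \<and> (TE j k \<longrightarrow> real k + 1 - (1 + y) < 0) \<and> (SA j k \<longrightarrow> 0 < 1 + y + real k)" for k
    using xy(3)[of "real k"] xy(4)[of "real k"] gt by auto
  have F3: "(SA l k \<longrightarrow> 0 < - 1 - x - y + real k) \<and> (TA l k \<longrightarrow> - 1 - x - y + real k < 0) \<and> (SE l k \<longrightarrow> 0 < real k + 1 - (- 1 - x - y))" for k
    using xy(5)[of "real k - 1"] xy(6)[of "real k - 1"] gt by auto
  have "separated f"
    unfolding separated_def f(4)
  proof (intro ballI allI)
    fix u k
    assume "u \<in> I"
    then consider "u = i" | "u = j" | "u = l" using I_eq[OF t] by blast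
    then show "(SA u k \<longrightarrow> 0 < f u + real k * 1) \<and> (TA u k \<longrightarrow> f u + real k * 1 < 0) \<and>
     (SE u k \<longrightarrow> 0 < (real k + 1) * 1 - f u) \<and> (TE u k \<longrightarrow> (real k + 1) * 1 - f u < 0)"
      using F1[of k] F2[of k] F3[of k] by cases (auto simp: f noTAi noTAj noTEl)
  qed
  then show ?thesis by blast
qed

lemma triple_exists: obtains i j l where "triple i j l"
proof -
  obtain i j l where "I = {i, j, l}" "i \<noteq> j" "i \<noteq> l" "j \<noteq> l"
    using card_I by (auto simp: card_3_iff)
  then have "triple i j l" unfolding triple_def by simp
  then show thesis by (rule that)
qed

lemma triple_containing:
  assumes "u \<in> I"
  obtains v w where "triple u v w"
proof -
  obtain i j l where t: "triple i j l" by (rule triple_exists)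
  then have "u = i \<or> u = j \<or> u = l" using I_eq assms by blast
  then show thesis using that t unfolding triple_def by (metis distinct_length_2_or_more)
qed

text \<open>Each line has a ray free of T, and a line missing T altogether counts as either kind. If
  free rays of both kinds occur, one of the two patterns above is present. It remains to treat T
  occurring on all three A-rays or on all three E-rays.\<close>

lemma separated_one_sided:
  assumes one: "\<And>i k m. i \<in> I \<Longrightarrow> TA i k \<Longrightarrow> TE i m \<Longrightarrow> False"
  shows "\<exists>x. separated x"
proof -
  obtain i j l where t: "triple i j l" by (rule triple_exists)
  note m = triple_mem[OF t]
  note perms = t triple_swap(1)[OF t] triple_swap(2)[OF t] triple_swap(1)[OF triple_swap(2)[OF t]]
    triple_swap(2)[OF triple_swap(1)[OF t]] triple_swap(1)[OF triple_swap(2)[OF triple_swap(1)[OF t]]]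
  define a where "a u \<longleftrightarrow> (\<forall>k. \<not> TE u k)" for u
  define e where "e u \<longleftrightarrow> (\<forall>k. \<not> TA u k)" for u
  have ae: "a u \<or> e u" if "u \<in> I" for u using one[OF that] by (auto simp: a_def e_def)
  have AAE: "\<exists>x. separated x" if "triple i j l" "a i" "a j" "e l" for i j l
    using separated_AAE[OF that(1)] that by (auto simp: a_def e_def)
  have EEA: "\<exists>x. separated x" if "triple i j l" "e i" "e j" "a l" for i j l
    using separated_EEA[OF that(1)] that by (auto simp: a_def e_def)
  show ?thesis
  proof (cases "\<exists>u\<in>I. a u \<and> e u")
    case True
    then obtain u where u: "u \<in> I" "a u" "e u" by blast
    obtain v w where uvw: "triple u v w" using triple_containing[OF u(1)] .
    then have vwu: "triple v w u" by (auto simp: triple_def)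
    have "a v \<or> e v" "a w \<or> e w" using ae triple_mem[OF uvw] by blast+
    then show ?thesis using AAE[OF uvw] AAE[OF vwu] EEA[OF uvw] EEA[OF vwu] u
      AAE[OF triple_swap(2)[OF uvw]] EEA[OF triple_swap(2)[OF uvw]] by blast
  next
    case False
    then consider "a i" "a j" "a l" "\<not> e i" "\<not> e j" "\<not> e l" | "e i" "e j" "e l" "\<not> a i" "\<not> a j" "\<not> a l"
      | "a i" "a j" "e l" | "a i" "e j" "a l" | "e i" "a j" "a l"
      | "e i" "e j" "a l" | "e i" "a j" "e l" | "a i" "e j" "e l"
      using ae[OF m(1)] ae[OF m(2)] ae[OF m(3)] m(1-3) by blast
    then show ?thesis
    proof cases
      case 1
      \<comment> \<open>The degenerate case. All A-roots of index 0 are in T, and so would be their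
        pairwise sums, the E-roots of index 0; hence no E-root is present and no A-root of positive
        index. Only the three elements of \<open>I\<close> remain, all in T.\<close>
      have all: "TA u 0 \<and> (\<forall>k. \<not> TE u k)" if u: "u \<in> I" for u
      proof -
        have "a u" "\<not> e u" using 1 u unfolding I_eq[OF t] by auto
        then obtain k where k: "TA u k" "\<And>k. \<not> TE u k" by (auto simp: a_def e_def)
        then show ?thesis using A_le_A[of u k 0] threshold_A[OF u k(2,1), of 0] u by auto
      qed
      have noSE: "\<not> SE l k" if "triple i j l" for i j l k
        using T_AAE'[OF that, of 0 0 0] all E_le_E[of l k 0] triple_mem[OF that] by auto
      have noSE: "\<not> SE u k" if "u \<in> I" for u k
        using that noSE perms unfolding I_eq[OF t] by blast
      have A0: "k = 0" "TA u k" if "SA u k \<or> TA u k" "u \<in> I" for u k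
      proof -
        show "k = 0" using E_less_A[of u u k 0] that noSE all by (metis not_gr_zero)
        then show "TA u k" using all that by auto
      qed
      have "separated (\<lambda>_. -1)" unfolding separated_def
        using A0 noSE all card_I disjoint_A by fastforce
      then show ?thesis by blast
    next
      case 2
      have all: "TE u 0 \<and> (\<forall>k. \<not> TA u k)" if u: "u \<in> I" for u
      proof -
        have "e u" "\<not> a u" using 2 u unfolding I_eq[OF t] by auto
        then obtain k where k: "TE u k" "\<And>k. \<not> TA u k" by (auto simp: a_def e_def)
        then show ?thesis using E_le_E[of u k 0] threshold_E[OF u k(2,1), of 0] u by auto
      qed
      \<comment> \<open>The E-roots of index 0 are in T and bring with them the A-roots of index 0,
        which can only be in S; but two of these add up to an E-root of index 0.\<close>
      have "SA i 0" "SA j 0" using A_le_E[of l i 0 0] A_le_E[of l j 0 0] all m by auto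
      then show ?thesis using S_AAE'[OF t, of 0 0 0] all m by auto
    qed (use AAE EEA perms in blast)+
  qed
qed

text \<open>If T surrounds d on some line, then S surrounds it on none, by \<open>crossing\<close>
  and \<open>both_sides_S\<close>. The one-sided case then applies with S and T exchanged, and its
  functional is negated.\<close>

theorem ex_separated: "\<exists>x. separated x"
proof (cases "\<exists>i\<in>I. \<exists>k m. TA i k \<and> TE i m")
  case False
  then show ?thesis using separated_one_sided by blast
next
  case True
  then obtain j k' m' where j: "j \<in> I" "TA j k'" "TE j m'" by blast
  interpret o: hexagon_cut I TA TE SA SE L by (rule swap)
  have "False" if i: "i \<in> I" "SA i k" "SE i m" for i k m
  proof (cases "i = j")
    case True
    then show False using both_sides_S[OF i] j by blast
  next
    case False
    obtain a b c where "triple a b c" by (rule triple_exists)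
    then have "card (I - {i, j}) = 1" using card_I i(1) j(1) False by simp
    then obtain l where "l \<in> I - {i, j}" by (metis card.empty ex_in_conv zero_neq_one)
    then have "triple i j l" using i j False by (auto simp: triple_def)
    then show False using crossing i j by blast
  qed
  then obtain x where x: "o.separated x" using o.separated_one_sided by blast
  have "separated (\<lambda>i. - x i)"
    using x unfolding separated_def o.separated_def sum_negf by (fastforce simp: algebra_simps)
  then show ?thesis by blast
qed

end

section \<open>Roots as lattice vectors of norm 2\<close>

locale simply_laced_ade =
  fixes B :: "'a::real_vector \<Rightarrow> 'a \<Rightarrow> real" and P :: "'a set"
  assumes fin_or_aff: "fin_or_aff_simply_laced B P"
begin

lemma slb: "simply_laced_base B P" using fin_or_aff by (simp add: fin_or_aff_simply_laced_def)
lemma bil: "bilinear B" using slb by (simp add: simply_laced_base_def)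
lemma B_sym: "B u v = B v u" using slb by (simp add: simply_laced_base_def)
lemma finite_P: "finite P" using slb by (simp add: simply_laced_base_def)
lemma indep_P: "independent P" using slb by (simp add: simply_laced_base_def)
lemma B_simple: "p \<in> P \<Longrightarrow> B p p = 2" using slb by (simp add: simply_laced_base_def)
lemma B_simple_distinct: "p \<in> P \<Longrightarrow> q \<in> P \<Longrightarrow> p \<noteq> q \<Longrightarrow> B p q = 0 \<or> B p q = -1"
  using slb by (simp add: simply_laced_base_def)

lemmas B_simps = bilinear_ladd[OF bil] bilinear_radd[OF bil] bilinear_lmul[OF bil] bilinear_rmul[OF bil]
  bilinear_lneg[OF bil] bilinear_rneg[OF bil] bilinear_lsub[OF bil] bilinear_rsub[OF bil]
  bilinear_lzero[OF bil] bilinear_rzero[OF bil]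

lemma linear_B: "linear (B x)" using bil by (simp add: bilinear_def)
lemma linear_B': "linear (\<lambda>y. B y x)" using bil by (simp add: bilinear_def)

text \<open>Coordinate functionals of the base. They are linear on the whole space, so off
  \<open>span P\<close> their values are arbitrary; statements that recover a vector from its
  coordinates therefore require membership in \<open>span P\<close>.\<close>

definition co :: "'a \<Rightarrow> 'a \<Rightarrow> real" where
  "co = (SOME f. \<forall>p\<in>P. linear (f p) \<and> (\<forall>q\<in>P. f p q = (if q = p then 1 else 0)))"

lemma co_spec: "p \<in> P \<Longrightarrow> linear (co p) \<and> (\<forall>q\<in>P. co p q = (if q = p then 1 else 0))"
proof -
  have "\<forall>p. \<exists>g. linear g \<and> (\<forall>q\<in>P. g q = (if q = p then 1 else 0::real))"
    using linear_independent_extend[OF indep_P] by fastforce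
  then obtain f where "\<forall>p. linear (f p) \<and> (\<forall>q\<in>P. f p q = (if q = p then 1 else 0::real))" by metis
  then have "\<exists>f. \<forall>p\<in>P. linear (f p) \<and> (\<forall>q\<in>P. f p q = (if q = p then 1 else 0::real))" by blast
  from someI_ex[OF this, folded co_def]
  show "p \<in> P \<Longrightarrow> linear (co p) \<and> (\<forall>q\<in>P. co p q = (if q = p then 1 else 0))" by blast
qed

lemma linear_co: "p \<in> P \<Longrightarrow> linear (co p)" using co_spec by blast
lemma co_simple: "p \<in> P \<Longrightarrow> q \<in> P \<Longrightarrow> co p q = (if q = p then 1 else 0)" using co_spec by blast

lemma co_simps:
  assumes "p \<in> P"
  shows "co p (x + y) = co p x + co p y" "co p (x - y) = co p x - co p y" "co p (- x) = - co p x"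
    "co p (c *\<^sub>R x) = c * co p x" "co p 0 = 0"
  using linear_co[OF assms] by (simp_all add: linear_add linear_diff linear_neg linear_cmul linear_0)

lemma co_sum: "p \<in> P \<Longrightarrow> co p (sum f A) = (\<Sum>a\<in>A. co p (f a))"
  using linear_sum[OF linear_co] by blast

lemma co_expand:
  assumes "v \<in> span P"
  shows "v = (\<Sum>p\<in>P. co p v *\<^sub>R p)"
proof -
  have "linear (\<lambda>v. \<Sum>p\<in>P. co p v *\<^sub>R p)"
    by (rule linearI) (auto simp: co_simps sum.distrib scaleR_add_left scaleR_right.sum)
  moreover have "(\<Sum>p\<in>P. co p q *\<^sub>R p) = q" if "q \<in> P" for q
    using that finite_P by (simp add: co_simple if_distrib[of "\<lambda>c. c *\<^sub>R _"] cong: if_cong)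
  ultimately show ?thesis
    using linear_eq_on[of "\<lambda>v. v" "\<lambda>v. \<Sum>p\<in>P. co p v *\<^sub>R p" v P] assms linear_id[unfolded id_def] by auto
qed

lemma co_ext: "v \<in> span P \<Longrightarrow> w \<in> span P \<Longrightarrow> (\<And>p. p \<in> P \<Longrightarrow> co p v = co p w) \<Longrightarrow> v = w"
proof -
  assume *: "v \<in> span P" "w \<in> span P" "\<And>p. p \<in> P \<Longrightarrow> co p v = co p w"
  have "(\<Sum>p\<in>P. co p v *\<^sub>R p) = (\<Sum>p\<in>P. co p w *\<^sub>R p)" by (rule sum.cong) (simp_all add: *(3))
  then show "v = w" using co_expand[OF *(1)] co_expand[OF *(2)] by argo
qed

lemma co_combination: "p \<in> P \<Longrightarrow> co p (\<Sum>q\<in>P. c q *\<^sub>R q) = c p"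
  using finite_P by (simp add: co_sum co_simps co_simple if_distrib[of "\<lambda>x. _ * x"] cong: if_cong)

lemma span_subset_iff:
  assumes "C \<subseteq> P"
  shows "v \<in> span C \<longleftrightarrow> v \<in> span P \<and> (\<forall>p\<in>P - C. co p v = 0)"
proof
  assume v: "v \<in> span C"
  have "co p v = 0" if "p \<in> P - C" for p
  proof -
    have "co p v = (\<lambda>_. 0) v"
      by (rule linear_eq_on[of "co p" "\<lambda>_. 0" v C])
         (use linear_co v assms that in \<open>auto simp: co_simple module_hom_zero\<close>)
    then show ?thesis by simp
  qed
  then show "v \<in> span P \<and> (\<forall>p\<in>P - C. co p v = 0)" using v assms span_mono by blast
next
  assume a: "v \<in> span P \<and> (\<forall>p\<in>P - C. co p v = 0)"
  then have "v = (\<Sum>p\<in>P. co p v *\<^sub>R p)" using co_expand by blast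
  also have "\<dots> = (\<Sum>p\<in>C. co p v *\<^sub>R p)"
    using a assms finite_P by (intro sum.mono_neutral_right) auto
  also have "\<dots> \<in> span C" by (intro span_sum span_scale span_base)
  finally show "v \<in> span C" .
qed

lemma nnspan_P_iff: "v \<in> nnspan P \<longleftrightarrow> v \<in> span P \<and> (\<forall>p\<in>P. 0 \<le> co p v)"
proof
  assume "v \<in> nnspan P"
  then obtain c where c: "\<forall>x\<in>P. 0 \<le> c x" "v = (\<Sum>x\<in>P. c x *\<^sub>R x)"
    unfolding nnspan_finite[OF finite_P] by blast
  then have "v \<in> span P" by (simp add: span_sum span_scale span_base)
  then show "v \<in> span P \<and> (\<forall>p\<in>P. 0 \<le> co p v)" using c co_combination by auto
next
  assume v: "v \<in> span P \<and> (\<forall>p\<in>P. 0 \<le> co p v)"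
  show "v \<in> nnspan P" unfolding nnspan_finite[OF finite_P]
    by (rule exI[of _ "\<lambda>p. co p v"]) (use v co_expand in blast)
qed

lemma nnspan_P_add: "v \<in> nnspan P \<Longrightarrow> w \<in> nnspan P \<Longrightarrow> v + w \<in> nnspan P"
  by (auto simp: nnspan_P_iff co_simps span_add)

lemma nnspan_P_scale: "v \<in> nnspan P \<Longrightarrow> 0 \<le> c \<Longrightarrow> c *\<^sub>R v \<in> nnspan P"
  by (auto simp: nnspan_P_iff co_simps span_scale)

lemma nnspan_P_span: "v \<in> nnspan P \<Longrightarrow> v \<in> span P" by (simp add: nnspan_P_iff)

definition height :: "'a \<Rightarrow> real" where "height v = (\<Sum>p\<in>P. co p v)"

lemma linear_height: "linear height"
  unfolding height_def by (rule linearI) (auto simp: co_simps sum.distrib sum_distrib_left)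

lemmas height_simps = linear_add[OF linear_height] linear_diff[OF linear_height] linear_neg[OF linear_height]
  linear_cmul[OF linear_height] linear_0[OF linear_height]

lemma height_pos: "v \<in> nnspan P \<Longrightarrow> v \<noteq> 0 \<Longrightarrow> 0 < height v"
proof -
  assume v: "v \<in> nnspan P" "v \<noteq> 0"
  then obtain p where "p \<in> P" "co p v \<noteq> 0"
    using co_ext[OF nnspan_P_span[OF v(1)] span_zero] by (auto simp: co_simps)
  then show "0 < height v"
    unfolding height_def using v nnspan_P_iff by (intro sum_pos2[OF finite_P]) (auto simp: less_le)
qed

lemma nnspan_antisym: "v \<in> nnspan P \<Longrightarrow> - v \<in> nnspan P \<Longrightarrow> v = 0"
  using height_pos[of v] height_pos[of "-v"] by (force simp: height_simps)

definition lat :: "'a set" where "lat = {v \<in> span P. \<forall>p\<in>P. co p v \<in> \<int>}"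

lemma lat_simps: "v \<in> lat \<Longrightarrow> w \<in> lat \<Longrightarrow> v + w \<in> lat" "v \<in> lat \<Longrightarrow> w \<in> lat \<Longrightarrow> v - w \<in> lat"
  "v \<in> lat \<Longrightarrow> - v \<in> lat" "p \<in> P \<Longrightarrow> p \<in> lat" "k \<in> \<int> \<Longrightarrow> v \<in> lat \<Longrightarrow> k *\<^sub>R v \<in> lat" "0 \<in> lat"
  by (auto simp: lat_def co_simps co_simple span_add span_diff span_neg span_base span_scale span_zero)

lemma lat_span: "v \<in> lat \<Longrightarrow> v \<in> span P" by (simp add: lat_def)

lemma B_expand: "v \<in> span P \<Longrightarrow> B v w = (\<Sum>p\<in>P. co p v * B p w)"
proof -
  assume "v \<in> span P"
  then have "B v w = B (\<Sum>p\<in>P. co p v *\<^sub>R p) w" using co_expand by metis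
  then show ?thesis by (simp add: linear_sum[OF linear_B'] B_simps)
qed

lemma B_expand2:
  assumes "v \<in> span P" "w \<in> span P"
  shows "B v w = (\<Sum>p\<in>P. \<Sum>q\<in>P. co p v * co q w * B p q)"
proof -
  have "B p w = (\<Sum>q\<in>P. co q w * B p q)" for p
    using B_expand[OF assms(2), of p] B_sym[of p] by simp
  then show ?thesis using B_expand[OF assms(1), of w] by (simp add: sum_distrib_left mult.assoc)
qed

lemma B_simple_Ints: "p \<in> P \<Longrightarrow> q \<in> P \<Longrightarrow> B p q \<in> \<int>"
  using B_simple B_simple_distinct by (cases "p = q") force+

lemma B_lat: "v \<in> lat \<Longrightarrow> w \<in> lat \<Longrightarrow> B v w \<in> \<int>"
  by (subst B_expand2) (auto simp: lat_def B_simple_Ints intro!: Ints_sum Ints_mult)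

text \<open>The root lattice is even: diagonal entries are 2 and mixed terms occur twice. A lattice
  vector of norm below 2 is therefore isotropic, on which \<open>norm2_sign\<close> rests.\<close>

lemma B_lat_even:
  assumes "v \<in> lat"
  obtains k :: int where "B v v = 2 * of_int k"
proof -
  have even: "\<exists>k::int. B v v = 2 * of_int k" if "finite S" "S \<subseteq> P" "v = (\<Sum>p\<in>S. of_int (c p) *\<^sub>R p)" for v S and c :: "'a \<Rightarrow> int"
    using that
  proof (induction S arbitrary: v)
    case empty
    then show ?case by (intro exI[of _ 0]) (simp add: B_simps)
  next
    case (insert p S)
    let ?u = "\<Sum>p\<in>S. of_int (c p) *\<^sub>R p"
    obtain k :: int where k: "B ?u ?u = 2 * of_int k" using insert by blast
    have "?u \<in> lat" using insert.prems(1)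
      by (induction S rule: infinite_finite_induct) (simp_all add: lat_simps)
    then have "B ?u p \<in> \<int>" using insert.prems lat_simps B_lat by simp
    then obtain m :: int where m: "B ?u p = of_int m" by (rule Ints_cases)
    define u where "u = ?u"
    have v: "v = u + of_int (c p) *\<^sub>R p" using insert unfolding u_def by simp
    have "B p p = 2" "B u u = 2 * of_int k" "B u p = of_int m" "B p u = of_int m"
      using k m insert.prems B_simple B_sym[of p u] unfolding u_def by auto
    then have "B v v = 2 * of_int k + 2 * of_int (c p) * of_int m + 2 * of_int (c p) * of_int (c p)"
      unfolding v by (simp add: B_simps algebra_simps)
    then have "B v v = 2 * of_int (k + c p * m + c p * c p)" by (simp add: algebra_simps)
    then show ?case by blast
  qed
  have "(\<Sum>p\<in>P. co p v *\<^sub>R p) = (\<Sum>p\<in>P. of_int \<lfloor>co p v\<rfloor> *\<^sub>R p)"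
    using assms by (intro sum.cong) (auto simp: lat_def)
  then have "v = (\<Sum>p\<in>P. of_int \<lfloor>co p v\<rfloor> *\<^sub>R p)"
    using co_expand[OF lat_span[OF assms]] by argo
  from even[OF finite_P subset_refl this] obtain k :: int where "B v v = 2 * of_int k" by (elim exE)
  then show thesis by (rule that)
qed

section \<open>Irreducible components and semidefiniteness of the form\<close>

definition comps :: "'a set set" where "comps = component B P ` P"

abbreviation "edges \<equiv> {(x, y). x \<in> P \<and> y \<in> P \<and> B x y \<noteq> 0}"

lemma comps_subset: "C \<in> comps \<Longrightarrow> C \<subseteq> P" by (auto simp: comps_def component_def)

lemma edges_sym: "sym (edges\<^sup>*)"
  by (rule sym_rtrancl) (auto simp: sym_def B_sym)

lemma comps_eq: "C \<in> comps \<Longrightarrow> a \<in> C \<Longrightarrow> C = component B P a"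
proof -
  assume "C \<in> comps" "a \<in> C"
  then obtain b where b: "C = component B P b" "(b, a) \<in> edges\<^sup>*" by (auto simp: comps_def component_def)
  then have "(a, b) \<in> edges\<^sup>*" using edges_sym by (simp add: sym_def)
  then have "(b, c) \<in> edges\<^sup>* \<longleftrightarrow> (a, c) \<in> edges\<^sup>*" for c using b(2) by (meson rtrancl_trans)
  then show "C = component B P a" using b(1) unfolding component_def by auto
qed

lemma mem_own_comp: "a \<in> P \<Longrightarrow> a \<in> component B P a" by (simp add: component_def)

lemma comps_disjoint: "C \<in> comps \<Longrightarrow> D \<in> comps \<Longrightarrow> C \<noteq> D \<Longrightarrow> C \<inter> D = {}"
  using comps_eq[of C] comps_eq[of D] by fastforce

lemma comps_orth: assumes "C \<in> comps" "p \<in> C" "q \<in> P - C" shows "B p q = 0"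
proof (rule ccontr)
  assume "B p q \<noteq> 0"
  then have "(p, q) \<in> edges" using assms comps_subset by blast
  moreover have "C = component B P p" using comps_eq assms by blast
  ultimately have "q \<in> C" using assms by (auto simp: component_def)
  then show False using assms by blast
qed

lemma comps_cover: "\<Union>comps = P"
  using comps_subset mem_own_comp unfolding comps_def by fast

lemma finite_comps: "finite comps" unfolding comps_def using finite_P by simp

lemma comps_orth_span:
  assumes "C \<in> comps" "x \<in> span C" "y \<in> span (P - C)"
  shows "B x y = 0"
proof -
  have *: "B p y = 0" if "p \<in> C" for p
    by (rule linear_eq_on[of "B p" "\<lambda>_. 0" y "P - C"])
       (use linear_B assms comps_orth that in \<open>auto simp: module_hom_zero\<close>)
  show ?thesis
    by (rule linear_eq_on[of "\<lambda>x. B x y" "\<lambda>_. 0" x C])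
       (use linear_B' assms * in \<open>auto simp: module_hom_zero\<close>)
qed

lemma span_comps_orth:
  assumes "C \<in> comps" "D \<in> comps" "C \<noteq> D" "x \<in> span C" "y \<in> span D"
  shows "B x y = 0"
proof -
  have "D \<subseteq> P - C" using comps_disjoint[of C D] comps_subset[of D] assms by blast
  then show ?thesis using comps_orth_span[OF assms(1,4)] assms(5) span_mono[of D "P - C"] by blast
qed

lemma psd_comp: "C \<in> comps \<Longrightarrow> x \<in> span C \<Longrightarrow> 0 \<le> B x x"
proof -
  assume "C \<in> comps" "x \<in> span C"
  then obtain a where a: "a \<in> P" "C = component B P a" by (auto simp: comps_def)
  then have "finite_type_comp B C \<or> affine_type_comp B C"
    using fin_or_aff by (auto simp: fin_or_aff_simply_laced_def)
  then show "0 \<le> B x x" using \<open>x \<in> span C\<close>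
    unfolding finite_type_comp_def affine_type_comp_def by (cases "x = 0") (auto simp: B_simps intro: less_imp_le)
qed

lemma psd: assumes "x \<in> span P" shows "0 \<le> B x x"
proof -
  have "0 \<le> B x x" if "finite D" "D \<subseteq> comps" "x \<in> span (\<Union>D)" for D x
    using that
  proof (induction D arbitrary: x)
    case empty
    then show ?case by (simp add: B_simps)
  next
    case (insert C D)
    then obtain u w where uw: "x = u + w" "u \<in> span C" "w \<in> span (\<Union>D)"
      by (auto simp: span_Un)
    have CD: "C \<in> comps" "\<And>E. E \<in> D \<Longrightarrow> E \<in> comps" using insert.prems by auto
    have "E \<subseteq> P - C" if "E \<in> D" for E
      using comps_disjoint[of C E] comps_subset[of E] CD insert.hyps that by blast
    then have "\<Union>D \<subseteq> P - C" by blast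
    then have "B u w = 0" using uw comps_orth_span[OF CD(1) uw(2), of w] span_mono[of "\<Union>D" "P - C"] by blast
    then have "B x x = B u u + B w w" using uw B_sym[of w u] by (simp add: B_simps)
    then show ?case using insert.IH[OF _ uw(3)] insert.prems psd_comp[OF _ uw(2)] by simp
  qed
  from this[OF finite_comps] show ?thesis using assms comps_cover by simp
qed

section \<open>Isotropic vectors and signs of lattice vectors\<close>

lemma iso_radical:
  assumes "x \<in> span P" "B x x = 0" "y \<in> span P"
  shows "B x y = 0"
proof (rule ccontr)
  assume ne: "B x y \<noteq> 0"
  \<comment> \<open>The norm of \<open>y + t *\<^sub>R x\<close> is affine in t with slope
    \<open>2 * B x y\<close>; this t makes it -1.\<close>
  define t where "t = - (B y y + 1) / (2 * B x y)"
  have "0 \<le> B (y + t *\<^sub>R x) (y + t *\<^sub>R x)" using psd assms by (simp add: span_add span_scale)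
  also have "\<dots> = B y y + 2 * t * B x y" using assms(2) B_sym[of y x] by (simp add: B_simps)
  also have "\<dots> = -1" using ne by (simp add: t_def field_simps)
  finally show False by simp
qed

text \<open>A Perron-Frobenius argument. An isotropic x pairs to 0 with every simple root s. If s is
  outside the support of x, all terms of \<open>B x s\<close> are nonpositive, and a neighbour of s
  in the support makes the sum negative. So the support is closed under neighbours, and a component
  is connected.\<close>

lemma iso_nonneg_pos:
  assumes C: "C \<in> comps" and x: "x \<in> span C" "B x x = 0" "\<And>p. p \<in> C \<Longrightarrow> 0 \<le> co p x" "x \<noteq> 0" and p: "p \<in> C"
  shows "0 < co p x"
proof -
  note CP = comps_subset[OF C]
  have xP: "x \<in> span P" and x0: "\<And>p. p \<in> P - C \<Longrightarrow> co p x = 0" using x(1) span_subset_iff[OF CP] by blast+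
  have "\<exists>q\<in>P. co q x \<noteq> 0" using co_ext[OF xP span_zero] x(4) by (auto simp: co_simps)
  then obtain q where "q \<in> P" "co q x \<noteq> 0" by blast
  then have q: "q \<in> C" "0 < co q x" using x0[of q] x(3)[of q] by force+
  have step_pos: "0 < co s x" if "r \<in> C" "0 < co r x" "s \<in> P" "B r s \<noteq> 0" for r s
  proof (rule ccontr)
    assume "\<not> 0 < co s x"
    moreover have "s \<in> C" using comps_orth[OF C that(1)] that by blast
    ultimately have s0: "co s x = 0" using x(3)[of s] by simp
    have "0 = B x s" using iso_radical[OF xP x(2)] that by (simp add: span_base)
    also have "\<dots> = (\<Sum>p\<in>P. co p x * B p s)" using B_expand xP by blast
    also have "\<dots> < 0"
    proof -
      have "0 < (\<Sum>p\<in>P. - (co p x * B p s))"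
      proof (rule sum_pos2[OF finite_P])
        show "r \<in> P" using that CP by blast
        show "0 < - (co r x * B r s)"
          using that s0 B_simple_distinct[of r s] CP by (cases "r = s") auto
        show "0 \<le> - (co p x * B p s)" if "p \<in> P" for p
          using that s0 x0[of p] x(3)[of p] B_simple_distinct[of p s] \<open>s \<in> P\<close>
          by (cases "p = s"; cases "p \<in> C") auto
      qed
      then show ?thesis by (simp add: sum_negf)
    qed
    finally show False by simp
  qed
  have "(q, p) \<in> edges\<^sup>*" using comps_eq[OF C q(1)] p by (simp add: component_def)
  then have "p \<in> C \<and> 0 < co p x"
  proof (induction rule: rtrancl_induct)
    case base
    then show ?case using q by blast
  next
    case (step r s)
    then show ?case using step(2) step(3) step_pos[of r s]
        comps_orth[OF C, of r s] by blast
  qed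
  then show ?thesis by blast
qed

text \<open>Subtract from y the multiple of x given by the smallest ratio of coordinates: the rest
  is isotropic and nonnegative with a zero coordinate, so it vanishes by
  \<open>iso_nonneg_pos\<close>.\<close>

lemma iso_proportional:
  assumes C: "C \<in> comps" and x: "x \<in> span C" "B x x = 0" "\<And>p. p \<in> C \<Longrightarrow> 0 \<le> co p x" "x \<noteq> 0"
    and y: "y \<in> span C" "B y y = 0"
  obtains t where "y = t *\<^sub>R x"
proof -
  note CP = comps_subset[OF C]
  have C': "finite C" "C \<noteq> {}" using C finite_subset[OF CP finite_P] mem_own_comp by (auto simp: comps_def)
  define t where "t = Min ((\<lambda>p. co p y / co p x) ` C)"
  have "t \<in> (\<lambda>p. co p y / co p x) ` C" unfolding t_def using C' by (intro Min_in) auto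
  then obtain q where q: "q \<in> C" "t = co q y / co q x" by blast
  have pos: "0 < co p x" if "p \<in> C" for p using iso_nonneg_pos[OF C x that] .
  have le: "t * co p x \<le> co p y" if "p \<in> C" for p
  proof -
    have "t \<le> co p y / co p x" unfolding t_def using C' that by auto
    then show ?thesis using pos[OF that] by (simp add: field_simps)
  qed
  define z where "z = y - t *\<^sub>R x"
  have z: "z \<in> span C" "\<And>p. p \<in> C \<Longrightarrow> 0 \<le> co p z" "co q z = 0"
    using x y le q pos[OF q(1)] CP by (auto simp: z_def span_diff span_scale co_simps subset_eq)
  have "B x y = 0" using iso_radical[of x y] x y CP span_mono by blast
  then have "B z z = 0" using x y B_sym[of y x] by (simp add: z_def B_simps)
  then have "z = 0" using iso_nonneg_pos[OF C z(1) _ z(2) _ q(1)] z(3) by fastforce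
  then have "y = t *\<^sub>R x" by (simp add: z_def)
  then show thesis by (rule that)
qed

lemma span_comp_span: "C \<in> comps \<Longrightarrow> x \<in> span C \<Longrightarrow> x \<in> span P"
  using comps_subset span_mono by blast

lemma nnspan_comp_coeffs: "C \<in> comps \<Longrightarrow> x \<in> nnspan P \<Longrightarrow> p \<in> C \<Longrightarrow> 0 \<le> co p x"
  using comps_subset nnspan_P_iff by blast

lemma span_comp_combination:
  assumes "C \<in> comps" "\<And>p. p \<in> P - C \<Longrightarrow> c p = 0"
  shows "(\<Sum>p\<in>P. c p *\<^sub>R p) \<in> span C"
proof -
  have "(\<Sum>p\<in>P. c p *\<^sub>R p) \<in> span P" by (intro span_sum span_scale span_base)
  then show ?thesis unfolding span_subset_iff[OF comps_subset[OF assms(1)]] using assms(2) by (simp add: co_combination)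
qed

text \<open>Off-diagonal entries are nonpositive, so replacing all coordinates by their absolute
  values does not increase the norm. The result is again isotropic, and x is a multiple of
  it.\<close>

lemma iso_sign:
  assumes C: "C \<in> comps" and x: "x \<in> span C" "B x x = 0"
  shows "x \<in> nnspan P \<or> - x \<in> nnspan P"
proof (cases "x = 0")
  case True
  then show ?thesis using nnspan_0 by simp
next
  case False
  have xP: "x \<in> span P" using span_comp_span C x by blast
  define y where "y = (\<Sum>p\<in>P. \<bar>co p x\<bar> *\<^sub>R p)"
  have y: "y \<in> span C" unfolding y_def
    by (rule span_comp_combination[OF C]) (use x span_subset_iff[OF comps_subset[OF C]] in auto)
  have co_y: "co p y = \<bar>co p x\<bar>" if "p \<in> P" for p unfolding y_def by (rule co_combination[OF that])
  have yP: "y \<in> span P" using span_comp_span C y by blast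
  have "B y y \<le> B x x"
    unfolding B_expand2[OF yP yP] B_expand2[OF xP xP]
  proof (intro sum_mono)
    fix p q assume pq: "p \<in> P" "q \<in> P"
    show "co p y * co q y * B p q \<le> co p x * co q x * B p q"
    proof (cases "p = q")
      case True
      then show ?thesis using pq by (simp add: co_y)
    next
      case False
      then have "B p q = 0 \<or> B p q = -1" using B_simple_distinct pq by blast
      moreover have "co p x * co q x \<le> \<bar>co p x\<bar> * \<bar>co q x\<bar>" by (simp add: abs_mult[symmetric])
      ultimately show ?thesis using pq by (auto simp: co_y)
    qed
  qed
  then have y0: "B y y = 0" using psd[OF yP] x by simp
  have "y \<noteq> 0"
  proof
    assume "y = 0"
    then have "co p x = 0" if "p \<in> P" for p using co_y[OF that] by (simp add: co_simps[OF that])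
    then have "x = 0" using co_ext[OF xP span_zero] by (simp add: co_simps)
    then show False using False by blast
  qed
  moreover have "0 \<le> co p y" if "p \<in> C" for p using co_y[of p] comps_subset[OF C] that by auto
  ultimately obtain t where t: "x = t *\<^sub>R y" using iso_proportional[OF C y y0 _ _ x] by blast
  have ynn: "y \<in> nnspan P" unfolding nnspan_P_iff using yP co_y by simp
  show ?thesis
  proof (cases "0 \<le> t")
    case True
    then show ?thesis using nnspan_P_scale[OF ynn] t by simp
  next
    case False
    then show ?thesis using nnspan_P_scale[OF ynn, of "- t"] t by simp
  qed
qed

text \<open>The positive part \<open>w 1\<close> and the negative part \<open>w (-1)\<close> of v
  have disjoint supports, hence pairing at most 0. In an even semidefinite lattice, norm 2 of their
  difference then forces one part to be isotropic. If that part is nonzero it has full support on C,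
  leaving nothing for the other.\<close>

lemma norm2_sign:
  assumes C: "C \<in> comps" and v: "v \<in> lat" "v \<in> span C" "B v v = 2"
  shows "v \<in> nnspan P \<or> - v \<in> nnspan P"
proof -
  define w where "w s = (\<Sum>p\<in>P. max (s * co p v) 0 *\<^sub>R p)" for s :: real
  have co_w: "co p (w s) = max (s * co p v) 0" if "p \<in> P" for p s
    unfolding w_def by (rule co_combination[OF that])
  have wC: "w s \<in> span C" for s unfolding w_def
    by (rule span_comp_combination[OF C]) (use v span_subset_iff[OF comps_subset[OF C]] in auto)
  then have wP: "w s \<in> span P" for s using span_comp_span C by blast
  have w_nn: "w s \<in> nnspan P" for s unfolding nnspan_P_iff using wP co_w by simp
  have w_lat: "w s \<in> lat" if "s = 1 \<or> s = -1" for s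
    using v wP that by (auto simp: lat_def co_w max_def)
  have vP: "v \<in> span P" using v lat_span by blast
  have v_eq: "v = w 1 - w (-1)"
    by (rule co_ext[OF vP span_diff[OF wP wP]]) (simp add: co_w co_simps max_def)
  have g: "B (w 1) (w (-1)) \<le> 0" unfolding B_expand2[OF wP wP]
  proof (intro sum_nonpos)
    fix p q assume pq: "p \<in> P" "q \<in> P"
    show "co p (w 1) * co q (w (-1)) * B p q \<le> 0"
    proof (cases "p = q")
      case True
      then show ?thesis using pq by (simp add: co_w max_def)
    next
      case False
      then have "B p q = 0 \<or> B p q = -1" using B_simple_distinct pq by blast
      moreover have "0 \<le> co p (w 1) * co q (w (-1))" using pq by (simp add: co_w)
      ultimately show ?thesis by auto
    qed
  qed
  obtain g' :: int where g': "B (w 1) (w (-1)) = of_int g'"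
    using B_lat[of "w 1" "w (-1)"] w_lat Ints_cases by blast
  obtain e :: int where e: "B (w 1) (w 1) = 2 * of_int e" using B_lat_even w_lat by metis
  obtain f :: int where f: "B (w (-1)) (w (-1)) = 2 * of_int f" using B_lat_even w_lat by metis
  have nn: "0 \<le> e" "0 \<le> f" using psd[OF wP, of 1] psd[OF wP, of "-1"] e f by auto
  have "B v v = B (w 1) (w 1) + B (w (-1)) (w (-1)) - 2 * B (w 1) (w (-1))"
    unfolding v_eq using B_sym[of "w (-1)" "w 1"] by (simp add: B_simps)
  then have "e + f - g' = 1" using v(3) e f g' by linarith
  then consider "e = 1" "f = 0" | "e = 0" "f = 1" | "e = 0" "f = 0" "g' = -1" using nn g g' by linarith
  moreover have key: "w (- s) = 0" if "s = 1 \<or> s = -1" "B (w s) (w s) = 0" "w s \<noteq> 0" for s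
  proof (rule co_ext[OF wP span_zero])
    fix p assume p: "p \<in> P"
    show "co p (w (- s)) = co p 0"
    proof (cases "p \<in> C")
      case True
      then have "0 < co p (w s)" using iso_nonneg_pos[OF C wC that(2) _ that(3)] nnspan_comp_coeffs[OF C w_nn] by blast
      then show ?thesis using p by (simp add: co_w co_simps max_def split: if_splits)
    next
      case False
      then show ?thesis using wC[of "-s"] span_subset_iff[OF comps_subset[OF C]] p by (simp add: co_simps)
    qed
  qed
  ultimately show ?thesis
  proof cases
    case 1
    have "w (-1) = 0"
    proof (rule ccontr)
      assume "w (-1) \<noteq> 0"
      then have "w 1 = 0" using key[of "-1"] f 1 by simp
      then show False using e 1 by (simp add: B_simps)
    qed
    then show ?thesis using v_eq w_nn by (metis diff_zero)
  next
    case 2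
    have "w 1 = 0"
    proof (rule ccontr)
      assume "w 1 \<noteq> 0"
      then have "w (-1) = 0" using key[of 1] e 2 by simp
      then show False using f 2 by (simp add: B_simps)
    qed
    then have "- v = w (-1)" using v_eq by simp
    then show ?thesis using w_nn by metis
  next
    case 3
    then have "B (w 1) (w (-1)) = 0" using iso_radical[OF wP _ wP] e by simp
    then show ?thesis using g' 3 by simp
  qed
qed

section \<open>Roots and positive roots\<close>

definition rts :: "'a set" where
  "rts = {v \<in> lat. B v v = 2 \<and> (\<exists>C\<in>comps. v \<in> span C)}"

lemma rts_lat: "v \<in> rts \<Longrightarrow> v \<in> lat" and rts_norm: "v \<in> rts \<Longrightarrow> B v v = 2"
  and rts_span: "v \<in> rts \<Longrightarrow> v \<in> span P"
  by (auto simp: rts_def lat_def)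

lemma rts_comp: assumes "v \<in> rts" obtains C where "C \<in> comps" "v \<in> span C"
  using assms by (auto simp: rts_def)

lemma rtsI: "v \<in> lat \<Longrightarrow> B v v = 2 \<Longrightarrow> C \<in> comps \<Longrightarrow> v \<in> span C \<Longrightarrow> v \<in> rts"
  by (auto simp: rts_def)

lemma rts_sign: "v \<in> rts \<Longrightarrow> v \<in> nnspan P \<or> - v \<in> nnspan P"
  using norm2_sign by (auto simp: rts_def)

lemma rts_neg: "v \<in> rts \<Longrightarrow> - v \<in> rts"
  using rtsI[of "- v"] span_neg by (fastforce simp: rts_def lat_simps B_simps)

lemma rts_same_comp:
  assumes "v \<in> rts" "w \<in> rts" "B v w \<noteq> 0" "C \<in> comps" "v \<in> span C"
  shows "w \<in> span C"
  using assms span_comps_orth rts_comp by metis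

lemma rts_B_cases:
  assumes "v \<in> rts" "w \<in> rts"
  shows "B v w \<in> {-2, -1, 0, 1, 2}"
proof -
  obtain k :: int where k: "B v w = of_int k" using B_lat[of v w] rts_lat assms Ints_cases by blast
  have "0 \<le> B (v + w) (v + w)" "0 \<le> B (v - w) (v - w)"
    using psd[OF span_add[OF rts_span[OF assms(1)] rts_span[OF assms(2)]]]
      psd[OF span_diff[OF rts_span[OF assms(1)] rts_span[OF assms(2)]]] .
  then have "- 2 \<le> B v w" "B v w \<le> 2" using B_sym[of w v] rts_norm assms by (simp_all add: B_simps)
  then have "-2 \<le> k" "k \<le> 2" using k by simp_all
  then have "k \<in> {-2, -1, 0, 1, 2}" by auto
  then show ?thesis using k by auto
qed

lemma rts_combination:
  assumes "v \<in> rts" "w \<in> rts" "B v w \<noteq> 0" "x \<in> \<int>" "y \<in> \<int>" "x * x + y * y + x * y * B v w = 1"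
  shows "x *\<^sub>R v + y *\<^sub>R w \<in> rts"
proof -
  obtain C where C: "C \<in> comps" "v \<in> span C" using rts_comp assms by blast
  have w: "w \<in> span C" using rts_same_comp C assms by blast
  have "B (x *\<^sub>R v + y *\<^sub>R w) (x *\<^sub>R v + y *\<^sub>R w) = 2 * (x * x + y * y + x * y * B v w)"
    using rts_norm[OF assms(1)] rts_norm[OF assms(2)] B_sym[of w v] by (simp add: B_simps algebra_simps)
  then have "B (x *\<^sub>R v + y *\<^sub>R w) (x *\<^sub>R v + y *\<^sub>R w) = 2" using assms(6) by simp
  then show ?thesis using rtsI C w assms lat_simps rts_lat span_add span_scale by metis
qed

lemma rts_diff: "v \<in> rts \<Longrightarrow> w \<in> rts \<Longrightarrow> B v w = 1 \<Longrightarrow> v - w \<in> rts"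
  using rts_combination[of v w 1 "-1"] by simp

lemma rts_add: "v \<in> rts \<Longrightarrow> w \<in> rts \<Longrightarrow> B v w = -1 \<Longrightarrow> v + w \<in> rts"
  using rts_combination[of v w 1 1] by simp

lemma rts_add_iso:
  assumes "v \<in> rts" "C \<in> comps" "v \<in> span C" "d \<in> lat" "d \<in> span C" "B d d = 0"
  shows "v + d \<in> rts"
proof -
  have "B d v = 0" using iso_radical[of d v] assms span_comp_span by blast
  then have "B (v + d) (v + d) = 2" using assms B_sym[of v d] by (simp add: B_simps rts_norm)
  then show ?thesis using assms lat_simps(1) rts_lat rtsI span_add by metis
qed

lemma simple_rts: "p \<in> P \<Longrightarrow> p \<in> rts"
  using mem_own_comp[of p] by (intro rtsI[of p "component B P p"]) (auto simp: lat_simps B_simple comps_def span_base)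

lemma refl_rts: assumes "v \<in> rts" "p \<in> P" shows "refl B p v \<in> rts"
proof (cases "B p v = 0")
  case True
  then show ?thesis using assms by (simp add: refl_def)
next
  case False
  have "B v p \<noteq> 0" "B v p \<in> \<int>" using False B_sym[of p v] B_lat rts_lat simple_rts assms by metis+
  then have "1 *\<^sub>R v + (- B v p) *\<^sub>R p \<in> rts"
    using rts_combination[OF assms(1) simple_rts[OF assms(2)], of 1 "- B v p"] by simp
  then show ?thesis using B_sym[of p v] by (simp add: refl_def)
qed

lemma roots_subset_rts: "v \<in> roots B P \<Longrightarrow> v \<in> rts"
  by (induction rule: roots.induct) (auto intro: simple_rts refl_rts)

text \<open>Descent on the height. Since v has positive norm, some simple p in its support has
  \<open>B p v > 0\<close>, and reflecting in p lowers the height by at least 1. Only the coordinate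
  at p changes, so the reflected root stays positive unless v is p itself.\<close>

lemma pos_rts_root:
  assumes "v \<in> rts" "v \<in> nnspan P"
  shows "v \<in> roots B P"
proof -
  have "v \<in> roots B P" if "v \<in> rts" "v \<in> nnspan P" "height v < real n" for n
    using that
  proof (induction n arbitrary: v)
    case 0
    have "v \<noteq> 0" using rts_norm[OF 0(1)] by (auto simp: B_simps)
    then show ?case using height_pos 0 by fastforce
  next
    case (Suc n)
    note v = Suc.prems
    show ?case
    proof (cases "v \<in> P")
      case True
      then show ?thesis by (rule roots.simple)
    next
      case False
      have vnn: "0 \<le> co p v" if "p \<in> P" for p using v that nnspan_P_iff by blast
      have "\<exists>p\<in>P. 0 < co p v * B p v"
      proof (rule ccontr)
        assume "\<not> ?thesis"
        then have "(\<Sum>p\<in>P. co p v * B p v) \<le> 0" by (intro sum_nonpos) force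
        then show False using B_expand[OF rts_span[OF v(1)], of v] rts_norm[OF v(1)] by simp
      qed
      then obtain p where p: "p \<in> P" "0 < co p v * B p v" by blast
      then have pB: "0 < B p v" using vnn[OF p(1)] by (simp add: zero_less_mult_iff)
      define m where "m = B p v"
      define w where "w = refl B p v"
      have w_eq: "w = v - m *\<^sub>R p" by (simp add: w_def m_def refl_def)
      have m: "1 \<le> m" using rts_B_cases[OF simple_rts[OF p(1)] v(1)] pB m_def by auto
      have w: "w \<in> rts" unfolding w_def using refl_rts v p by blast
      have "B p w = - m" using B_simple p m_def unfolding w_eq by (simp add: B_simps)
      then have v_eq: "v = refl B p w" unfolding refl_def by (simp add: w_eq)
      have "height p = 1" unfolding height_def using p finite_P by (simp add: co_simple)
      then have hw: "height w < real n" using v(3) m by (simp add: w_eq height_simps)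
      have "w \<in> nnspan P"
      proof (rule ccontr)
        assume "w \<notin> nnspan P"
        then have nw: "- w \<in> nnspan P" using rts_sign w by blast
        have "co q v = 0" if "q \<in> P" "q \<noteq> p" for q
        proof -
          have "co q w = co q v" using that p by (simp add: w_eq co_simps co_simple)
          moreover have "0 \<le> - co q w" using nw that by (auto simp: nnspan_P_iff co_simps)
          ultimately show ?thesis using vnn[OF that(1)] by simp
        qed
        then have "v = co p v *\<^sub>R p"
          by (intro co_ext[OF rts_span[OF v(1)] span_scale[OF span_base[OF p(1)]]]) (auto simp: co_simps co_simple p)
        moreover from this have "co p v * co p v * 2 = 2" using rts_norm[OF v(1)] B_simple[OF p(1)]
          by (metis B_simps(3,4) mult.assoc real_scaleR_def)
        then have "co p v = 1" using vnn[OF p(1)]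
          by (metis abs_of_nonneg mult_cancel_right1 mult.right_neutral real_sqrt_abs2 real_sqrt_one zero_neq_numeral)
        ultimately have "v = p" by simp
        then show False using False p by simp
      qed
      then have "w \<in> roots B P" using Suc.IH w hw by blast
      then show ?thesis unfolding v_eq using p(1) by (rule roots.reflect)
    qed
  qed
  then show ?thesis using assms reals_Archimedean2 by blast
qed

abbreviation "X \<equiv> pos_roots B P"

lemma X_iff: "v \<in> X \<longleftrightarrow> v \<in> rts \<and> v \<in> nnspan P"
  unfolding pos_roots_def using roots_subset_rts pos_rts_root by blast

lemma X_rts: "v \<in> X \<Longrightarrow> v \<in> rts" and X_nn: "v \<in> X \<Longrightarrow> v \<in> nnspan P"
  and X_span: "v \<in> X \<Longrightarrow> v \<in> span P" and X_norm: "v \<in> X \<Longrightarrow> B v v = 2"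
  by (auto simp: X_iff rts_span rts_norm)

lemma rts_nonzero: "v \<in> rts \<Longrightarrow> v \<noteq> 0"
  using rts_norm by (force simp: B_simps)

lemma X_height: "v \<in> X \<Longrightarrow> 0 < height v"
  using height_pos X_iff rts_nonzero by blast

lemma rts_X: "v \<in> rts \<Longrightarrow> v \<in> X \<or> - v \<in> X"
  using rts_sign rts_neg X_iff by blast

lemma X_neg: "v \<in> X \<Longrightarrow> - v \<notin> X"
  using nnspan_antisym rts_nonzero X_iff by blast

text \<open>d is the null root of the component, found as a positive isotropic lattice vector of
  least height. For y = t d, the fractional part of t would yield one of smaller height.\<close>

lemma primitive_iso:
  assumes C: "C \<in> comps" and e: "e \<in> lat" "e \<in> span C" "B e e = 0" "e \<noteq> 0"
  obtains d where "d \<in> lat" "d \<in> span C" "B d d = 0" "d \<noteq> 0" "d \<in> nnspan P"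
    "\<And>y. y \<in> lat \<Longrightarrow> y \<in> span C \<Longrightarrow> B y y = 0 \<Longrightarrow> \<exists>k::int. y = of_int k *\<^sub>R d"
proof -
  define Q where "Q y \<longleftrightarrow> y \<in> lat \<and> y \<in> span C \<and> B y y = 0 \<and> y \<noteq> 0 \<and> y \<in> nnspan P" for y
  have "Q e \<or> Q (- e)"
    using iso_sign[OF C e(2,3)] e by (auto simp: Q_def lat_simps span_neg B_simps)
  then obtain e' where "Q e'" by blast
  \<comment> \<open>Heights of lattice vectors are integers, so minimising their floors as natural
    numbers loses nothing.\<close>
  then obtain d where d: "Q d" and least: "\<And>y. Q y \<Longrightarrow> nat \<lfloor>height d\<rfloor> \<le> nat \<lfloor>height y\<rfloor>"
    using ex_has_least_nat[of Q e' "\<lambda>y. nat \<lfloor>height y\<rfloor>"] by blast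
  have hint: "height y \<in> \<int>" if "y \<in> lat" for y
    using that by (auto simp: height_def lat_def intro!: Ints_sum)
  have least: "height d \<le> height y" if y: "Q y" for y
  proof -
    have "0 < height y" "0 < height d" using y d height_pos by (auto simp: Q_def)
    moreover obtain m n :: int where "height y = m" "height d = n"
      using hint y d by (metis Ints_cases Q_def)
    ultimately show ?thesis using least[OF y] by simp
  qed
  have "\<exists>k::int. y = of_int k *\<^sub>R d" if y: "y \<in> lat" "y \<in> span C" "B y y = 0" for y
  proof -
    obtain t where t: "y = t *\<^sub>R d"
      using iso_proportional[OF C _ _ _ _ y(2,3)] d nnspan_comp_coeffs[OF C] unfolding Q_def by metis
    define z where "z = y - of_int \<lfloor>t\<rfloor> *\<^sub>R d"
    have z_eq: "z = (t - of_int \<lfloor>t\<rfloor>) *\<^sub>R d" by (simp add: z_def t scaleR_diff_left)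
    have frac: "0 \<le> t - of_int \<lfloor>t\<rfloor>" "t - of_int \<lfloor>t\<rfloor> < 1" by linarith+
    have hd: "0 < height d" using d height_pos by (auto simp: Q_def)
    have "z = 0"
    proof (rule ccontr)
      assume "z \<noteq> 0"
      moreover have "z \<in> lat" unfolding z_def using y d by (simp add: lat_simps Q_def)
      moreover have "z \<in> span C" "B z z = 0" "z \<in> nnspan P"
        using d frac unfolding z_eq by (auto simp: Q_def span_scale B_simps nnspan_P_scale)
      ultimately have "height d \<le> height z" using least Q_def by blast
      also have "\<dots> = (t - of_int \<lfloor>t\<rfloor>) * height d" by (simp add: z_eq height_simps)
      also have "\<dots> < height d" using frac hd by simp
      finally show False by simp
    qed
    then show ?thesis unfolding z_def by (metis eq_iff_diff_eq_0)
  qed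
  then show thesis using that d Q_def by blast
qed

text \<open>Up to sign a root of the plane is positive, hence a nonnegative combination of a and b.
  Its coordinates are unique because proportional roots, having equal norm, are equal or
  opposite.\<close>

lemma no_mixed_root:
  assumes ab: "\<And>v. v \<in> X \<Longrightarrow> v \<in> span {a, b} \<Longrightarrow> v \<in> nnspan {a, b}"
    and X: "a \<in> X" "b \<in> X" "a \<noteq> b" and xy: "x < 0" "0 < y"
  shows "x *\<^sub>R a + y *\<^sub>R b \<notin> rts"
proof
  have ind: "s = 0 \<and> t = 0" if "s *\<^sub>R a + t *\<^sub>R b = 0" for s t
  proof (rule ccontr)
    assume n: "\<not> (s = 0 \<and> t = 0)"
    have "s \<noteq> 0" "t \<noteq> 0" using that n X rts_nonzero X_rts by (auto simp: scaleR_eq_0_iff)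
    then have a: "a = (- t / s) *\<^sub>R b" using that
      by (metis (no_types, opaque_lifting) divide_inverse_commute eq_neg_iff_add_eq_0 scaleR_minus_left scaleR_minus_right scaleR_one scaleR_scaleR left_inverse)
    define r where "r = - t / s"
    have a: "a = r *\<^sub>R b" using a r_def by simp
    have "B a a = r * r * B b b" unfolding a by (simp add: B_simps)
    then have "r * r = 1" using X_norm[OF X(1)] X_norm[OF X(2)] by simp
    then have "r = 1 \<or> r = -1" by (simp only: square_eq_1_iff)
    then have "a = b \<or> a = - b" using a by auto
    then show False using X X_neg[OF X(2)] by auto
  qed
  assume r: "x *\<^sub>R a + y *\<^sub>R b \<in> rts"
  define v where "v = x *\<^sub>R a + y *\<^sub>R b"
  have vs: "v \<in> span {a, b}" "- v \<in> span {a, b}"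
    unfolding v_def by (intro span_add span_neg span_scale span_base; simp)+
  consider "v \<in> nnspan {a, b}" | "- v \<in> nnspan {a, b}" using rts_X r ab vs v_def by blast
  then show False
  proof cases
    case 1
    then obtain s t where "0 \<le> s" "0 \<le> t" "v = s *\<^sub>R a + t *\<^sub>R b" by (auto simp: nnspan_pair)
    moreover from this have "(s - x) *\<^sub>R a + (t - y) *\<^sub>R b = 0" by (simp add: v_def algebra_simps)
    ultimately show False using ind xy by force
  next
    case 2
    then obtain s t where "0 \<le> s" "0 \<le> t" "- v = s *\<^sub>R a + t *\<^sub>R b" by (auto simp: nnspan_pair)
    moreover from this have "v + (s *\<^sub>R a + t *\<^sub>R b) = 0" by (metis add.right_inverse)
    then have "(s + x) *\<^sub>R a + (t + y) *\<^sub>R b = 0" by (simp add: v_def algebra_simps)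
    ultimately show False using ind xy by force
  qed
qed

section \<open>Fundamental vectors and clean sets\<close>

text \<open>If \<open>B a b\<close> were positive, then b - a or 2 b - a would be a root of mixed
  sign. For the values 0 and -1 the integers \<open>B c a\<close> and \<open>B c b\<close> determine
  the coordinates of c (types A1 x A1 and A2); for -2, affine A1, they only show that the
  coordinates differ by 1.\<close>

lemma fundamental_below_left:
  assumes lin: "linear_subset X Y" and fund: "fundamental_vectors Y a b" and c: "c \<in> Y" "c \<noteq> a" "c \<noteq> b"
  shows "c - a \<in> nnspan P"
proof -
  obtain W where W: "subspace W" "Y = X \<inter> W" using lin by (auto simp: linear_subset_def)
  have ab: "a \<in> X" "b \<in> X" "a \<in> W" "b \<in> W" and Y: "Y \<subseteq> nnspan {a, b}" and cX: "c \<in> X"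
    using fund c W by (auto simp: fundamental_vectors_def)
  have "span {a, b} \<subseteq> W" using W ab by (intro span_minimal) auto
  then have plane: "v \<in> nnspan {a, b}" if "v \<in> X" "v \<in> span {a, b}" for v using that Y W by blast
  obtain x y where xy: "0 \<le> x" "0 \<le> y" "c = x *\<^sub>R a + y *\<^sub>R b"
    using Y c nnspan_pair by (metis subsetD)
  note nrm = X_norm[OF ab(1)] X_norm[OF ab(2)] X_norm[OF cX]
  have sym: "B b a = B a b" by (rule B_sym)
  have "a \<noteq> b"
  proof
    assume "a = b"
    then have c': "c = (x + y) *\<^sub>R a" using xy by (simp add: scaleR_add_left)
    have "B c c = (x + y) * (x + y) * 2" unfolding c' using nrm(1) by (simp add: B_simps)
    then have "(x + y) * (x + y) = 1" using nrm(3) by simp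
    then have "x + y = 1 \<or> x + y = -1" by (simp only: square_eq_1_iff)
    then have "x + y = 1" using xy by linarith
    then show False using c c' by simp
  qed
  note mixed = no_mixed_root[OF plane ab(1,2) this] no_mixed_root[of b a, OF plane[unfolded insert_commute[of a]] ab(2,1)]
  define m where "m = B c a"
  define n where "n = B c b"
  have mn: "m \<in> {-2, -1, 0, 1, 2}" "n \<in> {-2, -1, 0, 1, 2}"
    unfolding m_def n_def using rts_B_cases X_rts cX ab by metis+
  have m: "m = 2 * x + y * B a b" and n: "n = x * B a b + 2 * y"
    unfolding m_def n_def using nrm sym by (simp_all add: xy(3) B_simps)
  have "B c c = x * B c a + y * B c b" by (subst (2) xy(3)) (simp add: B_simps)
  then have nc: "x * m + y * n = 2" using nrm(3) by (simp add: m_def n_def)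
  consider "B a b = 2" | "B a b = 1" | "B a b = 0" | "B a b = -1" | "B a b = -2"
    using rts_B_cases X_rts ab by blast
  then show ?thesis
  proof cases
    case 1
    then show ?thesis using mixed(1)[of "-1" 2] rts_combination[of a b "-1" 2] X_rts ab by simp
  next
    case 2
    then show ?thesis using mixed(1)[of "-1" 1] rts_combination[of a b "-1" 1] X_rts ab by simp
  next
    case 3
    then have "x = m / 2" "y = n / 2" using m n by simp_all
    then have "(x = 1 \<and> y = 0) \<or> (x = 0 \<and> y = 1)" using nc xy(1,2) mn by auto
    then show ?thesis using c xy(3) by auto
  next
    case 4
    then have "x = (2 * m + n) / 3" "y = (m + 2 * n) / 3" using m n by simp_all
    then have "(x = 1 \<and> y = 0) \<or> (x = 0 \<and> y = 1) \<or> (x = 1 \<and> y = 1)" using nc xy(1,2) mn by auto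
    then have "c = a + b" using c xy(3) by auto
    then show ?thesis using X_nn ab by simp
  next
    case 5
    then have "m = 2 * (x - y)" "n = - 2 * (x - y)" using m n by simp_all
    then have "x * (2 * (x - y)) + y * (- 2 * (x - y)) = 2" using nc by metis
    then have "(x - y) * (x - y) = 1" by (simp add: algebra_simps)
    then consider "x = y + 1" | "y = x + 1" by (force simp: square_eq_1_iff)
    then show ?thesis
    proof cases
      case 1
      then have "c - a = y *\<^sub>R (a + b)" using xy(3) by (simp add: algebra_simps)
      then show ?thesis using nnspan_P_add nnspan_P_scale X_nn ab xy by metis
    next
      case 2
      have "x \<noteq> 0" using xy(3) 2 c by auto
      \<comment> \<open>The coordinates are not known to be integers. The reflection of c in b is c
        - 2 b = x a + (x - 1) b, which would be of mixed sign.\<close>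
      moreover have "\<not> (0 < x \<and> x < 1)"
      proof
        assume x: "0 < x \<and> x < 1"
        have "n = 2" using 2 5 n by simp
        then have "1 *\<^sub>R c + (-2) *\<^sub>R b \<in> rts" using rts_combination[of c b 1 "-2"] X_rts cX ab n_def by simp
        moreover have "1 *\<^sub>R c + (-2) *\<^sub>R b = (x - 1) *\<^sub>R b + x *\<^sub>R a" using xy(3) 2 by (simp add: algebra_simps scaleR_2)
        ultimately show False using mixed(2)[of "x - 1" x] x \<open>a \<noteq> b\<close> by auto
      qed
      ultimately have "0 \<le> x - 1" using xy by linarith
      then have "(x - 1) *\<^sub>R a + y *\<^sub>R b \<in> nnspan P" using nnspan_P_add nnspan_P_scale X_nn ab xy by blast
      moreover have "c - a = (x - 1) *\<^sub>R a + y *\<^sub>R b" using xy(3) by (simp add: algebra_simps)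
      ultimately show ?thesis by simp
    qed
  qed
qed

lemma fundamental_below:
  assumes "linear_subset X Y" "fundamental_vectors Y a b" "c \<in> Y" "c \<noteq> a" "c \<noteq> b"
  shows "c - a \<in> nnspan P" "c - b \<in> nnspan P"
proof -
  have "fundamental_vectors Y b a"
    using assms(2) by (simp add: fundamental_vectors_def insert_commute)
  then show "c - a \<in> nnspan P" "c - b \<in> nnspan P" using fundamental_below_left assms by blast+
qed

section \<open>Integral relations and the definite case\<close>

lemma integer_relation:
  assumes fin: "finite U" and lat: "U \<subseteq> lat" and rel: "(\<Sum>z\<in>U. x z *\<^sub>R z) = 0" and nz: "\<And>z. z \<in> U \<Longrightarrow> x z \<noteq> 0"
  obtains y :: "'a \<Rightarrow> int" where "(\<Sum>z\<in>U. of_int (y z) *\<^sub>R z) = 0" "\<And>z. z \<in> U \<Longrightarrow> 0 < x z \<Longrightarrow> 0 < y z"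
    "\<And>z. z \<in> U \<Longrightarrow> x z < 0 \<Longrightarrow> y z < 0"
proof -
  \<comment> \<open>The first sum keeps the error in every coordinate below 1; the second makes 1 /
    n at most the absolute value of each coefficient, so that rounding preserves signs.\<close>
  define K where "K = 1 + (\<Sum>z\<in>U. \<Sum>p\<in>P. \<bar>co p z\<bar>) + (\<Sum>z\<in>U. 1 / \<bar>x z\<bar>)"
  have K1: "1 \<le> K" unfolding K_def by (simp add: sum_nonneg)
  obtain n :: nat where n: "K < real n" using reals_Archimedean2 by blast
  then have n0: "0 < n" using K1 by (cases n) auto
  obtain f where f: "bij_betw f {..<card U} U" using ex_bij_betw_nat_finite[OF fin] by (metis atLeast0LessThan)
  \<comment> \<open>Simultaneous Dirichlet approximation: one multiplier q brings all coefficients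
    within 1 / n of integers. The rounded combination then has integer coordinates of absolute value
    below 1, so it vanishes.\<close>
  obtain q p where q: "0 < q" and approx: "\<And>i. i < card U \<Longrightarrow> \<bar>of_int q * x (f i) - of_int (p i)\<bar> < 1 / n"
    using Dirichlet_approx_simult[OF n0, of "card U" "\<lambda>i. x (f i)"] by (metis comp_apply of_nat_less_iff)
  define y where "y z = p (the_inv_into {..<card U} f z)" for z
  have y: "\<bar>of_int q * x z - of_int (y z)\<bar> < 1 / n" if "z \<in> U" for z
  proof -
    have "z \<in> f ` {..<card U}" using f that by (simp add: bij_betw_def)
    then obtain i where "i < card U" "z = f i" by auto
    then show ?thesis using approx f by (simp add: y_def the_inv_into_f_f bij_betw_def)
  qed
  have small: "1 / n \<le> \<bar>x z\<bar>" if "z \<in> U" for z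
  proof -
    have "1 / \<bar>x z\<bar> \<le> (\<Sum>z\<in>U. 1 / \<bar>x z\<bar>)" by (rule member_le_sum) (use fin that in auto)
    then have "1 / \<bar>x z\<bar> \<le> K" unfolding K_def by (smt (verit) sum_nonneg abs_ge_zero)
    then have "1 / \<bar>x z\<bar> \<le> n" using n by linarith
    then show ?thesis using nz[OF that] n0 by (simp add: field_simps)
  qed
  have q1: "\<bar>x z\<bar> \<le> of_int q * \<bar>x z\<bar>" for z using q by (simp add: mult_le_cancel_right1)
  have "co r (\<Sum>z\<in>U. of_int (y z) *\<^sub>R z) = 0" if r: "r \<in> P" for r
  proof -
    let ?s = "\<Sum>z\<in>U. of_int (y z) * co r z"
    have "(\<Sum>z\<in>U. x z * co r z) = co r (\<Sum>z\<in>U. x z *\<^sub>R z)" by (simp add: co_sum[OF r] co_simps[OF r])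
    then have "(\<Sum>z\<in>U. of_int q * x z * co r z) = 0"
      using rel co_simps(5)[OF r] by (simp add: sum_distrib_left[symmetric] mult.assoc)
    then have "?s = - (\<Sum>z\<in>U. (of_int q * x z - of_int (y z)) * co r z)"
      by (simp add: left_diff_distrib sum_subtractf)
    then have "\<bar>?s\<bar> \<le> (\<Sum>z\<in>U. \<bar>(of_int q * x z - of_int (y z)) * co r z\<bar>)" by (simp add: sum_abs)
    also have "\<dots> \<le> (\<Sum>z\<in>U. 1 / n * \<bar>co r z\<bar>)"
      unfolding abs_mult using y by (intro sum_mono mult_right_mono) (auto intro: less_imp_le)
    also have "\<dots> = (\<Sum>z\<in>U. \<bar>co r z\<bar>) / n" by (simp add: sum_divide_distrib)
    also have "(\<Sum>z\<in>U. \<bar>co r z\<bar>) \<le> (\<Sum>z\<in>U. \<Sum>p\<in>P. \<bar>co p z\<bar>)"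
      using r finite_P by (intro sum_mono member_le_sum) auto
    then have "(\<Sum>z\<in>U. \<bar>co r z\<bar>) < n" using n unfolding K_def by (smt (verit) sum_nonneg abs_ge_zero zero_le_divide_1_iff)
    then have "(\<Sum>z\<in>U. \<bar>co r z\<bar>) / n < 1" using n0 by simp
    finally have "\<bar>?s\<bar> < 1" .
    moreover have "?s \<in> \<int>" using lat r by (intro Ints_sum) (auto simp: lat_def)
    ultimately have "?s = 0" by (rule Ints_nonzero_abs_less1[rotated])
    then show ?thesis by (simp add: co_sum[OF r] co_simps[OF r])
  qed
  moreover have "(\<Sum>z\<in>U. of_int (y z) *\<^sub>R z) \<in> span P" using lat lat_span by (intro span_sum span_scale) auto
  ultimately have "(\<Sum>z\<in>U. of_int (y z) *\<^sub>R z) = 0" using co_ext[OF _ span_zero] by (simp add: co_simps)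
  moreover have "0 < y z" if "z \<in> U" "0 < x z" for z
  proof -
    have "of_int q * x z - of_int (y z) < 1 / n" using y[OF that(1)] by (simp add: abs_less_iff)
    moreover have "1 / n \<le> x z" "x z \<le> of_int q * x z" using small[OF that(1)] q1[of z] that(2) by simp_all
    ultimately have "0 < real_of_int (y z)" by linarith
    then show ?thesis by simp
  qed
  moreover have "y z < 0" if "z \<in> U" "x z < 0" for z
  proof -
    have "of_int (y z) - of_int q * x z < 1 / n" using y[OF that(1)] by (simp add: abs_less_iff)
    moreover have "1 / n \<le> - x z" "- x z \<le> - (of_int q * x z)"
      using small[OF that(1)] q1[of z] that(2) by (simp_all add: abs_if)
    ultimately have "real_of_int (y z) < 0" by linarith
    then show ?thesis by simp
  qed
  ultimately show thesis using that by blast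
qed

lemma mset_of_multiplicities:
  fixes k :: "'a \<Rightarrow> nat"
  assumes "finite A"
  obtains M where "set_mset M = {a \<in> A. 0 < k a}" "sum_mset M = (\<Sum>a\<in>A. real (k a) *\<^sub>R a)"
proof -
  have "\<exists>M. set_mset M = {a \<in> A. 0 < k a} \<and> sum_mset M = (\<Sum>a\<in>A. real (k a) *\<^sub>R a)"
    using assms
  proof (induction A)
    case empty
    then show ?case by (intro exI[of _ "{#}"]) simp
  next
    case (insert a A)
    then obtain M where M: "set_mset M = {a \<in> A. 0 < k a}" "sum_mset M = (\<Sum>a\<in>A. real (k a) *\<^sub>R a)" by blast
    have "sum_mset (replicate_mset n a) = real n *\<^sub>R a" for n
      by (induction n) (simp_all add: algebra_simps)
    then show ?case using M insert.hyps by (intro exI[of _ "replicate_mset (k a) a + M"]) (auto split: if_splits)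
  qed
  then show thesis using that by blast
qed

text \<open>Rounding preserves signs, so the positive coefficients stay on S and the negative ones
  on T. Multisets record the multiplicities, which lets a relation be shortened by single
  elements.\<close>

lemma mset_relation:
  assumes fin: "finite S" "finite T" and lat: "S \<subseteq> lat" "T \<subseteq> lat" and dis: "S \<inter> T = {}"
    and v: "v \<in> nnspan S" "v \<in> nnspan T" "v \<noteq> 0"
  obtains M N where "set_mset M \<subseteq> S" "set_mset N \<subseteq> T" "sum_mset M = sum_mset N" "M \<noteq> {#} \<or> N \<noteq> {#}"
proof -
  obtain c where c: "\<forall>z\<in>S. 0 \<le> c z" "v = (\<Sum>z\<in>S. c z *\<^sub>R z)" using v(1) nnspan_finite[OF fin(1)] by blast
  obtain d where d: "\<forall>z\<in>T. 0 \<le> d z" "v = (\<Sum>z\<in>T. d z *\<^sub>R z)" using v(2) nnspan_finite[OF fin(2)] by blast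
  define x where "x z = (if z \<in> S then c z else - d z)" for z
  define U where "U = {z \<in> S \<union> T. x z \<noteq> 0}"
  have "(\<Sum>z\<in>U. x z *\<^sub>R z) = (\<Sum>z\<in>S \<union> T. x z *\<^sub>R z)"
    unfolding U_def using fin by (intro sum.mono_neutral_left) auto
  also have "\<dots> = (\<Sum>z\<in>S. x z *\<^sub>R z) + (\<Sum>z\<in>T. x z *\<^sub>R z)" using fin dis by (rule sum.union_disjoint)
  also have "(\<Sum>z\<in>S. x z *\<^sub>R z) = v" using c by (simp add: x_def)
  also have "(\<Sum>z\<in>T. x z *\<^sub>R z) = (\<Sum>z\<in>T. - (d z *\<^sub>R z))" using dis by (intro sum.cong) (auto simp: x_def)
  also have "\<dots> = - v" using d by (simp add: sum_negf)
  finally have rel: "(\<Sum>z\<in>U. x z *\<^sub>R z) = 0" by simp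
  have finU: "finite U" using fin by (simp add: U_def)
  have latU: "U \<subseteq> lat" using lat by (auto simp: U_def)
  obtain y :: "'a \<Rightarrow> int" where y: "(\<Sum>z\<in>U. of_int (y z) *\<^sub>R z) = 0" "\<And>z. z \<in> U \<Longrightarrow> 0 < x z \<Longrightarrow> 0 < y z"
    "\<And>z. z \<in> U \<Longrightarrow> x z < 0 \<Longrightarrow> y z < 0"
    using integer_relation[OF finU latU rel] unfolding U_def by blast
  have yS: "0 < y z" if "z \<in> U" "z \<in> S" for z using y(2)[OF that(1)] that c(1) by (force simp: U_def x_def)
  have yT: "y z < 0" if "z \<in> U" "z \<notin> S" for z using y(3)[OF that(1)] that d(1) by (force simp: U_def x_def)
  obtain M where M: "set_mset M = {a \<in> U \<inter> S. 0 < nat (y a)}" "sum_mset M = (\<Sum>a\<in>U \<inter> S. real (nat (y a)) *\<^sub>R a)"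
    using mset_of_multiplicities[of "U \<inter> S" "\<lambda>a. nat (y a)"] finU by blast
  obtain N where N: "set_mset N = {a \<in> U - S. 0 < nat (- y a)}" "sum_mset N = (\<Sum>a\<in>U - S. real (nat (- y a)) *\<^sub>R a)"
    using mset_of_multiplicities[of "U - S" "\<lambda>a. nat (- y a)"] finU by blast
  have "0 = (\<Sum>z\<in>U \<inter> S. of_int (y z) *\<^sub>R z) + (\<Sum>z\<in>U - S. of_int (y z) *\<^sub>R z)"
    using y(1) finU by (subst sum.union_disjoint[symmetric]) (auto simp: Int_Diff_Un)
  also have "(\<Sum>z\<in>U \<inter> S. of_int (y z) *\<^sub>R z) = sum_mset M"
    unfolding M(2) using yS by (intro sum.cong) (auto simp: less_imp_le)
  also have "(\<Sum>z\<in>U - S. of_int (y z) *\<^sub>R z) = - sum_mset N"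
    unfolding N(2) sum_negf[symmetric] using yT by (intro sum.cong) (force simp: less_imp_le)+
  finally have "sum_mset M = sum_mset N" by simp
  moreover have "M \<noteq> {#} \<or> N \<noteq> {#}"
  proof (rule ccontr)
    assume "\<not> ?thesis"
    then have "U = {}" using M(1) N(1) yS yT by fastforce
    then have "\<forall>z\<in>S. c z = 0" by (auto simp: U_def x_def)
    then show False using c(2) v(3) by simp
  qed
  moreover have "set_mset M \<subseteq> S" "set_mset N \<subseteq> T" using M(1) N(1) by (auto simp: U_def)
  ultimately show thesis using that by blast
qed

lemma B_sum_mset_nonpos:
  assumes "\<And>s t. s \<in># M \<Longrightarrow> t \<in># N \<Longrightarrow> B s t \<le> 0"
  shows "B (sum_mset M) (sum_mset N) \<le> 0"
proof -
  have *: "B s (sum_mset N) \<le> 0" if "\<And>t. t \<in># N \<Longrightarrow> B s t \<le> 0" for s N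
    using that by (induction N) (auto simp: B_simps intro: add_nonpos_nonpos)
  show ?thesis using assms
  proof (induction M)
    case (add s M)
    then show ?case using *[of N s] by (auto simp: B_simps intro: add_nonpos_nonpos)
  qed (simp add: B_simps)
qed

text \<open>Induction on the total size. Positive heights make the common sum nonzero. Definiteness
  enters twice: it gives that sum positive norm, and it excludes \<open>B s t = 2\<close>, where s -
  t would be a nonzero isotropic vector. Closedness decides the side of the difference of s and
  t.\<close>

lemma no_mset_relation:
  assumes ST: "S \<inter> T = {}" "S \<union> T = Z" "closed_in Z S" "closed_in Z T" and Z: "Z \<subseteq> X"
    and diff: "\<And>s t. s \<in> Z \<Longrightarrow> t \<in> Z \<Longrightarrow> s - t \<in> X \<Longrightarrow> s - t \<in> Z"
    and definite: "\<And>v. v \<in> span Z \<Longrightarrow> B v v = 0 \<Longrightarrow> v = 0"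
    and MN: "set_mset M \<subseteq> S" "set_mset N \<subseteq> T" "sum_mset M = sum_mset N" "M \<noteq> {#} \<or> N \<noteq> {#}"
  shows False
  using MN
proof (induction "size M + size N" arbitrary: M N rule: less_induct)
  case less
  note MN = less.prems
  have h: "0 < height (sum_mset K)" if "K \<noteq> {#}" "set_mset K \<subseteq> Z" for K
    using that
  proof (induction K)
    case (add k K)
    then have "0 < height k" using Z X_height by auto
    then show ?case using add by (cases "K = {#}") (auto simp: height_simps)
  qed simp
  have sp: "sum_mset K \<in> span Z" if "set_mset K \<subseteq> Z" for K
    using that by (induction K) (auto intro: span_add span_base span_zero)
  have MZ: "set_mset M \<subseteq> Z" "set_mset N \<subseteq> Z" using MN ST by auto
  have "sum_mset M \<noteq> 0" using h[OF _ MZ(1)] h[OF _ MZ(2)] MN(3,4) by (force simp: height_simps)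
  then have "B (sum_mset M) (sum_mset N) \<noteq> 0" using definite[OF sp[OF MZ(1)]] MN(3) by auto
  moreover have "0 \<le> B (sum_mset M) (sum_mset N)"
    using psd[of "sum_mset M"] sp[OF MZ(1)] span_mono[of Z "span P"] Z X_span MN(3) by (metis span_span subsetI subset_iff)
  ultimately have "\<not> B (sum_mset M) (sum_mset N) \<le> 0" by simp
  then obtain s t where st: "s \<in># M" "t \<in># N" "0 < B s t"
    using B_sum_mset_nonpos by (meson not_le)
  have sZ: "s \<in> S" "t \<in> T" "s \<in> Z" "t \<in> Z" using st MN ST by auto
  have rt: "s \<in> rts" "t \<in> rts" using sZ Z X_rts by auto
  have "B s t \<noteq> 2"
  proof
    assume "B s t = 2"
    then have "B (s - t) (s - t) = 0" using rts_norm rt B_sym[of t s] by (simp add: B_simps)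
    then have "s = t" using definite[of "s - t"] sZ by (simp add: span_diff span_base)
    then show False using sZ ST by auto
  qed
  then have st1: "B s t = 1" using rts_B_cases[OF rt] st(3) by auto
  then have "s - t \<in> X \<or> t - s \<in> X" using rts_X[OF rts_diff[OF rt]] by simp
  then show False
  proof
    assume X: "s - t \<in> X"
    let ?r = "s - t"
    have r: "?r \<in> Z" using diff sZ X by blast
    have "?r \<in> S"
    proof (rule ccontr)
      assume "?r \<notin> S"
      then have "?r \<in> T" using r ST by blast
      moreover have "s = 1 *\<^sub>R ?r + 1 *\<^sub>R t" by simp
      then have "s \<in> nnspan {?r, t}" unfolding nnspan_pair by (intro exI[of _ 1]) simp
      ultimately have "s \<in> T" using ST(4) sZ unfolding closed_in_def by blast
      then show False using sZ ST by blast
    qed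
    have eq: "sum_mset (add_mset ?r (M - {#s#})) = sum_mset (N - {#t#})"
      using st MN(3) by (simp add: sum_mset_diff)
    have sz: "size (add_mset ?r (M - {#s#})) + size (N - {#t#}) < size M + size N"
      using st(1,2) size_Suc_Diff1[of s M] size_Suc_Diff1[of t N] by simp
    have sub: "set_mset (add_mset ?r (M - {#s#})) \<subseteq> S" "set_mset (N - {#t#}) \<subseteq> T"
      using \<open>?r \<in> S\<close> MN(1,2) by (auto dest: in_diffD)
    show False using less.hyps[OF sz sub eq] by simp
  next
    assume X: "t - s \<in> X"
    let ?r = "t - s"
    have r: "?r \<in> Z" using diff sZ X by blast
    have "?r \<in> T"
    proof (rule ccontr)
      assume "?r \<notin> T"
      then have "?r \<in> S" using r ST by blast
      moreover have "t = 1 *\<^sub>R ?r + 1 *\<^sub>R s" by simp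
      then have "t \<in> nnspan {?r, s}" unfolding nnspan_pair by (intro exI[of _ 1]) simp
      ultimately have "t \<in> S" using ST(3) sZ unfolding closed_in_def by blast
      then show False using sZ ST by blast
    qed
    have eq: "sum_mset (M - {#s#}) = sum_mset (add_mset ?r (N - {#t#}))"
      using st MN(3) by (simp add: sum_mset_diff)
    have sz: "size (M - {#s#}) + size (add_mset ?r (N - {#t#})) < size M + size N"
      using st(1,2) size_Suc_Diff1[of s M] size_Suc_Diff1[of t N] by simp
    have sub: "set_mset (M - {#s#}) \<subseteq> S" "set_mset (add_mset ?r (N - {#t#})) \<subseteq> T"
      using \<open>?r \<in> T\<close> MN(1,2) by (auto dest: in_diffD)
    show False using less.hyps[OF sz sub eq] by simp
  qed
qed

lemma clean_definite:
  assumes "finite Z" "Z \<subseteq> X"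
    and "\<And>s t. s \<in> Z \<Longrightarrow> t \<in> Z \<Longrightarrow> s - t \<in> X \<Longrightarrow> s - t \<in> Z"
    and "\<And>v. v \<in> span Z \<Longrightarrow> B v v = 0 \<Longrightarrow> v = 0"
  shows "clean Z"
  unfolding clean_def
proof (intro allI impI)
  fix S assume S: "biclosed_in Z S"
  then have ST: "S \<inter> (Z - S) = {}" "S \<union> (Z - S) = Z" "closed_in Z S" "closed_in Z (Z - S)"
    by (auto simp: biclosed_in_def)
  have "v = 0" if v: "v \<in> nnspan S" "v \<in> nnspan (Z - S)" for v
  proof (rule ccontr)
    assume "v \<noteq> 0"
    have "Z \<subseteq> lat" using assms(2) X_rts rts_lat by blast
    then have "S \<subseteq> lat" "Z - S \<subseteq> lat" using ST(2) by blast+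
    moreover have "finite S" "finite (Z - S)" using assms(1) ST(2) by (metis finite_Un)+
    ultimately obtain M N where MN: "set_mset M \<subseteq> S" "set_mset N \<subseteq> Z - S" "sum_mset M = sum_mset N" "M \<noteq> {#} \<or> N \<noteq> {#}"
      using mset_relation[OF _ _ _ _ ST(1) v \<open>v \<noteq> 0\<close>] by metis
    show False by (rule no_mset_relation[OF ST assms(2-4) MN])
  qed
  then show "weakly_separable Z S" unfolding weakly_separable_def using nnspan_0 by blast
qed

section \<open>Clean sets in an affine plane with at most one further root\<close>

lemma plane_coordinates:
  assumes "y \<in> span {a, d}"
  obtains l m where "y = l *\<^sub>R a + m *\<^sub>R d"
  using assms by (auto simp: span_insert span_singleton algebra_simps)

text \<open>Height and pairing with a are coordinates on the plane, so the slope \<open>sl\<close>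
  orders its positive roots like points on a line, and a root whose slope is between two others lies
  in their nonnegative span. At most one of S and T contains c, so a common vector of their cones
  lies in the plane and uses c with coefficient 0.\<close>

lemma clean_affine_plane:
  assumes fin: "finite Z" and Z: "Z \<subseteq> X" "Z \<subseteq> span {a, d} \<union> C" "C \<subseteq> {c}" "C \<noteq> {} \<Longrightarrow> c \<notin> span {a, d}"
    and a: "a \<in> X" and d: "d \<in> span P" "B d d = 0" "height d \<noteq> 0"
  shows "clean Z"
  unfolding clean_def
proof (intro allI impI)
  fix S assume S: "biclosed_in Z S"
  define T where "T = Z - S"
  have ST: "S \<subseteq> Z" "T \<subseteq> Z" "S \<inter> T = {}" "closed_in Z S" "closed_in Z T"
    using S by (auto simp: T_def biclosed_in_def)
  have fST: "finite S" "finite T" using ST fin finite_subset by blast+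
  let ?V = "span {a, d}"
  have Bad: "B a d = 0" using iso_radical[OF d(1,2) X_span[OF a]] B_sym by metis
  have inj: "y = 0" if "y \<in> ?V" "height y = 0" "B a y = 0" for y
  proof -
    obtain l m where y: "y = l *\<^sub>R a + m *\<^sub>R d" using plane_coordinates \<open>y \<in> ?V\<close> .
    have "l = 0" using that(3) X_norm[OF a] Bad unfolding y by (simp add: B_simps)
    moreover from this have "m = 0" using that(2) d(3) unfolding y by (simp add: height_simps)
    ultimately show ?thesis using y by simp
  qed
  define sl where "sl x = B a x / height x" for x
  have Basl: "B a x = sl x * height x" if "x \<in> X" for x using X_height[OF that] by (simp add: sl_def)
  have between: "x \<in> nnspan {u, w}"
    if x: "u \<in> X" "w \<in> X" "x \<in> X" "u \<in> ?V" "w \<in> ?V" "x \<in> ?V" "sl u \<le> sl x" "sl x \<le> sl w" for x u w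
  proof -
    note h = X_height[OF x(1)] X_height[OF x(2)] X_height[OF x(3)]
    obtain l where l: "0 \<le> l" "l \<le> 1" "sl x = (1 - l) * sl u + l * sl w"
    proof (cases "sl u = sl w")
      case True
      then show thesis using that[of 0] x by simp
    next
      case False
      then have lt: "0 < sl w - sl u" using x by simp
      define l where "l = (sl x - sl u) / (sl w - sl u)"
      have "l * (sl w - sl u) = sl x - sl u" using lt by (simp add: l_def)
      then have "sl x = (1 - l) * sl u + l * sl w" by (simp add: algebra_simps)
      moreover have "0 \<le> l" "l \<le> 1" using lt x by (simp_all add: l_def)
      ultimately show thesis using that by blast
    qed
    define k m where "k = (1 - l) * height x / height u" "m = l * height x / height w"
    have km: "k * height u = (1 - l) * height x" "m * height w = l * height x" "0 \<le> k" "0 \<le> m"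
      using h l by (simp_all add: k_m_def)
    have "x - (k *\<^sub>R u + m *\<^sub>R w) = 0"
    proof (rule inj)
      show "x - (k *\<^sub>R u + m *\<^sub>R w) \<in> ?V" using x by (intro span_diff span_add span_scale)
      show "height (x - (k *\<^sub>R u + m *\<^sub>R w)) = 0" using km by (simp add: height_simps algebra_simps)
      have "B a (x - (k *\<^sub>R u + m *\<^sub>R w)) = sl x * height x - (sl u * (k * height u) + sl w * (m * height w))"
        using x(1-3) by (simp add: B_simps Basl algebra_simps)
      also have "\<dots> = 0" unfolding km l(3) by (simp add: algebra_simps)
      finally show "B a (x - (k *\<^sub>R u + m *\<^sub>R w)) = 0" .
    qed
    then have "x = k *\<^sub>R u + m *\<^sub>R w" by simp
    then show ?thesis unfolding nnspan_pair using km by blast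
  qed
  have key: "v = 0" if v: "v \<in> nnspan (S \<inter> ?V)" "v \<in> nnspan (T \<inter> ?V)" for v
  proof (rule ccontr)
    assume v0: "v \<noteq> 0"
    have vX: "v \<in> nnspan X" using v(1) nnspan_mono[of "S \<inter> ?V" X] ST Z by blast
    have "0 \<le> height v" using linear_nnspan_nonneg[OF linear_height _ vX] X_height less_imp_le by blast
    moreover have "height v \<noteq> 0" using linear_nnspan_eq_0[OF linear_height X_height vX] v0 by blast
    ultimately have hv: "0 < height v" by simp
    have ex: "\<exists>x\<in>R. \<exists>y\<in>R. sl x \<le> sl v \<and> sl v \<le> sl y \<and> (\<forall>z\<in>R. sl x \<le> sl z)"
      if R: "finite R" "R \<subseteq> X" "v \<in> nnspan R" for R
    proof -
      have ne: "R \<noteq> {}" using R(3) v0 by (auto simp: nnspan_def)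
      then have "Min (sl ` R) \<in> sl ` R" "Max (sl ` R) \<in> sl ` R" using R(1) by simp_all
      then obtain x y where "x \<in> R" "y \<in> R" "sl x = Min (sl ` R)" "sl y = Max (sl ` R)" by auto
      then have xy: "x \<in> R" "y \<in> R" "\<forall>z\<in>R. sl x \<le> sl z" "\<forall>z\<in>R. sl z \<le> sl y"
        using R(1) by simp_all
      have lin: "linear (\<lambda>z. B a z - s * height z)" for s
        by (intro linear_compose_sub linear_B linear_compose_scale_right[OF linear_height, unfolded real_scaleR_def])
      have "0 \<le> B a v - sl x * height v"
        by (rule linear_nnspan_nonneg[OF lin _ R(3)])
           (use xy R X_height Basl in \<open>force simp: left_diff_distrib[symmetric]\<close>)
      moreover have "0 \<le> - (B a v - sl y * height v)"
        by (rule linear_nnspan_nonneg[OF linear_compose_neg[OF lin] _ R(3)])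
           (use xy R X_height Basl in \<open>force simp: mult_right_mono less_imp_le\<close>)
      ultimately have "sl x \<le> sl v" "sl v \<le> sl y" using hv by (simp_all add: sl_def[of v] field_simps)
      then show ?thesis using xy by blast
    qed
    obtain s s' where s: "s \<in> S \<inter> ?V" "s' \<in> S \<inter> ?V" "sl s \<le> sl v" "sl v \<le> sl s'"
      using ex[of "S \<inter> ?V"] v ST Z fST by (meson finite_Int inf.coboundedI1 order_trans)
    obtain t t' where t: "t \<in> T \<inter> ?V" "t' \<in> T \<inter> ?V" "sl t \<le> sl v" "sl v \<le> sl t'"
      using ex[of "T \<inter> ?V"] v ST Z fST by (meson finite_Int inf.coboundedI1 order_trans)
    have inX: "s \<in> X" "s' \<in> X" "t \<in> X" "t' \<in> X" "s \<in> Z" "t \<in> Z" using s t ST Z by auto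
    show False
    \<comment> \<open>Of s and t, the one with the larger slope lies between two roots of the other
      set.\<close>
    proof (cases "sl s \<le> sl t")
      case True
      then have "t \<in> nnspan {s, s'}" using between s t inX by auto
      then have "t \<in> S" using ST(4) s t inX unfolding closed_in_def by blast
      then show False using ST t by blast
    next
      case False
      then have "s \<in> nnspan {t, t'}" using between s t inX by auto
      then have "s \<in> T" using ST(5) s t inX unfolding closed_in_def by blast
      then show False using ST s by blast
    qed
  qed
  have drop_c: "v \<in> nnspan (R \<inter> ?V)" if R: "finite R" "R \<subseteq> Z" "v \<in> nnspan R" "v \<in> ?V" for R v
  proof (cases "c \<in> R \<and> c \<notin> ?V")
    case False
    then have "R \<inter> ?V = R" using R Z by auto
    then show ?thesis using R by simp
  next
    case True
    then have RV: "R \<inter> ?V = R - {c}" using R Z by auto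
    obtain k where k: "\<forall>z\<in>R. 0 \<le> k z" "v = (\<Sum>z\<in>R. k z *\<^sub>R z)" using R nnspan_finite by blast
    let ?w = "\<Sum>z\<in>R - {c}. k z *\<^sub>R z"
    have v_eq: "v = k c *\<^sub>R c + ?w" using k(2) True sum.remove[OF R(1), of c "\<lambda>z. k z *\<^sub>R z"] by simp
    have w: "?w \<in> ?V" using RV by (intro span_sum span_scale) blast
    have "k c *\<^sub>R c \<in> ?V" using span_diff[OF R(4) w] v_eq by simp
    then have "(inverse (k c) * k c) *\<^sub>R c \<in> ?V" using span_scale[of "k c *\<^sub>R c" "{a, d}" "inverse (k c)"] by simp
    then have "k c = 0" using True by (cases "k c = 0") simp_all
    then have "v = ?w" using v_eq by simp
    then show ?thesis unfolding RV using R(1) k(1) by (subst nnspan_finite) auto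
  qed
  have nnspan_V: "v \<in> ?V" if "v \<in> nnspan R" "R \<subseteq> ?V" for R v
    using that unfolding nnspan_def by (auto intro!: span_sum span_scale)
  have "v = 0" if v: "v \<in> nnspan S" "v \<in> nnspan T" for v
  proof -
    have "S \<subseteq> ?V \<or> T \<subseteq> ?V" using ST Z by blast
    then have "v \<in> ?V" using v nnspan_V by blast
    then show ?thesis using key drop_c fST ST v by blast
  qed
  then show "weakly_separable Z S" unfolding weakly_separable_def T_def using nnspan_0 by blast
qed

section \<open>Affine subsystems of type A2\<close>

lemma X_if_height: "r \<in> rts \<Longrightarrow> 0 < height r \<Longrightarrow> r \<in> X"
  and neg_X_if_height: "r \<in> rts \<Longrightarrow> height r \<le> 0 \<Longrightarrow> - r \<in> X"
  using rts_X[of r] X_height[of r] X_height[of "- r"] by (auto simp: height_simps)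

definition primitive :: "'a set \<Rightarrow> 'a \<Rightarrow> bool" where
  "primitive C d \<longleftrightarrow> C \<in> comps \<and> d \<in> lat \<and> d \<in> span C \<and> B d d = 0 \<and> d \<noteq> 0 \<and> d \<in> nnspan P \<and>
    (\<forall>y. y \<in> lat \<longrightarrow> y \<in> span C \<longrightarrow> B y y = 0 \<longrightarrow> (\<exists>k::int. y = of_int k *\<^sub>R d))"

lemma primitive_exists:
  assumes "C \<in> comps" "e \<in> lat" "e \<in> span C" "B e e = 0" "e \<noteq> 0"
  obtains d where "primitive C d"
  using primitive_iso[OF assms] assms(1) unfolding primitive_def by metis

lemma primitive_simps:
  assumes "primitive C d"
  shows "C \<in> comps" "d \<in> lat" "d \<in> span C" "B d d = 0" "d \<noteq> 0" "d \<in> nnspan P" "d \<in> span P" "0 < height d"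
  using assms height_pos nnspan_P_span by (auto simp: primitive_def)

lemma primitive_multiple:
  assumes "primitive C d" "y \<in> lat" "y \<in> span C" "B y y = 0"
  obtains k :: int where "y = of_int k *\<^sub>R d"
  using assms by (auto simp: primitive_def)

lemma primitive_B:
  assumes "primitive C d" "x \<in> span P"
  shows "B d x = 0" "B x d = 0"
  using iso_radical[of d x] primitive_simps[OF assms(1)] assms(2) B_sym[of x d] by auto

lemma rts_shift:
  assumes "primitive C d" "r \<in> rts" "r \<in> span C"
  shows "r + of_int k *\<^sub>R d \<in> rts" "r + of_int k *\<^sub>R d \<in> span C"
proof -
  note d = primitive_simps[OF assms(1)]
  show "r + of_int k *\<^sub>R d \<in> rts"
    using d by (intro rts_add_iso[OF assms(2) d(1) assms(3)]) (auto simp: lat_simps span_scale B_simps)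
  show "r + of_int k *\<^sub>R d \<in> span C" using assms d by (intro span_add span_scale)
qed

text \<open>Selects from the translates of a root by multiples of d one lying between 0 and d in the
  root poset.\<close>

definition level0 :: "'a set \<Rightarrow> 'a \<Rightarrow> 'a \<Rightarrow> bool" where
  "level0 C d u \<longleftrightarrow> u \<in> X \<and> d - u \<in> X \<and> u \<in> span C"

lemma level0_exists:
  assumes "primitive C d" "r \<in> rts" "r \<in> span C"
  obtains k :: int where "level0 C d (r + of_int k *\<^sub>R d)"
proof -
  note d = primitive_simps[OF assms(1)]
  define k where "k = \<lfloor>- height r / height d\<rfloor> + 1"
  have "- height r / height d < of_int k" "of_int (k - 1) \<le> - height r / height d"
    unfolding k_def by linarith+
  then have k: "0 < height r + of_int k * height d" "height r + of_int (k - 1) * height d \<le> 0"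
    using d(8) by (simp_all add: field_simps)
  have "r + of_int k *\<^sub>R d \<in> X"
    using X_if_height[OF rts_shift(1)[OF assms]] k by (simp add: height_simps)
  moreover have "- (r + of_int (k - 1) *\<^sub>R d) \<in> X"
    using neg_X_if_height[OF rts_shift(1)[OF assms], of "k - 1"] k(2) by (simp add: height_simps)
  moreover have "- (r + of_int (k - 1) *\<^sub>R d) = d - (r + of_int k *\<^sub>R d)" by (simp add: algebra_simps)
  ultimately have "level0 C d (r + of_int k *\<^sub>R d)"
    using rts_shift(2)[OF assms] unfolding level0_def by metis
  then show thesis by (rule that)
qed

lemma level0_flip: "primitive C d \<Longrightarrow> level0 C d u \<Longrightarrow> level0 C d (d - u)"
  using primitive_simps by (auto simp: level0_def span_diff)

text \<open>The simple roots of an affine subsystem of type A2, whose diagram is a triangle; d is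
  its null root.\<close>

definition triangle :: "'a set \<Rightarrow> 'a \<Rightarrow> 'a \<Rightarrow> 'a \<Rightarrow> 'a \<Rightarrow> bool" where
  "triangle C d u v w \<longleftrightarrow> primitive C d \<and> level0 C d u \<and> level0 C d v \<and> level0 C d w \<and> u + v + w = d \<and>
     B u v = -1 \<and> B v w = -1 \<and> B u w = -1"

text \<open>The representatives between 0 and d of p, q and -(p + q) add up to m d, and comparing
  heights leaves m = 1 or m = 2. For m = 2, replacing each by its difference from d gives the sum 3d
  - 2d = d and keeps the pairings, since d is in the radical.\<close>

lemma triangle_exists:
  assumes d: "primitive C d" and p: "p \<in> rts" "p \<in> span C" and q: "q \<in> rts" "q \<in> span C" and pq: "B p q = -1"
  obtains u v w where "triangle C d u v w" "p \<in> span {u, v, d}" "q \<in> span {u, v, d}"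
proof -
  note ds = primitive_simps[OF d]
  obtain k :: int where k: "level0 C d (p + of_int k *\<^sub>R d)" using level0_exists[OF d p] .
  obtain l :: int where l: "level0 C d (q + of_int l *\<^sub>R d)" using level0_exists[OF d q] .
  define p' q' where "p' = p + of_int k *\<^sub>R d" "q' = q + of_int l *\<^sub>R d"
  have p': "level0 C d p'" "p' \<in> rts" "p' \<in> X" and q': "level0 C d q'" "q' \<in> rts" "q' \<in> X"
    using k l X_rts by (auto simp: p'_q'_def level0_def)
  note pP = span_comp_span[OF ds(1) p(2)] and qP = span_comp_span[OF ds(1) q(2)]
  have B1: "B p' q' = -1"
    using pq ds primitive_B[OF d pP] primitive_B[OF d qP] by (simp add: p'_q'_def B_simps)
  define s where "s = - (p' + q')"
  have s: "s \<in> rts" using rts_neg[OF rts_add[OF p'(2) q'(2) B1]] by (simp add: s_def)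
  have sC: "s \<in> span C" unfolding s_def using p' q' by (intro span_neg span_add) (auto simp: level0_def)
  obtain m :: int where m: "level0 C d (s + of_int m *\<^sub>R d)" using level0_exists[OF d s sC] .
  define r where "r = s + of_int m *\<^sub>R d"
  have r: "level0 C d r" using m r_def by simp
  have sum: "p' + q' + r = of_int m *\<^sub>R d" by (simp add: r_def s_def)
  have norms: "B p' p' = 2" "B q' q' = 2" using X_norm p' q' by auto
  note p'P = X_span[OF p'(3)] and q'P = X_span[OF q'(3)]
  have B2: "B q' r = -1" "B p' r = -1"
    using norms B1 B_sym[of q' p'] primitive_B[OF d p'P] primitive_B[OF d q'P]
    by (simp_all add: r_def s_def B_simps)
  have ht: "0 < height x" "height x < height d" if "level0 C d x" for x
    using that X_height[of x] X_height[of "d - x"] by (auto simp: level0_def height_simps)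
  have "height p' + height q' + height r = of_int m * height d"
    using arg_cong[OF sum, of height] by (simp add: height_simps)
  then have "0 < of_int m * height d" "of_int m * height d < 3 * height d"
    using ht[OF p'(1)] ht[OF q'(1)] ht[OF r] by linarith+
  then have "0 < real_of_int m" "real_of_int m < 3" using ds(8) by (simp_all add: zero_less_mult_iff)
  then consider "m = 1" | "m = 2" by linarith
  then show thesis
  proof cases
    case 1
    have "triangle C d p' q' r" using d p' q' r sum 1 B1 B2 by (simp add: triangle_def)
    moreover have "p = p' - of_int k *\<^sub>R d" "q = q' - of_int l *\<^sub>R d" by (simp_all add: p'_q'_def)
    then have "p \<in> span {p', q', d}" "q \<in> span {p', q', d}"
      by (auto intro!: span_diff span_scale intro: span_base)
    ultimately show thesis using that by blast
  next
    case 2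
    have sum': "p' + q' + r = d + d" using sum 2 by (simp add: scaleR_2)
    have "(d - p') + (d - q') + (d - r) = (d + d + d) - (p' + q' + r)" by (simp add: algebra_simps)
    then have "(d - p') + (d - q') + (d - r) = d" unfolding sum' by simp
    moreover have "B (d - x) (d - y) = B x y" if "x \<in> span P" "y \<in> span P" for x y
      using that ds(4) primitive_B[OF d] by (simp add: B_simps)
    moreover have "r \<in> span P" using r X_span by (auto simp: level0_def)
    ultimately have "triangle C d (d - p') (d - q') (d - r)"
      using d p'(1) q'(1) r B1 B2 p'P q'P level0_flip[OF d] by (simp add: triangle_def)
    moreover have "p = d - (d - p') - of_int k *\<^sub>R d" "q = d - (d - q') - of_int l *\<^sub>R d" by (simp_all add: p'_q'_def)
    then have "p \<in> span {d - p', d - q', d}" "q \<in> span {d - p', d - q', d}"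
      by (metis span_diff span_scale span_base insertI1 insertI2)+
    ultimately show thesis using that by blast
  qed
qed

text \<open>Modulo d, the pairings of x with u and v determine its coordinates, and the norm leaves
  the six roots of A2. The multiple of d is integral because d is primitive, and its range follows
  from positive height.\<close>

lemma triangle_roots:
  assumes t: "triangle C d u v w" and x: "x \<in> X" "x \<in> span {u, v, d}"
  shows "\<exists>i\<in>{u, v, w}. \<exists>k::nat. x = i + real k *\<^sub>R d \<or> x = (real k + 1) *\<^sub>R d - i"
proof -
  have d: "primitive C d" and lev: "level0 C d u" "level0 C d v" "level0 C d w"
    and w: "w = d - u - v" and B: "B u v = -1"
    using t by (auto simp: triangle_def algebra_simps)
  note ds = primitive_simps[OF d]
  have uX: "u \<in> X" "v \<in> X" "w \<in> X" using lev by (auto simp: level0_def)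
  obtain l m n where x_eq: "x = l *\<^sub>R u + m *\<^sub>R v + n *\<^sub>R d"
    using x(2) by (auto simp: span_insert span_singleton algebra_simps)
  note z = primitive_B[OF d X_span[OF uX(1)]] primitive_B[OF d X_span[OF uX(2)]] primitive_B[OF d X_span[OF x(1)]]
  have Bu: "B x u = 2 * l - m" and Bv: "B x v = 2 * m - l"
    using z B B_sym[of v u] X_norm uX unfolding x_eq by (simp_all add: B_simps)
  have "B x x = l * B u x + m * B v x + n * B d x" by (subst (1) x_eq) (simp add: B_simps)
  then have nx: "2 = l * (2 * l - m) + m * (2 * m - l)"
    using z Bu Bv B_sym[of u x] B_sym[of v x] X_norm[OF x(1)] by simp
  have mem: "2 * l - m \<in> {-2, -1, 0, 1, 2}" "2 * m - l \<in> {-2, -1, 0, 1, 2}"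
    using rts_B_cases[of x u] rts_B_cases[of x v] X_rts x uX unfolding Bu Bv by auto
  have lm: "(l, m) \<in> {(1, 0), (-1, 0), (0, 1), (0, -1), (1, 1), (-1, -1)}"
  proof -
    define a b where "a = 2 * l - m" "b = 2 * m - l"
    have lm: "l = (2 * a + b) / 3" "m = (a + 2 * b) / 3" by (simp_all add: a_b_def)
    have "2 = l * a + m * b" using nx by (simp add: a_b_def)
    moreover have "a \<in> {-2, -1, 0, 1, 2}" "b \<in> {-2, -1, 0, 1, 2}" using mem by (simp_all add: a_b_def)
    ultimately show ?thesis unfolding lm by (elim insertE emptyE) simp_all
  qed
  have C: "u \<in> span C" "v \<in> span C" using lev by (auto simp: level0_def)
  have "x \<in> span C"
  proof (rule rts_same_comp)
    show "u \<in> rts" "x \<in> rts" using uX x X_rts by auto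
    show "C \<in> comps" "u \<in> span C" using ds C by auto
    show "B u x \<noteq> 0" using lm Bu B_sym[of u x] by auto
  qed
  then have nd: "n *\<^sub>R d \<in> span C" using ds span_scale by blast
  have "n *\<^sub>R d = x - (l *\<^sub>R u + m *\<^sub>R v)" by (simp add: x_eq)
  moreover have "l \<in> \<int>" "m \<in> \<int>" using lm by auto
  ultimately have "n *\<^sub>R d \<in> lat" using x uX X_rts rts_lat lat_simps by metis
  then obtain k :: int where "n *\<^sub>R d = of_int k *\<^sub>R d"
    using primitive_multiple[OF d _ nd] ds(4) by (metis B_simps(3) mult_zero_right B_simps(4) real_scaleR_def)
  then have n: "n = of_int k" using ds(5) by simp
  have h: "height u < height d" "height v < height d" "height w < height d" "0 < height u" "0 < height v" "0 < height w"
    using lev X_height[of "d - u"] X_height[of "d - v"] X_height[of "d - w"] X_height uX by (auto simp: level0_def height_simps)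
  have up: "\<exists>k::nat. x = i + real k *\<^sub>R d" if "x = i + of_int k *\<^sub>R d" "height i < height d" for i k
  proof -
    have "0 < height i + of_int k * height d" using X_height[OF x(1)] that by (simp add: height_simps)
    then have "0 < (1 + of_int k) * height d" using that by (simp add: algebra_simps)
    then have "0 < (1 + real_of_int k)" using ds(8) by (simp add: zero_less_mult_iff)
    then have "0 \<le> k" by linarith
    then have "x = i + real (nat k) *\<^sub>R d" using that by simp
    then show ?thesis by blast
  qed
  have down: "\<exists>k::nat. x = (real k + 1) *\<^sub>R d - i" if "x = of_int k *\<^sub>R d - i" "0 < height i" for i k
  proof -
    have "0 < of_int k * height d - height i" using X_height[OF x(1)] that by (simp add: height_simps)
    then have "0 < of_int k * height d" using that by (simp add: algebra_simps)
    then have "0 < real_of_int k" using ds(8) by (simp add: zero_less_mult_iff)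
    then have "real (nat (k - 1)) + 1 = of_int k" by simp
    then have "x = (real (nat (k - 1)) + 1) *\<^sub>R d - i" using that by simp
    then show ?thesis by blast
  qed
  \<comment> \<open>The coordinates (1, 1) and (-1, -1) stand for u + v = d - w and its negative,
    which shifts the multiple of d by one.\<close>
  consider "x = u + of_int k *\<^sub>R d" | "x = of_int k *\<^sub>R d - u" | "x = v + of_int k *\<^sub>R d" | "x = of_int k *\<^sub>R d - v"
    | "x = of_int (k + 1) *\<^sub>R d - w" | "x = w + of_int (k - 1) *\<^sub>R d"
    using lm unfolding x_eq n w by (auto simp: algebra_simps)
  then show ?thesis using up down h by cases blast+
qed

text \<open>Pairing a relation with u and v makes its three coefficients equal, so it is a multiple
  of u + v + w = d, which is nonzero.\<close>

lemma triangle_independent: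
  assumes t: "triangle C d u v w"
  shows "independent {u, v, w}" "card {u, v, w} = 3"
proof -
  have "primitive C d" and sum: "u + v + w = d" and X: "u \<in> X" "v \<in> X" "w \<in> X"
    and B: "B u v = -1" "B v w = -1" "B u w = -1"
    using t by (auto simp: triangle_def level0_def)
  then have d: "d \<noteq> 0" using primitive_simps by blast
  note B' = B B_sym[of v u] B_sym[of w v] B_sym[of w u] X_norm[OF X(1)] X_norm[OF X(2)] X_norm[OF X(3)]
  have ne: "u \<noteq> v" "v \<noteq> w" "u \<noteq> w" using B' by auto
  then show "card {u, v, w} = 3" by simp
  show "independent {u, v, w}"
  proof (rule independent_if_scalars_zero)
    fix f x assume f: "(\<Sum>x\<in>{u, v, w}. f x *\<^sub>R x) = 0" and x: "x \<in> {u, v, w}"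
    have e: "f u *\<^sub>R u + f v *\<^sub>R v + f w *\<^sub>R w = 0" using f ne by (simp add: add.assoc)
    have "B y (f u *\<^sub>R u + f v *\<^sub>R v + f w *\<^sub>R w) = 0" for y unfolding e by (simp add: B_simps)
    from this[of u] this[of v] have "2 * f u - f v - f w = 0" "2 * f v - f u - f w = 0"
      using B' by (simp_all add: B_simps)
    then have eq: "f v = f u" "f w = f u" by linarith+
    then have "f u *\<^sub>R d = 0" using e unfolding eq sum[symmetric] by (simp add: scaleR_add_right)
    then show "f x = 0" using d eq x by auto
  qed simp
qed

text \<open>The order ideal property tells which indices occur together, closedness tells which sums
  are forbidden; these are the hypotheses of \<open>hexagon_cut\<close>. Independence of u, v, w
  turns the three values found there into a linear functional.\<close>

lemma clean_triangle:
  assumes t: "triangle C d u v w" and fin: "finite Z" and Z: "Z \<subseteq> X" "Z \<subseteq> span {u, v, d}"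
    and ideal: "\<And>y z. z \<in> Z \<Longrightarrow> y \<in> X \<Longrightarrow> y \<in> span {u, v, d} \<Longrightarrow> z - y \<in> nnspan P \<Longrightarrow> y \<in> Z"
  shows "clean Z"
  unfolding clean_def
proof (intro allI impI)
  fix S assume S: "biclosed_in Z S"
  define T where "T = Z - S"
  have ST: "S \<subseteq> Z" "T \<subseteq> Z" "S \<inter> T = {}" "S \<union> T = Z" and clS: "closed_in Z S" and clT: "closed_in Z T"
    using S by (auto simp: T_def biclosed_in_def)
  have d: "primitive C d" and lev: "level0 C d u" "level0 C d v" "level0 C d w" and sum: "u + v + w = d"
    using t by (auto simp: triangle_def)
  note ds = primitive_simps[OF d]
  let ?I = "{u, v, w}"
  have levI: "level0 C d i" if "i \<in> ?I" for i using lev that by auto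
  have IX: "i \<in> X" "d - i \<in> X" "i \<in> span C" if "i \<in> ?I" for i using levI[OF that] by (auto simp: level0_def)
  have Inn: "i \<in> nnspan P" "d - i \<in> nnspan P" if "i \<in> ?I" for i using IX[OF that] X_nn by auto
  have w_eq: "w = d - u - v" using sum by (simp add: algebra_simps)
  have Isp: "i \<in> span {u, v, d}" if "i \<in> ?I" for i
  proof -
    have "d - u - v \<in> span {u, v, d}" by (intro span_diff span_base) auto
    moreover have "u \<in> span {u, v, d}" "v \<in> span {u, v, d}" by (simp_all add: span_base)
    ultimately show ?thesis using that w_eq by auto
  qed
  have dsp: "d \<in> span {u, v, d}" by (simp add: span_base)
  define A where "A i k = i + real k *\<^sub>R d" for i k
  define E where "E i k = (real k + 1) *\<^sub>R d - i" for i k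
  have A_X: "A i k \<in> X" "A i k \<in> span {u, v, d}" if "i \<in> ?I" for i k
  proof -
    have "A i k \<in> rts" unfolding A_def using rts_shift(1)[OF d X_rts[OF IX(1)[OF that]] IX(3)[OF that], of "int k"] by simp
    moreover have "A i k \<in> nnspan P" unfolding A_def using Inn[OF that] ds by (intro nnspan_P_add nnspan_P_scale) auto
    ultimately show "A i k \<in> X" by (simp add: X_iff)
    show "A i k \<in> span {u, v, d}" unfolding A_def using Isp[OF that] dsp by (intro span_add span_scale)
  qed
  have E_X: "E i k \<in> X" "E i k \<in> span {u, v, d}" if "i \<in> ?I" for i k
  proof -
    have E2: "E i k = (d - i) + real k *\<^sub>R d" by (simp add: E_def algebra_simps)
    have "d - i \<in> span C" using IX(3)[OF that] ds span_diff by blast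
    then have "E i k \<in> rts" unfolding E2 using rts_shift(1)[OF d X_rts[OF IX(2)[OF that]], of "int k"] by simp
    moreover have "E i k \<in> nnspan P" unfolding E2 using Inn[OF that] ds by (intro nnspan_P_add nnspan_P_scale) auto
    ultimately show "E i k \<in> X" by (simp add: X_iff)
    show "E i k \<in> span {u, v, d}" unfolding E_def using Isp[OF that] dsp by (intro span_diff span_scale)
  qed
  have dk: "c *\<^sub>R d \<in> nnspan P" if "0 \<le> c" for c using that ds nnspan_P_scale by blast
  have sumI: "i + j + l = d" if "i \<in> ?I" "j \<in> ?I" "l \<in> ?I" "distinct [i, j, l]" for i j l
    using that sum by (auto simp: algebra_simps)
  have AAE: "E l (p + q) = A i p + A j q" and EEA: "A l (Suc (p + q)) = E i p + E j q"
    if "i \<in> ?I" "j \<in> ?I" "l \<in> ?I" "distinct [i, j, l]" for i j l p q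
  proof -
    have l: "l = d - i - j" using sumI[OF that] by (simp add: algebra_simps)
    show "E l (p + q) = A i p + A j q" "A l (Suc (p + q)) = E i p + E j q"
      unfolding l by (simp_all add: A_def E_def algebra_simps)
  qed
  have AE_A: "A i m \<in> nnspan {A i p, E i q}" and EA_E: "E i m \<in> nnspan {E i p, A i q}" if "p < m" for i p q m
  proof -
    \<comment> \<open>Obtained by comparing multiples of d in A i m = (1 + b) A i p + b E i q, where
      i has coefficient (1 + b) - b = 1 in any case. The same b serves for E i m.\<close>
    define b where "b = (real m - real p) / (real p + real q + 1)"
    have b: "b * (real p + real q + 1) = real m - real p" "0 \<le> b"
      unfolding b_def using that by (simp_all add: add_nonneg_pos)
    have "real m = (1 + b) * real p + b * (real q + 1)" using b by (simp add: algebra_simps)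
    then have "A i m = (1 + b) *\<^sub>R A i p + b *\<^sub>R E i q"
      unfolding A_def E_def by (simp add: scaleR_add_left scaleR_add_right scaleR_diff_right algebra_simps)
    then show "A i m \<in> nnspan {A i p, E i q}" unfolding nnspan_pair using b by (metis add_nonneg_nonneg zero_le_one)
    have "real m + 1 = (1 + b) * (real p + 1) + b * real q" using b by (simp add: algebra_simps)
    then have "E i m = (1 + b) *\<^sub>R E i p + b *\<^sub>R A i q"
      unfolding A_def E_def by (simp add: scaleR_add_left scaleR_add_right scaleR_diff_right algebra_simps)
    then show "E i m \<in> nnspan {E i p, A i q}" unfolding nnspan_pair using b by (metis add_nonneg_nonneg zero_le_one)
  qed
  have pair: "x + y \<in> nnspan {x, y}" for x y :: 'a
    unfolding nnspan_pair by (intro exI[of _ 1]) simp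
  have clZ: "False" if "closed_in Z R" "x \<in> R" "y \<in> R" "z \<in> Z" "z \<notin> R" "z \<in> nnspan {x, y}" for R x y z
    using that unfolding closed_in_def by blast
  \<comment> \<open>A root of index k has height above k times that of d, so the finiteness of Z
    bounds the indices.\<close>
  define M where "M = nat \<lceil>Max (insert 0 (height ` Z)) / height d\<rceil> + 1"
  have bound: "k < M" if "z \<in> Z" "real k * height d < height z" for z k
  proof -
    have "height z \<le> Max (insert 0 (height ` Z))" using fin that by simp
    then have "real k < Max (insert 0 (height ` Z)) / height d" using that ds(8) by (simp add: field_simps)
    then show ?thesis unfolding M_def by linarith
  qed
  have hI: "0 < height i" "height i < height d" if "i \<in> ?I" for i
    using X_height[OF IX(1)[OF that]] X_height[OF IX(2)[OF that]] by (simp_all add: height_simps)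
  have bA: "k < M" if "i \<in> ?I" "A i k \<in> Z" for i k
    by (rule bound[OF that(2)]) (use hI[OF that(1)] in \<open>simp add: A_def height_simps\<close>)
  have bE: "k < M" if "i \<in> ?I" "E i k \<in> Z" for i k
    by (rule bound[OF that(2)]) (use hI[OF that(1)] in \<open>simp add: E_def height_simps algebra_simps\<close>)
  have le1: "A i p \<in> Z" if "i \<in> ?I" "A i k \<in> Z" "p \<le> k" for i k p
  proof (rule ideal[OF that(2) A_X[OF that(1)]])
    have "A i k - A i p = (real k - real p) *\<^sub>R d" by (simp add: A_def algebra_simps)
    then show "A i k - A i p \<in> nnspan P" using dk that by simp
  qed
  have le2: "E i p \<in> Z" if "i \<in> ?I" "E i k \<in> Z" "p \<le> k" for i k p
  proof (rule ideal[OF that(2) E_X[OF that(1)]])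
    have "E i k - E i p = (real k - real p) *\<^sub>R d" by (simp add: E_def algebra_simps)
    then show "E i k - E i p \<in> nnspan P" using dk that by simp
  qed
  have le3: "E j p \<in> Z" if "i \<in> ?I" "j \<in> ?I" "A i k \<in> Z" "p < k" for i j k p
  proof (rule ideal[OF that(3) E_X[OF that(2)]])
    have "A i k - E j p = i + j + (real k - real p - 1) *\<^sub>R d" by (simp add: A_def E_def algebra_simps)
    moreover have "i + j + (real k - real p - 1) *\<^sub>R d \<in> nnspan P"
      using Inn[OF that(1)] Inn[OF that(2)] that(4) by (intro nnspan_P_add dk) auto
    ultimately show "A i k - E j p \<in> nnspan P" by simp
  qed
  have le4: "A i p \<in> Z" if "i \<in> ?I" "E i k \<in> Z" "p < k" for i k p
  proof (rule ideal[OF that(2) A_X[OF that(1)]])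
    have "E i k - A i p = (d - i) + (d - i) + (real k - real p - 1) *\<^sub>R d" by (simp add: A_def E_def algebra_simps)
    moreover have "(d - i) + (d - i) + (real k - real p - 1) *\<^sub>R d \<in> nnspan P"
      using Inn[OF that(1)] that(3) by (intro nnspan_P_add dk) auto
    ultimately show "E i k - A i p \<in> nnspan P" by simp
  qed
  \<comment> \<open>Here p = k is allowed because d - i - j is the third simple root. For i = j, as
    in \<open>le4\<close>, the vector d - 2i need not be nonnegative, and p < k is required.\<close>
  have le5: "A j p \<in> Z" if ij: "i \<in> ?I" "j \<in> ?I" "i \<noteq> j" and k: "E i k \<in> Z" "p \<le> k" for i j k p
  proof (rule ideal[OF k(1) A_X[OF ij(2)]])
    have "u \<noteq> v" "v \<noteq> w" "u \<noteq> w" using triangle_independent(2)[OF t] by (auto simp: card_insert_if split: if_splits)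
    then have "\<exists>l\<in>?I. distinct [i, j, l]" using ij by auto
    then obtain l where l: "l \<in> ?I" "distinct [i, j, l]" by blast
    have "E i k - A j p = (real k - real p) *\<^sub>R d + (d - i - j)" by (simp add: A_def E_def algebra_simps)
    also have "d - i - j = l" using sumI[OF ij(1,2) l] by (simp add: algebra_simps)
    finally have "E i k - A j p = (real k - real p) *\<^sub>R d + l" .
    moreover have "(real k - real p) *\<^sub>R d + l \<in> nnspan P"
      using Inn[OF l(1)] k(2) by (intro nnspan_P_add dk) auto
    ultimately show "E i k - A j p \<in> nnspan P" by simp
  qed
  define SA where "SA i k \<longleftrightarrow> i \<in> ?I \<and> A i k \<in> S" for i k
  define SE where "SE i k \<longleftrightarrow> i \<in> ?I \<and> E i k \<in> S" for i k
  define TA where "TA i k \<longleftrightarrow> i \<in> ?I \<and> A i k \<in> T" for i k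
  define TE where "TE i k \<longleftrightarrow> i \<in> ?I \<and> E i k \<in> T" for i k
  note defs = SA_def SE_def TA_def TE_def
  have ZA: "SA i k \<or> TA i k \<longleftrightarrow> i \<in> ?I \<and> A i k \<in> Z" for i k using ST unfolding defs by blast
  have ZE: "SE i k \<or> TE i k \<longleftrightarrow> i \<in> ?I \<and> E i k \<in> Z" for i k using ST unfolding defs by blast
  have inS: "x \<in> S \<Longrightarrow> x \<in> Z \<and> x \<notin> T" "x \<in> T \<Longrightarrow> x \<in> Z \<and> x \<notin> S" for x using ST by blast+
  interpret hexagon_cut ?I SA SE TA TE M
  proof (unfold_locales, goal_cases)
    case 1 show ?case using triangle_independent(2)[OF t] .
  next
    case (2 i k) then show ?case using inS unfolding defs by blast
  next
    case (3 i k) then show ?case using inS unfolding defs by blast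
  next
    case (4 i k) then show ?case unfolding ZA using bA by blast
  next
    case (5 i k) then show ?case unfolding ZE using bE by blast
  next
    case (6 i k p) then show ?case unfolding ZA using le1 by blast
  next
    case (7 i k p) then show ?case unfolding ZE using le2 by blast
  next
    case (8 i j k p) then show ?case unfolding ZE ZA using le3 by blast
  next
    case (9 i k p) then show ?case unfolding ZE ZA using le4 by blast
  next
    case (10 i j k p) then show ?case unfolding ZE ZA using le5 by blast
  next
    case (11 i j l p q)
    then show ?case using clZ[OF clS _ _ _ _ pair, of "A i p" "A j q"] AAE[OF 11(1-4)] inS unfolding defs by metis
  next
    case (12 i j l p q)
    then show ?case using clZ[OF clT _ _ _ _ pair, of "A i p" "A j q"] AAE[OF 12(1-4)] inS unfolding defs by metis
  next
    case (13 i j l p q)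
    then show ?case using clZ[OF clS _ _ _ _ pair, of "E i p" "E j q"] EEA[OF 13(1-4)] inS unfolding defs by metis
  next
    case (14 i j l p q)
    then show ?case using clZ[OF clT _ _ _ _ pair, of "E i p" "E j q"] EEA[OF 14(1-4)] inS unfolding defs by metis
  next
    case (15 i p q m)
    then show ?case using clZ[OF clS _ _ _ _ AE_A[OF 15(5)]] inS unfolding defs by metis
  next
    case (16 i p q m)
    then show ?case using clZ[OF clT _ _ _ _ AE_A[OF 16(5)]] inS unfolding defs by metis
  next
    case (17 i p q m)
    then show ?case using clZ[OF clS _ _ _ _ EA_E[OF 17(5)]] inS unfolding defs by metis
  next
    case (18 i p q m)
    then show ?case using clZ[OF clT _ _ _ _ EA_E[OF 18(5)]] inS unfolding defs by metis
  qed
  obtain x where x: "separated x" using ex_separated by blast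
  obtain f where f: "linear f" "\<forall>i\<in>?I. f i = x i"
    using linear_independent_extend[OF triangle_independent(1)[OF t], of x] by blast
  have "f d = x u + x v + x w" using f unfolding sum[symmetric] by (simp add: linear_add)
  then have fd: "f d = sum x ?I" using triangle_independent(2)[OF t] by (auto simp: card_insert_if split: if_splits)
  have fA: "f (A i k) = x i + real k * sum x ?I" and fE: "f (E i k) = (real k + 1) * sum x ?I - x i" if "i \<in> ?I" for i k
    using f that fd by (auto simp: A_def E_def linear_add linear_diff linear_cmul)
  have form: "\<exists>i\<in>?I. \<exists>k. z = A i k \<or> z = E i k" if "z \<in> Z" for z
    using triangle_roots[OF t] Z that unfolding A_def E_def by blast
  show "weakly_separable Z S"
  proof (rule weakly_separable_linear[OF f(1)])
    fix z assume z: "z \<in> S"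
    then obtain i k where "i \<in> ?I" "z = A i k \<or> z = E i k" using form ST by blast
    then show "0 < f z" using x z fA fE unfolding separated_def defs by metis
  next
    fix z assume z: "z \<in> Z - S"
    then have "z \<in> T" by (simp add: T_def)
    moreover obtain i k where "i \<in> ?I" "z = A i k \<or> z = E i k" using form z by blast
    ultimately show "f z < 0" using x fA fE unfolding separated_def defs by metis
  qed
qed

section \<open>Full sets containing three roots\<close>

lemma full_span: "full X (X \<inter> span W)"
  unfolding full_def
proof (intro conjI ballI)
  fix a b assume "a \<in> X \<inter> span W" "b \<in> X \<inter> span W"
  then have "span {a, b} \<subseteq> span W" by (intro span_minimal subspace_span) auto
  then show "X \<inter> span W \<inter> span {a, b} = X \<inter> span {a, b}" by blast
qed simp

lemma X_proportional:
  assumes "a \<in> X" "x \<in> X" "x = c *\<^sub>R a"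
  shows "x = a"
proof -
  have "B x x = c * c * B a a" unfolding assms(3) by (simp add: B_simps)
  then have "c * c = 1" using X_norm assms(1,2) by simp
  then have "c = 1 \<or> c = -1" by (simp only: square_eq_1_iff)
  then show ?thesis using assms X_neg[OF assms(1)] by auto
qed

text \<open>Type A1 x A1: twice the coordinates are pairings, hence integers between -2 and 2, and
  the norm gives \<open>l * l + m * m = 1\<close>, so one coordinate vanishes.\<close>

lemma orthogonal_plane_roots:
  assumes a: "a \<in> X" and c: "c \<in> X" and orth: "B a c = 0" and x: "x \<in> X" "x \<in> span {a, c}"
  shows "x = a \<or> x = c"
proof -
  obtain l m where x_eq: "x = l *\<^sub>R a + m *\<^sub>R c" using plane_coordinates[OF x(2)] .
  have "B x a = 2 * l" "B x c = 2 * m" "B x x = 2 * (l * l + m * m)"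
    using X_norm[OF a] X_norm[OF c] orth B_sym[of c a] unfolding x_eq by (simp_all add: B_simps algebra_simps)
  then have "2 * l \<in> {-2, -1, 0, 1, 2}" "2 * m \<in> {-2, -1, 0, 1, 2}" "l * l + m * m = 1"
    using rts_B_cases[of x a] rts_B_cases[of x c] X_rts a c x X_norm[OF x(1)] by auto
  moreover have "t \<in> {-1, -1 / 2, 0, 1 / 2, 1}" if "2 * t \<in> {-2, -1, 0, 1, 2}" for t :: real
    using that by auto
  ultimately have lm: "l \<in> {-1, -1 / 2, 0, 1 / 2, 1}" "m \<in> {-1, -1 / 2, 0, 1 / 2, 1}" "l * l + m * m = 1" by blast+
  then have "l = 0 \<or> m = 0" by (elim insertE emptyE) simp_all
  then show ?thesis
  proof
    assume "l = 0"
    then show ?thesis using X_proportional[OF c x(1), of m] x_eq by simp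
  next
    assume "m = 0"
    then show ?thesis using X_proportional[OF a x(1), of l] x_eq by simp
  qed
qed

text \<open>For a and c distinct the Gram determinant is 4 minus the square of \<open>B a c\<close>,
  hence nonzero, while an isotropic vector lies in the kernel of the Gram matrix.\<close>

lemma definite_pair:
  assumes a: "a \<in> X" and c: "c \<in> X" and ac: "a = c \<or> \<bar>B a c\<bar> \<le> 1" and v: "v \<in> span {a, c}" "B v v = 0"
  shows "v = 0"
proof -
  obtain l m where v_eq: "v = l *\<^sub>R a + m *\<^sub>R c" using plane_coordinates[OF v(1)] .
  show ?thesis
  proof (cases "a = c")
    case True
    then have v_eq: "v = (l + m) *\<^sub>R a" using v_eq by (simp add: scaleR_add_left)
    then have "B v v = (l + m) * (l + m) * B a a" unfolding v_eq by (simp add: B_simps)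
    then have "l + m = 0" using v(2) X_norm[OF a] by simp
    then show ?thesis unfolding v_eq by simp
  next
    case False
    have vP: "v \<in> span P" unfolding v_eq using X_span a c by (intro span_add span_scale)
    have "B v a = 0" "B v c = 0" using iso_radical[OF vP v(2)] X_span a c by blast+
    then have e: "2 * l + m * B a c = 0" "l * B a c + 2 * m = 0"
      unfolding v_eq using X_norm[OF a] X_norm[OF c] B_sym[of c a] by (simp_all add: B_simps)
    have "B a c \<in> {-1, 0, 1}" using rts_B_cases[of a c] X_rts a c ac False by auto
    then have "l = 0 \<and> m = 0" using e by (elim insertE emptyE) simp_all
    then show ?thesis using v_eq by simp
  qed
qed

text \<open>\<open>D\<close> will be an initial segment of the ordering and \<open>A\<close> the set
  of the three given roots.\<close>

definition covered :: "'a set \<Rightarrow> 'a set \<Rightarrow> bool" where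
  "covered D A \<longleftrightarrow> (\<exists>F. full X F \<and> A \<subseteq> F \<and> clean (F \<inter> D))"

context
  fixes D :: "'a set"
  assumes finD: "finite D" and DX: "D \<subseteq> X"
    and ideal: "\<And>z y. z \<in> D \<Longrightarrow> y \<in> X \<Longrightarrow> z - y \<in> nnspan P \<Longrightarrow> y \<in> D"
begin

lemma covered_definite:
  assumes A: "A \<subseteq> X" and "\<And>v. v \<in> span A \<Longrightarrow> B v v = 0 \<Longrightarrow> v = 0"
  shows "covered D A"
proof -
  let ?Z = "X \<inter> span A \<inter> D"
  have "clean ?Z"
  proof (rule clean_definite)
    show "finite ?Z" "?Z \<subseteq> X" using finD by auto
    show "s - t \<in> ?Z" if "s \<in> ?Z" "t \<in> ?Z" "s - t \<in> X" for s t
      using that ideal[of s "s - t"] X_nn[of t] by (auto intro: span_diff)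
    show "v = 0" if "v \<in> span ?Z" "B v v = 0" for v
    proof -
      have "span ?Z \<subseteq> span A" by (intro span_minimal subspace_span) auto
      then show ?thesis using that assms(2) by blast
    qed
  qed
  then show ?thesis unfolding covered_def using full_span[of A] A span_superset[of A] by blast
qed

text \<open>Spans do not see the sign of q, so pairing -1 can be assumed; e only serves to produce
  the null root d, of which it is a multiple.\<close>

lemma covered_triangle:
  assumes C: "C \<in> comps" and p: "p \<in> X" "p \<in> span C" and q: "q \<in> X" "\<bar>B p q\<bar> = 1"
    and e: "e \<in> lat" "e \<in> span C" "B e e = 0" "e \<noteq> 0" and A: "A \<subseteq> X" "A \<subseteq> span {p, q, e}"
  shows "covered D A"
proof -
  obtain d where d: "primitive C d" using primitive_exists[OF C e] .
  obtain k :: int where k: "e = of_int k *\<^sub>R d" using primitive_multiple[OF d e(1-3)] .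
  have pr: "p \<in> rts" and qr: "q \<in> rts" using p q X_rts by auto
  have qC: "q \<in> span C" using rts_same_comp[OF pr qr _ C p(2)] q(2) by auto
  obtain q' where q': "q' \<in> rts" "q' \<in> span C" "B p q' = -1" "q = q' \<or> q = - q'"
  proof (cases "B p q = -1")
    case True
    then show thesis using that[of q] qr qC by simp
  next
    case False
    then have "B p (- q) = -1" using q(2) by (simp add: B_simps abs_if split: if_splits)
    then show thesis using that[of "- q"] rts_neg[OF qr] span_neg[OF qC] by simp
  qed
  obtain u v w where t: "triangle C d u v w" and pu: "p \<in> span {u, v, d}" and "q' \<in> span {u, v, d}"
    using triangle_exists[OF d pr p(2) q'(1-3)] .
  then have qu: "q \<in> span {u, v, d}" using q'(4) span_neg by auto
  have "e \<in> span {u, v, d}" unfolding k by (intro span_scale span_base) simp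
  then have "span {p, q, e} \<subseteq> span {u, v, d}" using pu qu by (intro span_minimal subspace_span) auto
  then have "A \<subseteq> X \<inter> span {u, v, d}" using A by blast
  moreover have "clean (X \<inter> span {u, v, d} \<inter> D)"
    by (rule clean_triangle[OF t]) (use finD ideal in auto)
  ultimately show ?thesis unfolding covered_def using full_span[of "{u, v, d}"] by blast
qed

text \<open>A pairing of 2 or -2 with a means differing from a or -a by an isotropic vector, so b
  lies in the plane of a and d. The third root c lies in that plane too, or spans affine A2 with a
  and d, or is orthogonal to the plane.\<close>

lemma covered_parallel:
  assumes a: "a \<in> X" and b: "b \<in> X" "a \<noteq> b" "\<bar>B a b\<bar> = 2" and c: "c \<in> X"
  shows "covered D {a, b, c}"
proof -
  note ar = X_rts[OF a] and br = X_rts[OF b(1)] and cr = X_rts[OF c]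
  obtain C where C: "C \<in> comps" "a \<in> span C" using rts_comp ar by blast
  have bC: "b \<in> span C" using rts_same_comp[OF ar br _ C] b(3) by auto
  have ex: "\<exists>s e. (s = 1 \<or> s = -1) \<and> x = s *\<^sub>R a + e \<and> e \<in> lat \<and> e \<in> span C \<and> B e e = 0"
    if x: "x \<in> rts" "x \<in> span C" "\<bar>B a x\<bar> = 2" for x
  proof -
    define s where "s = (if B a x = 2 then 1 else -1 :: real)"
    have s: "s = 1 \<or> s = -1" "B a x = 2 * s" using x(3) by (auto simp: s_def abs_if split: if_splits)
    have "B (x - s *\<^sub>R a) (x - s *\<^sub>R a) = 2 + 2 * s * s - 4 * s * s"
      using s(2) B_sym[of x a] rts_norm[OF x(1)] rts_norm[OF ar] by (simp add: B_simps)
    then have "B (x - s *\<^sub>R a) (x - s *\<^sub>R a) = 0" using s(1) by auto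
    moreover have "x - s *\<^sub>R a \<in> lat" using x rts_lat ar s(1) by (intro lat_simps(2,5)) auto
    moreover have "x - s *\<^sub>R a \<in> span C" using x C by (intro span_diff span_scale)
    ultimately show ?thesis using s(1) by (intro exI[of _ s] exI[of _ "x - s *\<^sub>R a"]) simp
  qed
  obtain s e where e: "s = 1 \<or> s = -1" "b = s *\<^sub>R a + e" "e \<in> lat" "e \<in> span C" "B e e = 0"
    using ex[OF br bC b(3)] by blast
  have e0: "e \<noteq> 0" using e(1,2) b(2) X_proportional[OF a b(1), of s] by auto
  obtain d where d: "primitive C d" using primitive_exists[OF C(1) e(3-5) e0] .
  note ds = primitive_simps[OF d]
  have par: "x \<in> span {a, d}" if x: "x \<in> rts" "x \<in> span C" "\<bar>B a x\<bar> = 2" for x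
  proof -
    obtain s e where x_eq: "x = s *\<^sub>R a + e" "e \<in> lat" "e \<in> span C" "B e e = 0" using ex[OF x] by blast
    then obtain k :: int where "e = of_int k *\<^sub>R d" using primitive_multiple[OF d] by blast
    then show ?thesis unfolding x_eq(1) by (auto intro!: span_add span_scale intro: span_base)
  qed
  have aV: "a \<in> span {a, d}" by (simp add: span_base)
  have bV: "b \<in> span {a, d}" using par br bC b by blast
  consider "\<bar>B a c\<bar> = 2" | "\<bar>B a c\<bar> = 1" | "B a c = 0" using rts_B_cases[OF ar cr] by auto
  then show ?thesis
  proof cases
    case 1
    have "c \<in> span C" using rts_same_comp[OF ar cr _ C] 1 by auto
    then have "c \<in> span {a, d}" using par cr 1 by blast
    moreover have "clean (X \<inter> span {a, d} \<inter> D)"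
      by (rule clean_affine_plane[of _ a d "{}" c]) (use finD a ds in auto)
    ultimately show ?thesis unfolding covered_def using full_span[of "{a, d}"] a b c aV bV by blast
  next
    case 2
    have "b \<in> span {a, c, e}" unfolding e(2) by (intro span_add span_scale span_base) auto
    then show ?thesis
      using a b c by (intro covered_triangle[OF C(1) a C(2) c 2 e(3-5) e0]) (auto intro: span_base)
  next
    case 3
    have orth: "B x c = 0" if x: "x \<in> span {a, d}" for x
    proof -
      obtain l m where "x = l *\<^sub>R a + m *\<^sub>R d" using plane_coordinates[OF x] .
      then show ?thesis using 3 primitive_B(1)[OF d X_span[OF c]] by (simp add: B_simps)
    qed
    have cV: "c \<notin> span {a, d}" using orth[of c] X_norm[OF c] by auto
    \<comment> \<open>Fullness concerns only planes spanned by two elements, and the plane of c and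
      a root orthogonal to it contains no third positive root.\<close>
    let ?F = "X \<inter> span {a, d} \<union> {c}"
    have "full X ?F" unfolding full_def
    proof (intro conjI ballI)
      show "?F \<subseteq> X" using c by blast
      fix x y assume xy: "x \<in> ?F" "y \<in> ?F"
      have "z \<in> ?F" if z: "z \<in> X" "z \<in> span {x, y}" for z
      proof (cases "x \<in> span {a, d} \<and> y \<in> span {a, d}")
        case True
        then have "span {x, y} \<subseteq> span {a, d}" by (intro span_minimal subspace_span) auto
        then show ?thesis using z by blast
      next
        case False
        then consider "x = c" "y = c" | "x \<in> X" "x \<in> span {a, d}" "y = c" | "y \<in> X" "y \<in> span {a, d}" "x = c"
          using xy by blast
        then show ?thesis
        proof cases
          case 1
          then obtain m where "z = m *\<^sub>R c" using z by (auto simp: span_singleton)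
          then show ?thesis using X_proportional[OF c z(1)] by blast
        next
          case 2
          then show ?thesis using orthogonal_plane_roots[OF 2(1) c orth[OF 2(2)] z(1)] z(2) by auto
        next
          case 3
          then show ?thesis using orthogonal_plane_roots[OF 3(1) c orth[OF 3(2)] z(1)] z(2)
            by (auto simp: insert_commute)
        qed
      qed
      then show "?F \<inter> span {x, y} = X \<inter> span {x, y}" using c by blast
    qed
    moreover have "clean (?F \<inter> D)"
      by (rule clean_affine_plane[of _ a d "{c}" c]) (use finD a c ds cV in auto)
    ultimately show ?thesis unfolding covered_def using a b aV bV by blast
  qed
qed

lemma covered_triple:
  assumes a: "a \<in> X" and b: "b \<in> X" and c: "c \<in> X"
  shows "covered D {a, b, c}"
proof (cases "\<forall>v\<in>span {a, b, c}. B v v = 0 \<longrightarrow> v = 0")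
  case True
  then show ?thesis using covered_definite[of "{a, b, c}"] a b c by blast
next
  case False
  then obtain v where v: "v \<in> span {a, b, c}" "B v v = 0" "v \<noteq> 0" by blast
  have cases_B: "\<bar>B x y\<bar> = 2 \<or> B x y \<in> {-1, 0, 1}" if "x \<in> X" "y \<in> X" for x y
    using rts_B_cases[of x y] that X_rts by auto
  show ?thesis
  proof (cases "(a \<noteq> b \<and> \<bar>B a b\<bar> = 2) \<or> (a \<noteq> c \<and> \<bar>B a c\<bar> = 2) \<or> (b \<noteq> c \<and> \<bar>B b c\<bar> = 2)")
    case True
    then show ?thesis
      using covered_parallel[of a b c] covered_parallel[of a c b] covered_parallel[of b c a] a b c
      by (auto simp: insert_commute)
  next
    case False
    then have small: "a = b \<or> B a b \<in> {-1, 0, 1}" "a = c \<or> B a c \<in> {-1, 0, 1}" "b = c \<or> B b c \<in> {-1, 0, 1}"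
      using cases_B a b c by blast+
    have pair: "v \<notin> span {x, y}" if "x \<in> X" "y \<in> X" "x = y \<or> B x y \<in> {-1, 0, 1}" for x y
      using definite_pair[of x y v] that v by auto
    have ne: "a \<noteq> b" "a \<noteq> c" "b \<noteq> c"
      using pair[OF a c small(2)] pair[OF a b small(1)] pair[OF b c small(3)] v(1) by (auto simp: insert_absorb2 insert_commute)
    define r s t where "r = B a b" "s = B a c" "t = B b c"
    note rst = this
    have rst_mem: "r \<in> {-1, 0, 1}" "s \<in> {-1, 0, 1}" "t \<in> {-1, 0, 1}" using small ne by (simp_all add: rst)
    obtain x y z where v_eq: "v = x *\<^sub>R a + y *\<^sub>R b + z *\<^sub>R c"
      using v(1) by (auto simp: span_insert span_singleton algebra_simps)
    have vP: "v \<in> span P" unfolding v_eq using X_span a b c by (intro span_add span_scale)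
    have "B v a = 0" "B v b = 0" "B v c = 0" using iso_radical[OF vP v(2)] X_span a b c by blast+
    then have eqs: "2 * x + r * y + s * z = 0" "r * x + 2 * y + t * z = 0" "s * x + t * y + 2 * z = 0"
      unfolding v_eq using X_norm[OF a] X_norm[OF b] X_norm[OF c] B_sym[of b a] B_sym[of c a] B_sym[of c b]
      by (simp_all add: rst B_simps algebra_simps)
    have "\<not> (x = 0 \<and> y = 0 \<and> z = 0)" using v(3) v_eq by auto
    \<comment> \<open>The isotropic vector makes the Gram matrix of a, b, c singular; checking the
      entries -1, 0, 1 leaves only all pairings nonzero with product -1.\<close>
    then have prod: "r * s * t = -1" "r * r = 1" "s * s = 1"
      using rst_mem eqs by (elim insertE emptyE; simp; argo)+
    \<comment> \<open>The coordinates (1, -r, -s) span the kernel of the Gram matrix, as t = - r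
      s.\<close>
    define e where "e = a - r *\<^sub>R b - s *\<^sub>R c"
    have "B e e = 2 + 2 * (r * r) + 2 * (s * s) - 2 * (r * r) - 2 * (s * s) + 2 * (r * s * t)"
      unfolding e_def using X_norm[OF a] X_norm[OF b] X_norm[OF c] B_sym[of b a] B_sym[of c a] B_sym[of c b]
      by (simp add: rst B_simps algebra_simps)
    then have ee: "B e e = 0" using prod by simp
    have c_eq: "c = s *\<^sub>R (a - r *\<^sub>R b - e)" using prod(3) by (simp add: e_def)
    have e0: "e \<noteq> 0"
    proof
      assume "e = 0"
      then have "c \<in> span {a, b}" using c_eq by (metis diff_zero insertI1 insertI2 span_base span_diff span_scale)
      then have "span {a, b, c} \<subseteq> span {a, b}" by (intro span_minimal subspace_span) (auto intro: span_base)
      then show False using pair[OF a b small(1)] v(1) by blast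
    qed
    have ints: "r \<in> \<int>" "s \<in> \<int>" using rst_mem by auto
    have rs0: "r \<noteq> 0" "s \<noteq> 0" using prod by auto
    obtain C where C: "C \<in> comps" "a \<in> span C" using rts_comp X_rts[OF a] by blast
    have bC: "b \<in> span C" "c \<in> span C"
      using rts_same_comp[OF X_rts[OF a] X_rts[OF b] _ C] rts_same_comp[OF X_rts[OF a] X_rts[OF c] _ C] rs0
      by (simp_all add: rst)
    have "e \<in> lat" unfolding e_def using ints X_rts rts_lat a b c by (intro lat_simps(2,5)) auto
    moreover have "e \<in> span C" unfolding e_def using C bC by (intro span_diff span_scale)
    moreover have "\<bar>B a b\<bar> = 1" using rst_mem(1) rs0(1) by (auto simp: rst)
    moreover have "c \<in> span {a, b, e}" by (subst c_eq) (intro span_scale span_diff span_base; simp)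
    ultimately show ?thesis
      using a b c ee e0 by (intro covered_triangle[OF C(1) a C(2) b, of e]) (auto intro: span_base)
  qed
qed

end

end

theorem theorem6p1:
  fixes B :: "'a::real_vector \<Rightarrow> 'a \<Rightarrow> real"
    and P :: "'a set"
    and g :: "nat \<Rightarrow> 'a"
    and N :: "nat set"
  assumes "fin_or_aff_simply_laced B P"
    and "ordering_of g N (pos_roots B P)"
    and "refines_root_poset P g N"
  shows "suitable g N (pos_roots B P)"
proof -
  interpret simply_laced_ade B P by unfold_locales (rule assms(1))
  have gN: "inj_on g N" "g ` N = X" using assms(2) by (auto simp: ordering_of_def bij_betw_def)
  have order: "i < j" if "i \<in> N" "j \<in> N" "g i \<noteq> g j" "g j - g i \<in> nnspan P" for i j
    using assms(3) that unfolding refines_root_poset_def by blast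
  show ?thesis
    unfolding suitable_def
  proof (intro conjI allI impI ballI assms(2))
    fix Y a b i j
    assume Y: "linear_subset X Y \<and> dim (span Y) = 2 \<and> fundamental_vectors Y a b"
      and ij: "i \<in> N" "j \<in> N" and gij: "(g i = a \<or> g i = b) \<and> g j \<in> Y - {a, b}"
    then have "g j - a \<in> nnspan P" "g j - b \<in> nnspan P"
      using fundamental_below[of Y a b "g j"] by blast+
    then show "i < j" using order[OF ij] gij by auto
  next
    fix i a b c
    let ?D = "g ` ({..<i} \<inter> N)"
    assume abc: "a \<in> ?D" "b \<in> ?D" "c \<in> ?D"
    have fin: "finite ?D" by simp
    have DX: "?D \<subseteq> X" using gN by blast
    have ideal: "y \<in> ?D" if z: "z \<in> ?D" and y: "y \<in> X" "z - y \<in> nnspan P" for z y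
    proof -
      obtain m n where m: "m < i" "m \<in> N" "z = g m" using z by auto
      obtain n where n: "n \<in> N" "y = g n" using y(1) gN(2) by blast
      show ?thesis
      proof (cases "y = z")
        case False
        then have "n < m" using order[OF n(1) m(2)] m n y(2) by simp
        then show ?thesis using m n by auto
      qed (use z in simp)
    qed
    have "covered ?D {a, b, c}"
      by (rule covered_triple[OF fin DX]) (use ideal abc DX in blast)+
    then show "\<exists>F. full X F \<and> a \<in> F \<and> b \<in> F \<and> c \<in> F \<and> clean (F \<inter> ?D)"
      unfolding covered_def by blast
  qed
qed

end
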